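(* Let $d\ge 2$. There exist a constant $\delta>0$ and a positive integer $N$, depending only on $d$, such that for every rational map $f$ of degree $d$ over $\mathbb{C}$ (with the standard absolute value) there are open sets $U_1,\dots,U_N$ covering $\mathbb{P}^1(\mathbb{C})$ such that $$g_f(x,y) > \delta\max\{-\log|\operatorname{res}(f)|,\,1\}$$ for all $i$ and all $x,y\in U_i$.
   Context: For a homogeneous lift $F=(P,Q)$ of $f$ with homogeneous resultant $\operatorname{Res}(F)\ne0$, let $\widehat H_F(z) = \lim_{n\to\infty}d^{-n}\log\|F^n(z)\|$ with $\|(x,y)\|=\max\{|x|,|y|\}$. The Arakelov–Green function is $g_f(x,y)=-\log|x_0y_1-x_1y_0|+\widehat H_F(\tilde x)+\widehat H_F(\tilde y)-\frac{1}{d(d-1)}\log|\operatorname{Res}(F)|$ for lifts $\tilde x=(x_0,x_1),\tilde y=(y_0,y_1)$ (independent of choices; $+\infty$ when $x=y$). For a lift with coefficients $a_i,b_j$, $|\operatorname{Res}(f)|=|\operatorname{Res}(F)|/\max\{|a_i|,|b_j|\}^{2d+2}$, and $|\operatorname{res}(f)|=\sup_{\varphi\in\operatorname{SL}_2(\mathbb{C})}|\operatorname{Res}(\varphi\circ f\circ\varphi^{-1})|$.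
   Formalization: In the definition of |Res(f)| the exponent of max{|a_i|,|b_j|} is taken to be 2d instead of the printed 2d+2, since with 2d+2 the quotient changes by |c|^{-2} when the lift F is replaced by cF and so is not a function of f; for lifts with maximum coefficient 1 both agree. *)

theory Defs
  imports
    "HOL-Analysis.Analysis"
    "HOL-Computational_Algebra.Computational_Algebra"
    "HOL-Computational_Algebra.Field_as_Ring"
    "Subresultants.Resultant_Prelim"
begin

definition cscale :: "complex \<Rightarrow> complex \<times> complex \<Rightarrow> complex \<times> complex" where
  "cscale c z = (c * fst z, c * snd z)"

definition proportional :: "complex \<times> complex \<Rightarrow> complex \<times> complex \<Rightarrow> bool" where
  "proportional u v \<longleftrightarrow> u \<noteq> 0 \<and> v \<noteq> 0 \<and> (\<exists>c. c \<noteq> 0 \<and> v = cscale c u)"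

lemma cscale_cscale [simp]: "cscale a (cscale b z) = cscale (a * b) z"
  by (simp add: cscale_def)

lemma cscale_1 [simp]: "cscale 1 z = z"
  by (simp add: cscale_def)

lemma cscale_eq_0_iff [simp]: "cscale c z = 0 \<longleftrightarrow> c = 0 \<or> z = 0"
  by (auto simp: cscale_def prod_eq_iff)

quotient_type cp1 = "complex \<times> complex" / partial: proportional
  morphisms rep_cp1 proj
proof (rule part_equivpI)
  show "\<exists>x. proportional x x"
    by (rule exI[of _ "(1, 0)"])
       (auto simp: proportional_def zero_prod_def intro: exI[of _ 1])
  show "symp proportional"
  proof (rule sympI)
    fix u v assume "proportional u v"
    then obtain c where "u \<noteq> 0" "v \<noteq> 0" "c \<noteq> 0" "v = cscale c u"
      by (auto simp: proportional_def)
    then show "proportional v u"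
      unfolding proportional_def by (auto intro!: exI[of _ "inverse c"])
  qed
  show "transp proportional"
  proof (rule transpI)
    fix u v w assume "proportional u v" "proportional v w"
    then show "proportional u w"
      by (auto simp: proportional_def) (metis mult_eq_0_iff)
  qed
qed

lemma proj_eq_iff:
  assumes "u \<noteq> 0" "v \<noteq> 0"
  shows "proj u = proj v \<longleftrightarrow> (\<exists>c. c \<noteq> 0 \<and> v = cscale c u)"
proof -
  have refl: "proportional z z" if "z \<noteq> 0" for z
    using that unfolding proportional_def by (auto intro!: exI[of _ 1])
  have "proj u = proj v \<longleftrightarrow> proportional u v"
    using Quotient_rel[OF Quotient_cp1, of u v] refl assms by blast
  then show ?thesis using assms by (simp add: proportional_def)
qed

lemma proportional_rep: "proportional (rep_cp1 x) (rep_cp1 x)"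
  by (rule Quotient_rep_reflp[OF Quotient_cp1])

lemma rep_cp1_nonzero [simp]: "rep_cp1 x \<noteq> 0"
  using proportional_rep[of x] by (simp add: proportional_def)

lemma proj_rep [simp]: "proj (rep_cp1 x) = x"
  by (rule Quotient_abs_rep[OF Quotient_cp1])

instantiation cp1 :: topological_space
begin

text \<open>The quotient topology; the punctured plane is open in the plane.\<close>

definition open_cp1 :: "cp1 set \<Rightarrow> bool" where
  "open_cp1 U \<longleftrightarrow> open {z. z \<noteq> 0 \<and> proj z \<in> U}"

instance
proof
  show "open (UNIV :: cp1 set)"
    unfolding open_cp1_def by (simp add: Collect_neg_eq[symmetric] open_Collect_neq)
next
  fix S T :: "cp1 set" assume "open S" "open T"
  then have "open ({z. z \<noteq> 0 \<and> proj z \<in> S} \<inter> {z. z \<noteq> 0 \<and> proj z \<in> T})"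
    unfolding open_cp1_def by (rule open_Int)
  also have "\<dots> = {z. z \<noteq> 0 \<and> proj z \<in> S \<inter> T}" by auto
  finally show "open (S \<inter> T)" unfolding open_cp1_def .
next
  fix K :: "cp1 set set" assume "\<forall>S\<in>K. open S"
  then have "open (\<Union>S\<in>K. {z. z \<noteq> 0 \<and> proj z \<in> S})"
    unfolding open_cp1_def by auto
  also have "\<dots> = {z. z \<noteq> 0 \<and> proj z \<in> \<Union>K}" by auto
  finally show "open (\<Union>K)" unfolding open_cp1_def .
qed

end

text \<open>A pair of polynomials of degree at most \<open>d\<close> encodes the coefficients of a pair of binary
  forms of degree \<open>d\<close>; the resultant is taken with both formal degrees equal to \<open>d\<close>.\<close>

type_synonym forms = "complex poly \<times> complex poly"

definition form :: "nat \<Rightarrow> complex poly \<Rightarrow> complex \<times> complex \<Rightarrow> complex" where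
  "form d p z = (\<Sum>i\<le>d. coeff p i * fst z ^ i * snd z ^ (d - i))"

definition forms_map :: "nat \<Rightarrow> forms \<Rightarrow> complex \<times> complex \<Rightarrow> complex \<times> complex" where
  "forms_map d F z = (form d (fst F) z, form d (snd F) z)"

definition Res_forms :: "nat \<Rightarrow> forms \<Rightarrow> complex" where
  "Res_forms d F = resultant_sub d d (fst F) (snd F)"

definition is_lift :: "nat \<Rightarrow> forms \<Rightarrow> (cp1 \<Rightarrow> cp1) \<Rightarrow> bool" where
  "is_lift d F f \<longleftrightarrow>
     degree (fst F) \<le> d \<and> degree (snd F) \<le> d \<and> Res_forms d F \<noteq> 0 \<and>
     (\<forall>z. z \<noteq> 0 \<longrightarrow> f (proj z) = proj (forms_map d F z))"

definition rational_map :: "nat \<Rightarrow> (cp1 \<Rightarrow> cp1) \<Rightarrow> bool" where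
  "rational_map d f \<longleftrightarrow> (\<exists>F. is_lift d F f)"

definition some_lift :: "nat \<Rightarrow> (cp1 \<Rightarrow> cp1) \<Rightarrow> forms" where
  "some_lift d f = (SOME F. is_lift d F f)"

definition coeff_norm :: "nat \<Rightarrow> forms \<Rightarrow> real" where
  "coeff_norm d F = Max ((\<lambda>i. max (cmod (coeff (fst F) i)) (cmod (coeff (snd F) i))) ` {..d})"

text \<open>The resultant of two binary forms of degree \<open>d\<close> is homogeneous of degree \<open>2 * d\<close> in
  the coefficients, so this is the normalization which does not depend on the lift.\<close>

definition abs_Res_lift :: "nat \<Rightarrow> forms \<Rightarrow> real" where
  "abs_Res_lift d F = cmod (Res_forms d F) / coeff_norm d F ^ (2 * d)"

definition abs_Res :: "nat \<Rightarrow> (cp1 \<Rightarrow> cp1) \<Rightarrow> real" where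
  "abs_Res d f = abs_Res_lift d (some_lift d f)"

text \<open>A quadruple \<open>(a, b, c, e)\<close> stands for the matrix with rows \<open>(a, b)\<close> and \<open>(c, e)\<close>.\<close>

type_synonym mat2 = "complex \<times> complex \<times> complex \<times> complex"

definition SL2 :: "mat2 set" where
  "SL2 = {(a, b, c, e). a * e - b * c = 1}"

definition mat2_apply :: "mat2 \<Rightarrow> complex \<times> complex \<Rightarrow> complex \<times> complex" where
  "mat2_apply = (\<lambda>(a, b, c, e) (x, y). (a * x + b * y, c * x + e * y))"

definition moebius :: "mat2 \<Rightarrow> cp1 \<Rightarrow> cp1" where
  "moebius \<phi> x = proj (mat2_apply \<phi> (rep_cp1 x))"

definition abs_res :: "nat \<Rightarrow> (cp1 \<Rightarrow> cp1) \<Rightarrow> real" where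
  "abs_res d f = (SUP \<phi>\<in>SL2. abs_Res d (moebius \<phi> \<circ> f \<circ> inv_into UNIV (moebius \<phi>)))"

definition max_norm :: "complex \<times> complex \<Rightarrow> real" where
  "max_norm z = max (cmod (fst z)) (cmod (snd z))"

definition hom_height :: "nat \<Rightarrow> forms \<Rightarrow> complex \<times> complex \<Rightarrow> real" where
  "hom_height d F z = lim (\<lambda>n. ln (max_norm ((forms_map d F ^^ n) z)) / real d ^ n)"

definition green_lift ::
    "nat \<Rightarrow> forms \<Rightarrow> complex \<times> complex \<Rightarrow> complex \<times> complex \<Rightarrow> real" where
  "green_lift d F u v =
     - ln (cmod (fst u * snd v - snd u * fst v)) + hom_height d F u + hom_height d F v
     - 1 / (real d * (real d - 1)) * ln (cmod (Res_forms d F))"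

definition green :: "nat \<Rightarrow> (cp1 \<Rightarrow> cp1) \<Rightarrow> cp1 \<Rightarrow> cp1 \<Rightarrow> ereal" where
  "green d f x y =
     (if x = y then \<infinity> else ereal (green_lift d (some_lift d f) (rep_cp1 x) (rep_cp1 y)))"

text \<open>None of the choices made above matters: lifts are unique up to a nonzero scalar, the limit
  defining the height exists, and the resultant and the Green function may be computed from any
  lifts of the map and of the points.\<close>

lemma form_cscale: "form d p (cscale c z) = c ^ d * form d p z"
proof -
  have "c ^ i * c ^ (d - i) = c ^ d" if "i \<le> d" for i
    using that by (simp flip: power_add)
  then show ?thesis
    unfolding form_def cscale_def sum_distrib_left
    by (intro sum.cong) (auto simp: power_mult_distrib mult_ac)
qed

lemma forms_map_cscale: "forms_map d F (cscale c z) = cscale (c ^ d) (forms_map d F z)"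
  unfolding forms_map_def form_cscale by (simp add: cscale_def)

lemma form_smult: "form d (Polynomial.smult c p) z = c * form d p z"
  by (simp add: form_def sum_distrib_left mult_ac)

lemma forms_map_smult:
  "forms_map d (Polynomial.smult c p, Polynomial.smult c q) z = cscale c (forms_map d (p, q) z)"
  by (simp add: forms_map_def form_smult cscale_def)

lemma Res_forms_smult: "Res_forms d (Polynomial.smult c p, Polynomial.smult c q) = c ^ (2 * d) * Res_forms d (p, q)"
proof -
  have "sylvester_mat_sub d d (Polynomial.smult c p) (Polynomial.smult c q) = c \<cdot>\<^sub>m sylvester_mat_sub d d p q"
    by (rule eq_matI) (auto simp: sylvester_mat_sub_index)
  then show ?thesis
    by (simp add: Res_forms_def resultant_sub_def mult_2)
qed

lemma coeff_norm_smult: "coeff_norm d (Polynomial.smult c p, Polynomial.smult c q) = cmod c * coeff_norm d (p, q)"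
proof -
  let ?g = "\<lambda>i. max (cmod (coeff p i)) (cmod (coeff q i))"
  have "mono ((*) (cmod c))" by (intro monoI mult_left_mono) auto
  from mono_Max_commute[OF this, of "?g ` {..d}"]
  have "cmod c * Max (?g ` {..d}) = Max ((\<lambda>i. cmod c * ?g i) ` {..d})"
    by (simp add: image_image)
  also have "(\<lambda>i. cmod c * ?g i) = (\<lambda>i. max (cmod (c * coeff p i)) (cmod (c * coeff q i)))"
    by (simp add: norm_mult max_mult_distrib_left)
  finally show ?thesis by (simp add: coeff_norm_def)
qed

lemma abs_Res_lift_smult:
  assumes "c \<noteq> 0"
  shows "abs_Res_lift d (Polynomial.smult c p, Polynomial.smult c q) = abs_Res_lift d (p, q)"
  using assms
  by (simp add: abs_Res_lift_def Res_forms_smult coeff_norm_smult norm_mult norm_power power_mult_distrib)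

lemma forms_map_nonzero:
  assumes d: "d > 0" and R: "Res_forms d F \<noteq> 0" and z: "z \<noteq> 0"
  shows "forms_map d F z \<noteq> 0"
proof
  assume zero: "forms_map d F z = 0"
  obtain p q where F: "F = (p, q)" by (cases F)
  obtain x y where xy: "z = (x, y)" by (cases z)
  have P: "(\<Sum>i\<le>d. coeff p i * x ^ i * y ^ (d - i)) = 0"
   and Q: "(\<Sum>i\<le>d. coeff q i * x ^ i * y ^ (d - i)) = 0"
    using zero by (auto simp: F xy forms_map_def form_def zero_prod_def)
  define S where "S = sylvester_mat_sub d d p q"
  define v where "v = vec (d + d) (\<lambda>j. x ^ (d + d - 1 - j) * y ^ j)"
  have S: "S \<in> carrier_mat (d + d) (d + d)" unfolding S_def by (rule sylvester_mat_sub_carrier)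
  have v: "v \<in> carrier_vec (d + d)" by (simp add: v_def)
  have "v \<noteq> 0\<^sub>v (d + d)"
  proof (cases "x = 0")
    case True
    then have "vec_index v (d + d - 1) \<noteq> 0"
      using z d xy by (auto simp: v_def zero_prod_def)
    then show ?thesis using d by auto
  next
    case False
    then have "vec_index v 0 \<noteq> 0" using d by (auto simp: v_def)
    then show ?thesis using d by auto
  qed
  moreover have "S *\<^sub>v v = 0\<^sub>v (d + d)"
  proof (rule eq_vecI)
    show "dim_vec (S *\<^sub>v v) = dim_vec (0\<^sub>v (d + d))" using S by simp
    fix i assume "i < dim_vec (0\<^sub>v (d + d) :: complex vec)"
    then have i: "i < d + d" by simp
    have eq: "vec_index (S *\<^sub>v v) i = (\<Sum>j<d + d. S $$ (i, j) * (x ^ (d + d - 1 - j) * y ^ j))"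
      using S i by (simp add: scalar_prod_def v_def lessThan_atLeast0)
    show "vec_index (S *\<^sub>v v) i = vec_index (0\<^sub>v (d + d)) i"
    proof (cases "i < d")
      case True
      have "(\<Sum>j<d + d. S $$ (i, j) * (x ^ (d + d - 1 - j) * y ^ j))
          = (\<Sum>j\<in>{i..i + d}. S $$ (i, j) * (x ^ (d + d - 1 - j) * y ^ j))"
        using True i by (intro sum.mono_neutral_right) (auto simp: S_def sylvester_mat_sub_index)
      also have "\<dots> = (\<Sum>k\<le>d. x ^ (d - 1 - i) * y ^ i * (coeff p k * x ^ k * y ^ (d - k)))"
      proof (rule sum.reindex_bij_witness[where i = "\<lambda>k. d + i - k" and j = "\<lambda>j. d + i - j"])
        fix j assume j: "j \<in> {i..i + d}"
        then have e: "S $$ (i, j) = coeff p (d + i - j)"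
          using True by (auto simp: S_def sylvester_mat_sub_index)
        have "d - 1 - i + (d + i - j) = d + d - 1 - j" "i + (d - (d + i - j)) = j"
          using j True by auto
        then have "x ^ (d + d - 1 - j) * y ^ j
            = x ^ (d - 1 - i) * y ^ i * (x ^ (d + i - j) * y ^ (d - (d + i - j)))"
          by (metis (no_types, lifting) power_add mult.assoc mult.left_commute)
        then show "x ^ (d - 1 - i) * y ^ i * (coeff p (d + i - j) * x ^ (d + i - j) * y ^ (d - (d + i - j)))
            = S $$ (i, j) * (x ^ (d + d - 1 - j) * y ^ j)"
          by (simp add: e mult_ac)
      qed auto
      also have "\<dots> = 0" by (simp add: P flip: sum_distrib_left)
      finally show ?thesis using eq i by simp
    next
      case False
      have "(\<Sum>j<d + d. S $$ (i, j) * (x ^ (d + d - 1 - j) * y ^ j))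
          = (\<Sum>j\<in>{i - d..i}. S $$ (i, j) * (x ^ (d + d - 1 - j) * y ^ j))"
        using False i by (intro sum.mono_neutral_right) (auto simp: S_def sylvester_mat_sub_index)
      also have "\<dots> = (\<Sum>k\<le>d. x ^ (d + d - 1 - i) * y ^ (i - d) * (coeff q k * x ^ k * y ^ (d - k)))"
      proof (rule sum.reindex_bij_witness[where i = "\<lambda>k. i - k" and j = "\<lambda>j. i - j"])
        fix j assume j: "j \<in> {i - d..i}"
        then have e: "S $$ (i, j) = coeff q (i - j)"
          using False i by (auto simp: S_def sylvester_mat_sub_index)
        have "d + d - 1 - i + (i - j) = d + d - 1 - j" "i - d + (d - (i - j)) = j"
          using j False i by auto
        then have "x ^ (d + d - 1 - j) * y ^ j
            = x ^ (d + d - 1 - i) * y ^ (i - d) * (x ^ (i - j) * y ^ (d - (i - j)))"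
          by (metis (no_types, lifting) power_add mult.assoc mult.left_commute)
        then show "x ^ (d + d - 1 - i) * y ^ (i - d) * (coeff q (i - j) * x ^ (i - j) * y ^ (d - (i - j)))
            = S $$ (i, j) * (x ^ (d + d - 1 - j) * y ^ j)"
          by (simp add: e mult_ac)
      qed (use False in auto)
      also have "\<dots> = 0" by (simp add: Q flip: sum_distrib_left)
      finally show ?thesis using eq i by simp
    qed
  qed
  ultimately have "Determinant.det S = 0"
    using det_0_iff_vec_prod_zero[OF S] v by blast
  then show False using R by (simp add: Res_forms_def resultant_sub_def F S_def)
qed

lemma form_1_eq_poly:
  assumes "degree p \<le> d"
  shows "form d p (t, 1) = poly p t"
proof -
  have "(\<Sum>i\<le>degree p. coeff p i * t ^ i) = (\<Sum>i\<le>d. coeff p i * t ^ i)"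
    using assms by (intro sum.mono_neutral_left) (auto simp: coeff_eq_0)
  then show ?thesis by (simp add: form_def poly_altdef)
qed

lemma coprime_of_Res_nonzero:
  assumes d: "d > 0" and R: "Res_forms d (p, q) \<noteq> 0" and deg: "degree p \<le> d" "degree q \<le> d"
  shows "coprime p q" "p \<noteq> 0"
proof -
  have nz: "(t, 1) \<noteq> (0 :: complex \<times> complex)" for t by (simp add: zero_prod_def)
  have no_root: "\<not> (poly p t = 0 \<and> poly q t = 0)" for t
    using forms_map_nonzero[OF d R nz[of t]] deg
    by (simp add: forms_map_def form_1_eq_poly zero_prod_def)
  show "coprime p q"
  proof (rule ccontr)
    assume "\<not> coprime p q"
    then obtain g where g: "g dvd p" "g dvd q" "\<not> is_unit g"
      by (auto simp: coprime_def)
    show False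
    proof (cases "degree g = 0")
      case True
      then have "g = 0" using g(3) is_unit_iff_degree by blast
      then show False using g no_root[of 0] by auto
    next
      case False
      then have "\<not> constant (poly g)" by (simp add: constant_degree)
      then obtain t where "poly g t = 0" using fundamental_theorem_of_algebra by blast
      then have "poly p t = 0" "poly q t = 0" using g(1,2) by (auto simp: poly_eq_0_iff_dvd intro: dvd_trans)
      then show False using no_root[of t] by simp
    qed
  qed
  show "p \<noteq> 0"
  proof
    assume p: "p = 0"
    then have "is_unit q" using \<open>coprime p q\<close> by simp
    then have "degree q = 0" by (metis is_unit_iff_degree not_is_unit_0)
    then have "coeff q d = 0" using d by (simp add: coeff_eq_0)
    moreover have "form d q (1, 0) = coeff q d"
      unfolding form_def by (subst sum.remove[of _ d]) (auto intro!: sum.neutral)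
    ultimately have "forms_map d (p, q) (1, 0) = 0"
      by (simp add: forms_map_def p form_def zero_prod_def)
    then show False using forms_map_nonzero[OF d R, of "(1, 0)"] by (simp add: zero_prod_def)
  qed
qed

lemma lift_unique:
  assumes d: "d > 0" and F: "is_lift d (p, q) f" and G: "is_lift d (r, s) f"
  obtains c where "c \<noteq> 0" "r = Polynomial.smult c p" "s = Polynomial.smult c q"
proof -
  have deg: "degree p \<le> d" "degree q \<le> d" "degree r \<le> d" "degree s \<le> d"
   and RF: "Res_forms d (p, q) \<noteq> 0" and RG: "Res_forms d (r, s) \<noteq> 0"
    using F G by (auto simp: is_lift_def)
  note cop = coprime_of_Res_nonzero[OF d RF deg(1,2)] coprime_of_Res_nonzero[OF d RG deg(3,4)]
  have "poly (p * s) t = poly (q * r) t" for t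
  proof -
    have nz: "(t, 1) \<noteq> (0 :: complex \<times> complex)" by (simp add: zero_prod_def)
    have "proj (forms_map d (p, q) (t, 1)) = proj (forms_map d (r, s) (t, 1))"
      using F G nz unfolding is_lift_def by metis
    then obtain c where "forms_map d (r, s) (t, 1) = cscale c (forms_map d (p, q) (t, 1))"
      using proj_eq_iff forms_map_nonzero[OF d _ nz] RF RG by metis
    then show ?thesis
      using deg by (simp add: forms_map_def form_1_eq_poly cscale_def)
  qed
  then have eq: "p * s = q * r" by (auto simp flip: poly_eq_poly_eq_iff)
  have "p dvd q * r" by (simp flip: eq)
  then have "p dvd r" using cop(1) by (simp add: coprime_dvd_mult_right_iff)
  then obtain a where a: "r = p * a" by (elim dvdE)
  have "r dvd p * s" by (simp add: eq)
  then have "r dvd p" using cop(3) by (simp add: coprime_dvd_mult_left_iff)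
  then have "p * a dvd p * 1" by (simp add: a)
  then have "is_unit a" using cop(2) dvd_times_left_cancel_iff[of p a 1] by blast
  then obtain c where c: "a = [:c:]" "c \<noteq> 0"
    by (metis is_unit_iff_degree not_is_unit_0 degree_eq_zeroE pCons_0_0)
  have r: "r = Polynomial.smult c p" using a c by simp
  have "p * s = p * Polynomial.smult c q" using eq r by (simp add: mult.commute)
  then have "s = Polynomial.smult c q" using cop(2) mult_left_cancel by blast
  then show ?thesis using that c r by blast
qed

lemma abs_Res_eq:
  assumes "d > 0" "is_lift d F f"
  shows "abs_Res d f = abs_Res_lift d F"
proof -
  have "is_lift d (some_lift d f) f"
    unfolding some_lift_def using assms(2) by (rule someI)
  then show ?thesis
    unfolding abs_Res_def
    by (metis assms abs_Res_lift_smult lift_unique prod.collapse)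
qed

lemma max_norm_cscale: "max_norm (cscale c z) = cmod c * max_norm z"
  by (simp add: max_norm_def cscale_def norm_mult max_mult_distrib_left)

lemma max_norm_pos: "z \<noteq> 0 \<Longrightarrow> max_norm z > 0"
  by (auto simp: max_norm_def prod_eq_iff less_max_iff_disj)

lemma continuous_on_max_norm_forms_map: "continuous_on A (\<lambda>z. max_norm (forms_map d F z))"
  unfolding max_norm_def forms_map_def form_def by (auto intro!: continuous_intros)

lemma compact_max_norm_sphere: "compact {z. max_norm z = 1}"
proof (rule compact_eq_bounded_closed[THEN iffD2], rule conjI)
  have "norm z \<le> 2" if "max_norm z = 1" for z
    using that norm_Pair_le[of "fst z" "snd z"] by (simp add: max_norm_def max_def split: if_splits)
  then show "bounded {z. max_norm z = 1}" by (auto simp: bounded_iff)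
  show "closed {z. max_norm z = 1}"
    unfolding max_norm_def by (intro closed_Collect_eq continuous_intros)
qed

lemma forms_map_bound:
  assumes d: "d > 0" and R: "Res_forms d F \<noteq> 0"
  obtains C where "\<And>z. z \<noteq> 0 \<Longrightarrow> \<bar>ln (max_norm (forms_map d F z)) - real d * ln (max_norm z)\<bar> \<le> C"
proof -
  let ?S = "{z. max_norm z = 1}" and ?g = "\<lambda>z. ln (max_norm (forms_map d F z))"
  have pos: "max_norm (forms_map d F z) > 0" if "z \<noteq> 0" for z
    using forms_map_nonzero[OF d R that] by (rule max_norm_pos)
  have S0: "z \<noteq> 0" if "z \<in> ?S" for z using that by (auto simp: max_norm_def)
  have "continuous_on ?S ?g"
    using pos S0 by (intro continuous_on_ln continuous_on_max_norm_forms_map) force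
  then have "compact (?g ` ?S)" by (rule compact_continuous_image[OF _ compact_max_norm_sphere])
  then obtain C where C: "\<And>z. z \<in> ?S \<Longrightarrow> \<bar>?g z\<bar> \<le> C"
    using compact_imp_bounded bounded_iff by (metis imageI real_norm_def)
  have "\<bar>?g z - real d * ln (max_norm z)\<bar> \<le> C" if z: "z \<noteq> 0" for z
  proof -
    define m where "m = max_norm z"
    have m: "m > 0" using z by (simp add: m_def max_norm_pos)
    define w where "w = cscale (of_real (1 / m)) z"
    have w: "w \<in> ?S" using m by (simp add: w_def max_norm_cscale norm_divide flip: m_def)
    have "z = cscale (of_real m) w" using m by (simp add: w_def)
    then have "max_norm (forms_map d F z) = m ^ d * max_norm (forms_map d F w)"
      using m by (simp add: forms_map_cscale max_norm_cscale norm_power)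
    then have "?g z = real d * ln m + ?g w"
      using m pos[OF S0[OF w]] by (simp add: ln_mult ln_realpow)
    then show ?thesis using C[OF w] by (simp add: m_def)
  qed
  then show ?thesis using that by blast
qed

lemma funpow_forms_map_nonzero:
  assumes "d > 0" "Res_forms d F \<noteq> 0" "z \<noteq> 0"
  shows "(forms_map d F ^^ n) z \<noteq> 0"
  using assms by (induction n) (auto dest: forms_map_nonzero)

lemma hom_height_LIMSEQ:
  assumes d: "d \<ge> 2" and R: "Res_forms d F \<noteq> 0" and z: "z \<noteq> 0"
  shows "(\<lambda>n. ln (max_norm ((forms_map d F ^^ n) z)) / real d ^ n) \<longlonglongrightarrow> hom_height d F z"
proof -
  define a where "a n = ln (max_norm ((forms_map d F ^^ n) z)) / real d ^ n" for n
  have d0: "d > 0" using d by simp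
  obtain C where C: "\<And>z. z \<noteq> 0 \<Longrightarrow>
      \<bar>ln (max_norm (forms_map d F z)) - real d * ln (max_norm z)\<bar> \<le> C"
    using forms_map_bound[OF d0 R] by blast
  have le: "norm (a (Suc n) - a n) \<le> C / real d * (1 / real d) ^ n" for n
  proof -
    let ?w = "(forms_map d F ^^ n) z"
    have "a (Suc n) - a n =
        (ln (max_norm (forms_map d F ?w)) - real d * ln (max_norm ?w)) / real d ^ Suc n"
      using d0 by (simp add: a_def field_simps)
    then have "\<bar>a (Suc n) - a n\<bar> =
        \<bar>ln (max_norm (forms_map d F ?w)) - real d * ln (max_norm ?w)\<bar> / real d ^ Suc n"
      by (simp add: abs_divide)
    also have "\<dots> \<le> C / real d ^ Suc n"
      using C[OF funpow_forms_map_nonzero[OF d0 R z]] by (intro divide_right_mono) auto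
    finally show ?thesis by (simp add: power_divide)
  qed
  have "summable (\<lambda>n. C / real d * (1 / real d) ^ n)"
    using d by (intro summable_mult summable_geometric) auto
  then have "summable (\<lambda>n. a (Suc n) - a n)"
    by (rule summable_comparison_test'[where N = 0]) (rule le)
  then have "convergent (\<lambda>n. a n - a 0)"
    unfolding summable_iff_convergent sum_lessThan_telescope .
  then have "convergent (\<lambda>n. (a n - a 0) + a 0)"
    by (intro convergent_add convergent_const)
  then show ?thesis
    by (simp add: convergent_LIMSEQ_iff a_def hom_height_def)
qed

lemma hom_height_cscale:
  assumes d: "d \<ge> 2" and R: "Res_forms d F \<noteq> 0" and z: "z \<noteq> 0" and c: "c \<noteq> 0"
  shows "hom_height d F (cscale c z) = hom_height d F z + ln (cmod c)"
proof -
  have it: "(forms_map d F ^^ n) (cscale c z) = cscale (c ^ d ^ n) ((forms_map d F ^^ n) z)" for n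
    by (induction n) (simp_all add: forms_map_cscale flip: power_mult, simp add: mult.commute)
  have d0: "d > 0" using d by simp
  have "ln (max_norm ((forms_map d F ^^ n) (cscale c z))) / real d ^ n
      = ln (max_norm ((forms_map d F ^^ n) z)) / real d ^ n + ln (cmod c)" for n
    using max_norm_pos[OF funpow_forms_map_nonzero[OF d0 R z, of n]] c d0
    by (simp add: it max_norm_cscale norm_power ln_mult ln_realpow add_divide_distrib)
  then have "(\<lambda>n. ln (max_norm ((forms_map d F ^^ n) (cscale c z))) / real d ^ n)
      \<longlonglongrightarrow> hom_height d F z + ln (cmod c)"
    using tendsto_add[OF hom_height_LIMSEQ[OF d R z] tendsto_const] by simp
  then show ?thesis unfolding hom_height_def by (rule limI)
qed

lemma hom_height_smult:
  assumes d: "d \<ge> 2" and R: "Res_forms d (p, q) \<noteq> 0" and z: "z \<noteq> 0" and c: "c \<noteq> 0"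
  shows "hom_height d (Polynomial.smult c p, Polynomial.smult c q) z
       = hom_height d (p, q) z + ln (cmod c) / (real d - 1)"
proof -
  let ?F = "(p, q)" and ?G = "(Polynomial.smult c p, Polynomial.smult c q)"
  have d0: "d > 0" using d by simp
  have RG: "Res_forms d ?G \<noteq> 0" using R c by (simp add: Res_forms_smult)
  define h where "h n = ln (max_norm ((forms_map d ?G ^^ n) z))" for n
  have it: "h n = ln (max_norm ((forms_map d ?F ^^ n) z))
      + ln (cmod c) / (real d - 1) * (real d ^ n - 1)" for n
  proof -
    have "\<exists>e. (forms_map d ?G ^^ n) z = cscale (c ^ e) ((forms_map d ?F ^^ n) z)
        \<and> real e * (real d - 1) = real d ^ n - 1"
    proof (induction n)
      case 0
      then show ?case by (auto intro!: exI[of _ 0])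
    next
      case (Suc n)
      then obtain e where e: "(forms_map d ?G ^^ n) z = cscale (c ^ e) ((forms_map d ?F ^^ n) z)"
        "real e * (real d - 1) = real d ^ n - 1" by blast
      have "real (e * d + 1) * (real d - 1) = real d ^ Suc n - 1"
        using arg_cong[OF e(2), of "\<lambda>x. x * real d"] by (simp add: algebra_simps)
      moreover have "(forms_map d ?G ^^ Suc n) z = cscale (c ^ (e * d + 1)) ((forms_map d ?F ^^ Suc n) z)"
        by (simp add: e(1) forms_map_cscale forms_map_smult mult.commute[of c] flip: power_mult)
      ultimately show ?case by blast
    qed
    then obtain e where e: "(forms_map d ?G ^^ n) z = cscale (c ^ e) ((forms_map d ?F ^^ n) z)"
        "real e * (real d - 1) = real d ^ n - 1" by blast
    have "h n = real e * ln (cmod c) + ln (max_norm ((forms_map d ?F ^^ n) z))"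
      using max_norm_pos[OF funpow_forms_map_nonzero[OF d0 R z, of n]] c
      by (simp add: h_def e(1) max_norm_cscale norm_power ln_mult ln_realpow)
    also have "real e = (real d ^ n - 1) / (real d - 1)" using e(2) d by (simp add: field_simps)
    finally show ?thesis by (simp add: field_simps)
  qed
  have "(\<lambda>n. (1 / real d) ^ n) \<longlonglongrightarrow> 0"
    using d by (intro LIMSEQ_power_zero) auto
  then have "(\<lambda>n. ln (max_norm ((forms_map d ?F ^^ n) z)) / real d ^ n
      + ln (cmod c) / (real d - 1) * (1 - (1 / real d) ^ n))
      \<longlonglongrightarrow> hom_height d ?F z + ln (cmod c) / (real d - 1) * (1 - 0)"
    by (intro tendsto_add tendsto_mult tendsto_diff tendsto_const hom_height_LIMSEQ d R z)
  also have "(\<lambda>n. ln (max_norm ((forms_map d ?F ^^ n) z)) / real d ^ n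
      + ln (cmod c) / (real d - 1) * (1 - (1 / real d) ^ n)) = (\<lambda>n. h n / real d ^ n)"
    using d0 by (auto simp: it fun_eq_iff add_divide_distrib power_divide right_diff_distrib diff_divide_distrib)
  finally show ?thesis
    unfolding hom_height_def h_def by (simp add: limI)
qed

lemma green_lift_smult:
  assumes d: "d \<ge> 2" and R: "Res_forms d (p, q) \<noteq> 0" and nz: "u \<noteq> 0" "v \<noteq> 0" "c \<noteq> 0"
  shows "green_lift d (Polynomial.smult c p, Polynomial.smult c q) u v = green_lift d (p, q) u v"
proof -
  have "ln (cmod (Res_forms d (Polynomial.smult c p, Polynomial.smult c q)))
      = 2 * real d * ln (cmod c) + ln (cmod (Res_forms d (p, q)))"
    using R nz by (simp add: Res_forms_smult norm_mult norm_power ln_mult ln_realpow)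
  moreover have "1 / (real d * (real d - 1)) * (2 * real d * ln (cmod c)) = 2 * (ln (cmod c) / (real d - 1))"
    using d by (simp add: field_simps)
  ultimately show ?thesis
    using hom_height_smult[OF d R _ nz(3)] nz
    by (simp add: green_lift_def distrib_left)
qed

lemma green_lift_cscale:
  assumes d: "d \<ge> 2" and R: "Res_forms d F \<noteq> 0" and nz: "u \<noteq> 0" "v \<noteq> 0" "a \<noteq> 0" "b \<noteq> 0"
    and neq: "proj u \<noteq> proj v"
  shows "green_lift d F (cscale a u) (cscale b v) = green_lift d F u v"
proof -
  let ?D = "fst u * snd v - snd u * fst v"
  have "?D \<noteq> 0"
  proof
    assume D: "?D = 0"
    have "\<exists>c. v = cscale c u"
    proof (cases "fst u = 0")
      case True
      then show ?thesis using D nz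
        by (intro exI[of _ "snd v / snd u"]) (auto simp: cscale_def prod_eq_iff)
    next
      case False
      then show ?thesis using D
        by (intro exI[of _ "fst v / fst u"]) (auto simp: cscale_def prod_eq_iff field_simps)
    qed
    then obtain c where "v = cscale c u" by blast
    then show False using nz neq proj_eq_iff[of u v] by auto
  qed
  moreover have "fst (cscale a u) * snd (cscale b v) - snd (cscale a u) * fst (cscale b v) = a * b * ?D"
    by (simp add: cscale_def algebra_simps)
  ultimately have "ln (cmod (fst (cscale a u) * snd (cscale b v) - snd (cscale a u) * fst (cscale b v)))
      = ln (cmod a) + ln (cmod b) + ln (cmod ?D)"
    using nz by (simp add: norm_mult ln_mult)
  then show ?thesis
    using hom_height_cscale[OF d R] nz by (simp add: green_lift_def)
qed

lemma green_eq:
  assumes d: "d \<ge> 2" and F: "is_lift d F f" and nz: "u \<noteq> 0" "v \<noteq> 0" and neq: "proj u \<noteq> proj v"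
  shows "green d f (proj u) (proj v) = ereal (green_lift d F u v)"
proof -
  have d0: "d > 0" using d by simp
  have RF: "Res_forms d F \<noteq> 0" using F by (simp add: is_lift_def)
  have some: "is_lift d (some_lift d f) f"
    unfolding some_lift_def using F by (rule someI)
  obtain c where c: "c \<noteq> 0"
    "some_lift d f = (Polynomial.smult c (fst F), Polynomial.smult c (snd F))"
    using lift_unique[OF d0, of "fst F" "snd F" f "fst (some_lift d f)" "snd (some_lift d f)"] F some
    by (metis prod.collapse)
  obtain a where a: "a \<noteq> 0" "rep_cp1 (proj u) = cscale a u"
    using proj_eq_iff[of u "rep_cp1 (proj u)"] nz by auto
  obtain b where b: "b \<noteq> 0" "rep_cp1 (proj v) = cscale b v"
    using proj_eq_iff[of v "rep_cp1 (proj v)"] nz by auto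
  have "green_lift d (some_lift d f) (cscale a u) (cscale b v) = green_lift d F (cscale a u) (cscale b v)"
    unfolding c using green_lift_smult[OF d, of "fst F" "snd F"] RF nz a b c(1) by simp
  also have "\<dots> = green_lift d F u v"
    using green_lift_cscale[OF d RF] nz a b neq by blast
  finally show ?thesis using neq by (simp add: green_def a b)
qed

lemma mat2_apply_nonzero: "\<phi> \<in> SL2 \<Longrightarrow> z \<noteq> 0 \<Longrightarrow> mat2_apply \<phi> z \<noteq> 0"
proof
  assume \<phi>: "\<phi> \<in> SL2" and z: "z \<noteq> 0" and 0: "mat2_apply \<phi> z = 0"
  obtain a b c e where abce: "\<phi> = (a, b, c, e)" by (cases \<phi>)
  obtain x y where xy: "z = (x, y)" by (cases z)
  have det: "a * e - b * c = 1" using \<phi> by (simp add: SL2_def abce)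
  have 1: "a * x + b * y = 0" "c * x + e * y = 0"
    using 0 by (auto simp: mat2_apply_def abce xy zero_prod_def)
  have "(a * e - b * c) * x = e * (a * x + b * y) - b * (c * x + e * y)"
    "(a * e - b * c) * y = a * (c * x + e * y) - c * (a * x + b * y)" by (simp_all add: algebra_simps)
  then have "x = 0" "y = 0" unfolding 1 det by simp_all
  then show False using z xy by (simp add: zero_prod_def)
qed

lemma moebius_proj:
  assumes "\<phi> \<in> SL2" "z \<noteq> 0"
  shows "moebius \<phi> (proj z) = proj (mat2_apply \<phi> z)"
proof -
  obtain c where c: "c \<noteq> 0" "rep_cp1 (proj z) = cscale c z"
    using proj_eq_iff[of z "rep_cp1 (proj z)"] assms by auto
  have "mat2_apply \<phi> (cscale c z) = cscale c (mat2_apply \<phi> z)"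
    by (auto simp: mat2_apply_def cscale_def algebra_simps split: prod.splits)
  moreover have "proj (mat2_apply \<phi> z) = proj (cscale c (mat2_apply \<phi> z))"
    using proj_eq_iff[of "mat2_apply \<phi> z" "cscale c (mat2_apply \<phi> z)"]
      mat2_apply_nonzero[OF assms] c(1) by auto
  ultimately show ?thesis by (simp add: moebius_def c)
qed

lemma bij_moebius:
  assumes "\<phi> \<in> SL2"
  shows "bij (moebius \<phi>)"
proof -
  obtain a b c e where abce: "\<phi> = (a, b, c, e)" by (cases \<phi>)
  define \<psi> where "\<psi> = (e, -b, -c, a)"
  have det: "a * e - b * c = 1" using assms by (simp add: SL2_def abce)
  have \<psi>: "\<psi> \<in> SL2" using det by (simp add: SL2_def \<psi>_def mult.commute)
  have inv1: "mat2_apply \<psi> (mat2_apply \<phi> z) = z" "mat2_apply \<phi> (mat2_apply \<psi> z) = z" for z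
  proof -
    obtain x y where xy: "z = (x, y)" by (cases z)
    have "e * (a * x + b * y) + - b * (c * x + e * y) = (a * e - b * c) * x"
      "- c * (a * x + b * y) + a * (c * x + e * y) = (a * e - b * c) * y"
      "a * (e * x + - b * y) + b * (- c * x + a * y) = (a * e - b * c) * x"
      "c * (e * x + - b * y) + e * (- c * x + a * y) = (a * e - b * c) * y" by (simp_all add: algebra_simps)
    then show "mat2_apply \<psi> (mat2_apply \<phi> z) = z" "mat2_apply \<phi> (mat2_apply \<psi> z) = z"
      by (simp_all add: mat2_apply_def abce \<psi>_def xy det)
  qed
  have "moebius \<psi> (moebius \<phi> x) = x" "moebius \<phi> (moebius \<psi> x) = x" for x
    using moebius_proj[OF assms] moebius_proj[OF \<psi>] mat2_apply_nonzero[OF assms]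
      mat2_apply_nonzero[OF \<psi>] inv1 by (metis proj_rep rep_cp1_nonzero)+
  then show ?thesis by (intro o_bij[of "moebius \<psi>"]) (auto simp: fun_eq_iff)
qed

end

theory Submission
  imports Defs "HOL-Complex_Analysis.Cauchy_Integral_Formula"
begin

text \<open>
  Scale the lift \<open>F\<close> so that its resultant has absolute value one. Then the Green function is
  \<open>- ln \<bar>x \<and> y\<bar> + h x + h y\<close> with \<open>h\<close> the homogeneous height, and \<open>SL\<^sub>2\<close> preserves both this shape and the
  resultant. Hence \<open>g\<close> is large on the set where \<open>h z - ln (max_norm (\<psi> z))\<close> is large, for every
  \<open>\<psi> \<in> SL\<^sub>2\<close>, and it remains to cover the sphere by boundedly many sets of this kind.

  The first point is that for every \<open>\<psi>\<close> such a set is nonempty: if \<open>h \<le> M + ln max_norm\<close> everywhere, then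
  the coefficients of \<open>F\<close> are at most \<open>exp (C * (M + 1))\<close>, which for a map almost minimizing the
  coefficients in its conjugacy class bounds \<open>M\<close> from below. This replaces the positivity of the
  diagonal of the Green function on hyperbolic space; it is proved by comparing the potentials
  \<open>d^n h x \<approx> \<Sum> ln \<bar>x \<and> a\<bar>\<close>, the sum being over the \<open>n\<close>-fold preimages \<open>a\<close> of a point, at two
  suitable points \<open>x\<close>.

  The second point is that a bounded number of \<open>\<psi>\<close> suffices. For a fixed large \<open>n\<close> take the \<open>\<psi>\<close>
  that blow up discs around the \<open>2 * d^n\<close> preimages of zero and infinity, with boundedly many
  radii in geometric progression whose ratio is a power of the size of \<open>F\<close>. A point lying in such a
  disc but in none of the next smaller ones has a potential comparable to the highest one, because its
  distances to all the preimages are controlled.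
\<close>

section \<open>The product formula for the resultant\<close>

text \<open>All constants have to be uniform over the maps of degree \<open>d\<close>, a non-compact
  family, so errors are measured in multiples of the size \<open>b\<close>. What keeps this
  affordable is that the product formula for the resultant is exact: over a point of height zero,
  the lifts of the preimages can all be scaled to height zero without a correction term. Hence
  passing to \<open>n\<close>-fold preimages loses only \<open>8 * b\<close> for every
  \<open>n\<close>, while the main terms carry the factor \<open>d ^ n\<close>; in the covering
  argument an \<open>n\<close> depending only on \<open>d\<close> makes the loss a small fraction of
  \<open>b\<close>. The same formula replaces elimination theory in the lower bound for
  \<open>f\<close> on the unit sphere and gives the invariance of the resultant under conjugation.
  For a lift with resultant of absolute value one, \<open>abs_Res_lift d F\<close> is
  \<open>1 / coeff_norm d F ^ (2 * d)\<close>, so \<open>- ln (abs_res d f)\<close> is at most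
  \<open>2 * d\<close> times the size of a lift of any conjugate; two points share this factor,
  whence the final division of \<open>\<delta>\<close> by \<open>d\<close>.\<close>

lemma prod_if_less:
  fixes x y :: "'a::comm_monoid_mult"
  shows "(\<Prod>i = 0..<m + n. if i < n then x else y) = x ^ n * y ^ m"
proof -
  have "(\<Prod>i = 0..<m + n. if i < n then x else y) =
      (\<Prod>i \<in> {0..<n} \<union> {n..<m + n}. if i < n then x else y)"
    by (rule prod.cong) auto
  also have "\<dots> = (\<Prod>i \<in> {0..<n}. if i < n then x else y) * (\<Prod>i \<in> {n..<m + n}. if i < n then x else y)"
    by (rule prod.union_disjoint) auto
  also have "\<dots> = x ^ n * y ^ m" by simp
  finally show ?thesis .
qed

lemma det_upper_triangular_two_diag:
  fixes A :: "'a::comm_ring_1 mat"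
  assumes A: "A \<in> carrier_mat (m + n) (m + n)"
    and upper: "\<And>i j. j < i \<Longrightarrow> i < m + n \<Longrightarrow> A $$ (i, j) = 0"
    and diag: "\<And>i. i < m + n \<Longrightarrow> A $$ (i, i) = (if i < n then x else y)"
  shows "Determinant.det A = x ^ n * y ^ m"
proof -
  have "upper_triangular A" using A upper by auto
  then have "Determinant.det A = (\<Prod>i = 0..<m + n. A $$ (i, i))"
    using det_upper_triangular[OF _ A] A by (simp add: prod_list_diag_prod)
  also have "\<dots> = (\<Prod>i = 0..<m + n. if i < n then x else y)"
    by (rule prod.cong) (auto simp: diag)
  finally show ?thesis by (simp add: prod_if_less)
qed

lemma det_single_entry_column:
  fixes A :: "'a::comm_ring_1 mat"
  assumes A: "A \<in> carrier_mat n n" and ij: "i < n" "j < n"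
    and col: "\<And>k. k < n \<Longrightarrow> k \<noteq> i \<Longrightarrow> A $$ (k, j) = 0"
  shows "Determinant.det A = A $$ (i, j) * ((-1) ^ (i + j) * Determinant.det (mat_delete A i j))"
proof -
  have "Determinant.det A = (\<Sum>k<n. A $$ (k, j) * cofactor A k j)"
    by (rule laplace_expansion_column[OF A ij(2)])
  also have "\<dots> = A $$ (i, j) * cofactor A i j"
    using ij col by (subst sum.remove[of _ i]) (auto intro!: sum.neutral)
  finally show ?thesis by (simp add: cofactor_def)
qed

lemma index_mult_mat_sum:
  assumes "A \<in> carrier_mat n n" "B \<in> carrier_mat n n" "i < n" "j < n"
  shows "(A * B) $$ (i, j) = (\<Sum>k = 0..<n. A $$ (i, k) * B $$ (k, j))"
  using assms by (simp add: scalar_prod_def)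

text \<open>The last \<open>m\<close> rows of the Sylvester matrix come from \<open>q\<close>, and
  \<open>D\<close> scales exactly these. With \<open>c = 0\<close> and \<open>m > 0\<close> the
  resultant with a zero form vanishes.\<close>

lemma resultant_sub_smult_right:
  fixes p q :: "'a::comm_ring_1 poly"
  shows "resultant_sub m n p (Polynomial.smult c q) = c ^ m * resultant_sub m n p q"
proof -
  let ?S = "sylvester_mat_sub m n p q"
  define D where "D = mat (m + n) (m + n) (\<lambda>(i, j). if i = j then (if i < n then 1 else c) else 0)"
  have D: "D \<in> carrier_mat (m + n) (m + n)" by (simp add: D_def)
  have S: "?S \<in> carrier_mat (m + n) (m + n)" by (rule sylvester_mat_sub_carrier)
  have "sylvester_mat_sub m n p (Polynomial.smult c q) = D * ?S"
  proof (rule eq_matI)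
    fix i j assume "i < dim_row (D * ?S)" "j < dim_col (D * ?S)"
    then have ij: "i < m + n" "j < m + n" by (auto simp: D_def)
    have "(D * ?S) $$ (i, j) = (\<Sum>k = 0..<m + n. D $$ (i, k) * ?S $$ (k, j))"
      using D S ij by (rule index_mult_mat_sum)
    also have "\<dots> = D $$ (i, i) * ?S $$ (i, j)"
      using ij by (subst sum.remove[of _ i]) (auto intro!: sum.neutral simp: D_def)
    finally show "sylvester_mat_sub m n p (Polynomial.smult c q) $$ (i, j) = (D * ?S) $$ (i, j)"
      using ij by (auto simp: D_def sylvester_mat_sub_index)
  qed (auto simp: D_def)
  moreover have "Determinant.det D = 1 ^ n * c ^ m"
    by (rule det_upper_triangular_two_diag[OF D]) (auto simp: D_def)
  ultimately show ?thesis
    by (simp add: resultant_sub_def det_mult[OF D S])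
qed

lemma form_at_infinity: "form d p (x, 0) = coeff p d * x ^ d"
  unfolding form_def by (subst sum.remove[of _ d]) (auto intro!: sum.neutral)

lemma form_affine:
  assumes "degree p \<le> d" "y \<noteq> 0"
  shows "form d p (x, y) = y ^ d * poly p (x / y)"
  using form_cscale[of d p y "(x / y, 1)"] assms by (simp add: cscale_def form_1_eq_poly)

text \<open>Raising the formal degree of \<open>q\<close> adds a root at infinity. In the first
  column only the top entry \<open>coeff p m\<close> survives, the value of the form of
  \<open>p\<close> at \<open>(1, 0)\<close>.\<close>

lemma resultant_sub_linear_factor_infinity:
  fixes p q :: "'a::comm_ring_1 poly"
  assumes q: "degree q \<le> n"
  shows "resultant_sub m (Suc n) p q = coeff p m * resultant_sub m n p q"
proof -
  let ?S = "sylvester_mat_sub m (Suc n) p q"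
  have S: "?S \<in> carrier_mat (m + Suc n) (m + Suc n)" by (rule sylvester_mat_sub_carrier)
  have "Determinant.det ?S = ?S $$ (0, 0) * ((-1) ^ (0 + 0) * Determinant.det (mat_delete ?S 0 0))"
    using q by (intro det_single_entry_column[OF S]) (auto simp: sylvester_mat_sub_index coeff_eq_0)
  also have "mat_delete ?S 0 0 = sylvester_mat_sub m n p q"
    using q by (intro eq_matI) (auto simp: mat_delete_def sylvester_mat_sub_index Suc_diff_le coeff_eq_0)
  finally show ?thesis by (simp add: resultant_sub_def sylvester_mat_sub_index)
qed

text \<open>Division by the linear factor, written as the matrix identity
  \<open>E * ?S' = Z * D\<close>. Rows are coefficient vectors, highest power first.
  \<open>E\<close> multiplies all shifts of \<open>p\<close> but the last by the linear factor, so
  that every row becomes a multiple of it except one, which leaves the remainder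
  \<open>poly p t\<close>. \<open>D\<close> turns a quotient and a remainder back into a polynomial.
  In \<open>Z\<close> the remainder stands alone in the last column, and deleting its row and column
  gives the smaller Sylvester matrix.\<close>

lemma resultant_sub_linear_factor_affine:
  fixes p q :: "'a::field poly"
  assumes p: "degree p \<le> m" and q: "degree q \<le> n" and \<alpha>: "\<alpha> \<noteq> 0"
  shows "resultant_sub m (Suc n) p ([:\<beta>, \<alpha>:] * q) =
    (-1) ^ m * \<alpha> ^ m * poly p (- \<beta> / \<alpha>) * resultant_sub m n p q"
proof -
  define N where "N = m + n"
  define t where "t = - \<beta> / \<alpha>"
  define l where "l = [:\<beta>, \<alpha>:]"
  define s where "s = Polynomial.smult (1 / \<alpha>) (synthetic_div p t)"
  have p_eq: "p = l * s + [:poly p t:]"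
  proof -
    have "p = [:- t, 1:] * synthetic_div p t + [:poly p t:]"
      using synthetic_div_correct'[of t p] by simp
    also have "[:- t, 1:] * synthetic_div p t = l * s"
      using \<alpha> by (simp add: l_def s_def t_def smult_add_right)
    finally show ?thesis .
  qed
  have s_deg: "coeff s k = 0" if "k \<ge> m" "m > 0" for k
    using p that degree_synthetic_div[of p t] unfolding s_def
    by (simp add: coeff_eq_0)
  have s_deg0: "s = 0" if "m = 0"
    using p that by (simp add: s_def synthetic_div_eq_0_iff)
  have s_top: "coeff s k = 0" if "k \<ge> m" for k
    using s_deg s_deg0 that by (cases "m = 0") auto
  have coeff_l: "coeff (l * r) k = \<beta> * coeff r k + (if k = 0 then 0 else \<alpha> * coeff r (k - 1))" for r k
    by (cases k) (auto simp: l_def)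
  have p_coeff: "coeff p k = \<beta> * coeff s k + (if k = 0 then poly p t else \<alpha> * coeff s (k - 1))" for k
    by (subst p_eq, subst coeff_add, subst coeff_l) (cases k, auto)
  let ?S = "sylvester_mat_sub m n p q" and ?S' = "sylvester_mat_sub m (Suc n) p (l * q)"
  define E where "E = mat (Suc N) (Suc N) (\<lambda>(i, j). if i < n then
      (if j = i then \<alpha> else if j = Suc i then \<beta> else 0) else if j = i then 1 else 0)"
  define D where "D = mat (Suc N) (Suc N) (\<lambda>(i, j). if i < N then
      (if j = i then \<alpha> else if j = Suc i then \<beta> else 0) else if j = i then 1 else 0)"
  define Z where "Z = mat (Suc N) (Suc N) (\<lambda>(i, j).
      if j = N then (if i = n then poly p t else 0)
      else if i < n then ?S $$ (i, j) else if i = n then (if n \<le> j then coeff s (N - 1 - j) else 0)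
      else ?S $$ (i - 1, j))"
  have car: "E \<in> carrier_mat (Suc N) (Suc N)" "D \<in> carrier_mat (Suc N) (Suc N)"
      "Z \<in> carrier_mat (Suc N) (Suc N)" "?S' \<in> carrier_mat (Suc N) (Suc N)"
    by (auto simp: E_def D_def Z_def N_def)
  have eq: "E * ?S' = Z * D"
  proof (rule eq_matI)
    fix i j assume "i < dim_row (Z * D)" "j < dim_col (Z * D)"
    then have ij: "i < Suc N" "j < Suc N" by (auto simp: Z_def D_def)
    have "(E * ?S') $$ (i, j) = (\<Sum>k = 0..<Suc N. E $$ (i, k) * ?S' $$ (k, j))"
      using car ij by (intro index_mult_mat_sum)
    also have "\<dots> = (\<Sum>k \<in> (if i < n then {i, Suc i} else {i}). E $$ (i, k) * ?S' $$ (k, j))"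
      using ij by (intro sum.mono_neutral_right) (auto simp: E_def N_def)
    also have "\<dots> = (if i < n then \<alpha> * ?S' $$ (i, j) + \<beta> * ?S' $$ (Suc i, j) else ?S' $$ (i, j))"
      using ij by (auto simp: E_def N_def)
    finally have L: "(E * ?S') $$ (i, j) = \<dots>" .
    have "(Z * D) $$ (i, j) = (\<Sum>k = 0..<Suc N. Z $$ (i, k) * D $$ (k, j))"
      using car ij by (intro index_mult_mat_sum)
    also have "\<dots> = (\<Sum>k \<in> (if j = 0 then {j} else {j - 1, j}). Z $$ (i, k) * D $$ (k, j))"
      using ij by (intro sum.mono_neutral_right) (auto simp: D_def N_def)
    also have "\<dots> = (if j = 0 then 0 else \<beta> * Z $$ (i, j - 1)) + (if j = N then Z $$ (i, j) else \<alpha> * Z $$ (i, j))"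
      using ij by (cases j) (auto simp: D_def)
    finally have R: "(Z * D) $$ (i, j) = \<dots>" .
    consider "i < n" | "i = n" | "i > n" by linarith
    then show "(E * ?S') $$ (i, j) = (Z * D) $$ (i, j)"
    proof cases
      case 1
      have s1: "?S' $$ (i, j) = (if i \<le> j \<and> j \<le> m + i then coeff p (m + i - j) else 0)"
        using 1 ij by (auto simp: sylvester_mat_sub_index N_def)
      have s2: "?S' $$ (Suc i, j) = (if Suc i \<le> j \<and> j \<le> m + Suc i then coeff p (m + Suc i - j) else 0)"
        using 1 ij by (auto simp: sylvester_mat_sub_index N_def)
      have z1: "Z $$ (i, j) = (if j = N then 0 else if i \<le> j \<and> j \<le> m + i then coeff p (m + i - j) else 0)"
        using 1 ij by (auto simp: sylvester_mat_sub_index N_def Z_def)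
      have z2: "Z $$ (i, j - 1) = (if i \<le> j - 1 \<and> j - 1 \<le> m + i then coeff p (m + i - (j - 1)) else 0)" if "j > 0"
        using 1 ij that by (auto simp: sylvester_mat_sub_index N_def Z_def)
      show ?thesis
        unfolding L R s1 s2 using 1 ij z1 z2 by (cases j) (auto simp: N_def)
    next
      case 2
      have s1: "?S' $$ (i, j) = (if n \<le> j then coeff p (N - j) else 0)"
        using 2 ij by (auto simp: sylvester_mat_sub_index N_def add.commute)
      have z1: "Z $$ (i, j) = (if j = N then poly p t else if n \<le> j then coeff s (N - 1 - j) else 0)"
        using 2 ij by (auto simp: Z_def N_def)
      have z2: "Z $$ (i, j - 1) = (if n \<le> j - 1 then coeff s (N - j) else 0)" if "j > 0"
        using 2 ij that by (auto simp: Z_def N_def)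
      consider "j < n" | "j = n" | "n < j" by linarith
      then show ?thesis
      proof cases
        case 1
        then show ?thesis unfolding L R s1 z1 using 2 z2 by (auto simp: N_def)
      next
        case b: 2
        have "N - j = m" using b by (simp add: N_def)
        then show ?thesis unfolding L R s1 z1 using 2 b z2 p_coeff[of m] s_top[of m]
          by (auto simp: N_def)
      next
        case 3
        then show ?thesis unfolding L R s1 z1 using 2 ij z2 p_coeff[of "N - j"]
          by (auto simp: diff_commute)
      qed
    next
      case 3
      have zero: "coeff q k = 0" if "k > n" for k using that q by (simp add: coeff_eq_0)
      have s1: "?S' $$ (i, j) = (if i - Suc n \<le> j \<and> j \<le> i then coeff (l * q) (i - j) else 0)"
        using 3 ij by (auto simp: sylvester_mat_sub_index N_def)
      have z1: "Z $$ (i, j) = (if j = N then 0 else if i - Suc n \<le> j \<and> j \<le> i - 1 then coeff q (i - 1 - j) else 0)"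
        using 3 ij by (auto simp: Z_def N_def sylvester_mat_sub_index)
      have z2: "Z $$ (i, j - 1) = (if i - Suc n \<le> j - 1 \<and> j - 1 \<le> i - 1 then coeff q (i - 1 - (j - 1)) else 0)" if "j > 0"
        using 3 ij that by (auto simp: Z_def N_def sylvester_mat_sub_index)
      show ?thesis
      proof (cases "j = 0")
        case True
        then show ?thesis unfolding L R s1 z1 using 3 zero[of i] ij
          by (auto simp: coeff_l N_def)
      next
        case False
        then have z2': "Z $$ (i, j - 1) = (if i \<le> j + n \<and> j \<le> i then coeff q (i - j) else 0)"
          using z2 3 by auto
        consider "j > i" | "j = i" | "j < i" "i \<le> j + n" | "i = Suc (j + n)" | "i > Suc (j + n)" by linarith
        then show ?thesis
          unfolding L R s1 z1 z2' using 3 False ij zero[of "i - j"]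
          by cases (auto simp: coeff_l diff_commute)
      qed
    qed
  qed (auto simp: E_def D_def Z_def N_def)
  have detE: "Determinant.det E = \<alpha> ^ n * 1 ^ Suc m"
    by (rule det_upper_triangular_two_diag) (auto simp: E_def N_def)
  have detD: "Determinant.det D = \<alpha> ^ N * 1 ^ 1"
    by (rule det_upper_triangular_two_diag) (auto simp: D_def)
  have "Determinant.det Z = Z $$ (n, N) * ((-1) ^ (n + N) * Determinant.det (mat_delete Z n N))"
    by (rule det_single_entry_column[OF car(3)]) (auto simp: Z_def N_def)
  also have "mat_delete Z n N = ?S"
    by (rule eq_matI) (auto simp: mat_delete_def Z_def N_def sylvester_mat_sub_index)
  also have "Z $$ (n, N) = poly p t" by (simp add: Z_def N_def)
  also have "(-1 :: 'a) ^ (n + N) = (-1) ^ m" by (simp add: N_def power_add flip: mult_2 power_mult)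
  finally have detZ: "Determinant.det Z = poly p t * ((-1) ^ m * resultant_sub m n p q)"
    by (simp add: resultant_sub_def)
  have "\<alpha> ^ n * resultant_sub m (Suc n) p (l * q) = poly p t * ((-1) ^ m * resultant_sub m n p q) * \<alpha> ^ N"
    using arg_cong[OF eq, of Determinant.det] detE detD detZ car
    by (simp add: det_mult resultant_sub_def)
  then have "\<alpha> ^ n * resultant_sub m (Suc n) p (l * q) =
      \<alpha> ^ n * ((-1) ^ m * \<alpha> ^ m * poly p t * resultant_sub m n p q)"
    by (simp add: N_def power_add mult_ac)
  then show ?thesis using \<alpha> by (simp add: l_def t_def)
qed

section \<open>Binary forms as products of linear forms\<close>

definition wedge :: "complex \<times> complex \<Rightarrow> complex \<times> complex \<Rightarrow> complex" where
  "wedge u v = fst u * snd v - snd u * fst v"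

text \<open>The factor of \<open>a\<close> is the linear form \<open>wedge (t, 1) a\<close>, which
  vanishes at \<open>a\<close>. A point at infinity gives a nonzero constant, so a drop in degree
  still counts as a root.\<close>

definition linear_factors :: "(complex \<times> complex) list \<Rightarrow> complex poly" where
  "linear_factors as = (\<Prod>a\<leftarrow>as. [:- fst a, snd a:])"

lemma linear_factors_simps [simp]:
  "linear_factors [] = 1"
  "linear_factors (a # as) = [:- fst a, snd a:] * linear_factors as"
  by (simp_all add: linear_factors_def)

lemma degree_linear_factors: "degree (linear_factors as) \<le> length as"
proof (induction as)
  case (Cons a as)
  have "degree [:- fst a, snd a:] \<le> 1" by simp
  then show ?case
    using Cons degree_mult_le[of "[:- fst a, snd a:]" "linear_factors as"] by (simp del: mult_pCons_left)
qed simp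

lemma poly_linear_factors: "poly (linear_factors as) t = (\<Prod>a\<leftarrow>as. wedge (t, 1) a)"
  by (induction as) (simp_all add: wedge_def algebra_simps del: mult_pCons_left)

lemma exists_linear_factors:
  assumes "degree q \<le> Suc n" "q \<noteq> 0"
  shows "\<exists>as. length as = Suc n \<and> (\<forall>a\<in>set as. a \<noteq> 0) \<and> q = linear_factors as"
  using assms
proof (induction n arbitrary: q)
  case 0
  then have "q = [:coeff q 0, coeff q 1:]"
    by (intro poly_eqI) (simp add: coeff_pCons coeff_eq_0 split: nat.split)
  then obtain u v where q: "q = [:u, v:]" by (rule that)
  with 0 have "(- u, v) \<noteq> 0" by (auto simp: zero_prod_def)
  then show ?case using q by (intro exI[of _ "[(- u, v)]"]) simp
next
  case (Suc n)
  show ?case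
  proof (cases "degree q \<le> Suc n")
    case True
    from Suc.IH[OF this Suc.prems(2)] obtain as where as: "length as = Suc n"
      "\<forall>a\<in>set as. a \<noteq> 0" "q = linear_factors as" by blast
    \<comment> \<open>The degree is smaller than allowed: one more root at infinity, scaled to
      contribute the factor 1.\<close>
    have "q = linear_factors ((- 1, 0) # as)" using as(3) by (simp flip: one_pCons)
    moreover have "\<forall>a\<in>set ((- 1, 0) # as). a \<noteq> 0" using as(2) by (simp add: zero_prod_def)
    ultimately show ?thesis using as(1) by (intro exI[of _ "(- 1, 0) # as"]) simp
  next
    case False
    then have "\<not> constant (poly q)" by (simp add: constant_degree)
    from Fundamental_Theorem_Algebra.fundamental_theorem_of_algebra[OF this] obtain t where "poly q t = 0" ..
    then have "[:- t, 1:] dvd q" by (simp only: poly_eq_0_iff_dvd)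
    then obtain r where r: "q = [:- t, 1:] * r" by (rule dvdE)
    with Suc.prems(2) have r0: "r \<noteq> 0" by (metis mult_zero_right)
    then have "degree q = Suc (degree r)" unfolding r by (subst degree_mult_eq) auto
    then have "degree r \<le> Suc n" using Suc.prems(1) by simp
    from Suc.IH[OF this r0] obtain as where as: "length as = Suc n" "\<forall>a\<in>set as. a \<noteq> 0"
      "r = linear_factors as" by blast
    have "q = linear_factors ((t, 1) # as)" by (simp only: r as(3) linear_factors_simps fst_conv snd_conv)
    moreover have "\<forall>a\<in>set ((t, 1) # as). a \<noteq> 0" using as(2) by (simp add: zero_prod_def)
    ultimately show ?thesis using as(1) by (intro exI[of _ "(t, 1) # as"]) simp
  qed
qed

text \<open>Poisson's product formula, by splitting off one root at a time. Absolute values remove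
  the signs, and the binary form in place of the polynomial treats finite and infinite roots
  alike.\<close>

lemma cmod_resultant_linear_factors:
  assumes p: "degree p \<le> m" and as: "\<forall>a\<in>set as. a \<noteq> 0"
  shows "cmod (resultant_sub m (length as) p (linear_factors as)) = (\<Prod>a\<leftarrow>as. cmod (form m p a))"
  using as
proof (induction as)
  case Nil
  have "sylvester_mat_sub m 0 p 1 = 1\<^sub>m m"
    by (rule eq_matI) (auto simp: sylvester_mat_sub_index coeff_1)
  then show ?case by (simp add: resultant_sub_def)
next
  case (Cons a as)
  obtain x y where a: "a = (x, y)" by (cases a)
  have "cmod (resultant_sub m (Suc (length as)) p ([:- x, y:] * linear_factors as)) =
      cmod (form m p a) * cmod (resultant_sub m (length as) p (linear_factors as))"
  proof (cases "y = 0")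
    case True
    have "resultant_sub m (Suc (length as)) p ([:- x, y:] * linear_factors as) =
        coeff p m * ((- x) ^ m * resultant_sub m (length as) p (linear_factors as))"
      using True degree_linear_factors[of as] degree_smult_le[of "- x" "linear_factors as"]
      by (simp add: resultant_sub_linear_factor_infinity resultant_sub_smult_right
          flip: smult_minus_left)
    then show ?thesis
      using True by (simp add: a form_at_infinity norm_mult norm_power)
  next
    case False
    show ?thesis
      unfolding resultant_sub_linear_factor_affine[OF p degree_linear_factors False]
      using False form_affine[OF p False, of x] by (simp add: a norm_mult norm_power)
  qed
  then show ?case using Cons by (simp add: a del: mult_pCons_left)
qed

text \<open>Both formal degrees are \<open>d\<close>, so the Sylvester matrix is multiplied from the
  left by a matrix of four scalar blocks of size \<open>d\<close>. This lets any target point play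
  the role of zero or infinity.\<close>

lemma Res_forms_linear_combination:
  "Res_forms d (Polynomial.smult a p + Polynomial.smult b q, Polynomial.smult c p + Polynomial.smult e q) =
   (a * e - b * c) ^ d * Res_forms d (p, q)"
proof -
  let ?S = "sylvester_mat_sub d d p q"
  let ?T = "sylvester_mat_sub d d (Polynomial.smult a p + Polynomial.smult b q)
              (Polynomial.smult c p + Polynomial.smult e q)"
  let ?I = "1\<^sub>m d :: complex mat"
  define M where "M = four_block_mat (a \<cdot>\<^sub>m ?I) (b \<cdot>\<^sub>m ?I) (c \<cdot>\<^sub>m ?I) (e \<cdot>\<^sub>m ?I)"
  have M: "M \<in> carrier_mat (d + d) (d + d)" by (simp add: M_def)
  have S: "?S \<in> carrier_mat (d + d) (d + d)" by (rule sylvester_mat_sub_carrier)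
  have "?T = M * ?S"
  proof (rule eq_matI)
    fix i j assume "i < dim_row (M * ?S)" "j < dim_col (M * ?S)"
    then have ij: "i < d + d" "j < d + d" using M by auto
    have "(M * ?S) $$ (i, j) = (\<Sum>k = 0..<d + d. M $$ (i, k) * ?S $$ (k, j))"
      using M S ij by (rule index_mult_mat_sum)
    also have "\<dots> = (\<Sum>k \<in> (if i < d then {i, d + i} else {i - d, i}). M $$ (i, k) * ?S $$ (k, j))"
      using ij by (intro sum.mono_neutral_right) (auto simp: M_def)
    also have "\<dots> = (if i < d then a * ?S $$ (i, j) + b * ?S $$ (d + i, j)
        else c * ?S $$ (i - d, j) + e * ?S $$ (i, j))"
      using ij by (auto simp: M_def)
    finally show "?T $$ (i, j) = (M * ?S) $$ (i, j)"
      using ij by (cases "i < d") (auto simp: sylvester_mat_sub_index)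
  qed (use M in auto)
  moreover have "Determinant.det M = (a * e - b * c) ^ d"
  proof -
    have "Determinant.det M = Determinant.det ((a \<cdot>\<^sub>m ?I) * (e \<cdot>\<^sub>m ?I) - (b \<cdot>\<^sub>m ?I) * (c \<cdot>\<^sub>m ?I))"
      unfolding M_def by (rule det_four_block_mat[of _ d]) auto
    also have "(a \<cdot>\<^sub>m ?I) * (e \<cdot>\<^sub>m ?I) - (b \<cdot>\<^sub>m ?I) * (c \<cdot>\<^sub>m ?I) = (a * e - b * c) \<cdot>\<^sub>m ?I"
      by (rule eq_matI) (auto simp: algebra_simps)
    finally show ?thesis by simp
  qed
  ultimately show ?thesis by (simp add: Res_forms_def resultant_sub_def det_mult[OF M S])
qed

text \<open>The affine chart suffices: homogeneity covers \<open>snd z \<noteq> 0\<close>, and the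
  remaining points are limits of such ones.\<close>

lemma form_eqI:
  assumes q: "degree q \<le> d" and cont: "continuous_on UNIV G"
    and hom: "\<And>c z. G (cscale c z) = c ^ d * G z" and affine: "\<And>t. G (t, 1) = poly q t"
  shows "form d q z = G z"
proof -
  have ne: "form d q (x, y) = G (x, y)" if "y \<noteq> 0" for x y
    using form_affine[OF q that, of x] hom[of y "(x / y, 1)"] affine that by (simp add: cscale_def)
  obtain x y where z: "z = (x, y)" by (cases z)
  show ?thesis
  proof (cases "y = 0")
    case True
    have "closed {z. form d q z = G z}"
      unfolding form_def by (intro closed_Collect_eq cont continuous_intros)
    moreover have "(x, complex_of_real (1 / real (Suc n))) \<in> {z. form d q z = G z}" for n
      by (rule CollectI, rule ne) (simp only: of_real_eq_0_iff, simp)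
    moreover have "(\<lambda>n. (x, complex_of_real (1 / real (Suc n)))) \<longlonglongrightarrow> (x, complex_of_real 0)"
      by (intro tendsto_Pair tendsto_const tendsto_of_real LIMSEQ_Suc[OF lim_1_over_n])
    ultimately have "(x, complex_of_real 0) \<in> {z. form d q z = G z}"
      by (rule closed_sequentially)
    then show ?thesis using True z by simp
  qed (simp add: ne z)
qed

lemma continuous_on_prod_list [continuous_intros]:
  fixes f :: "'a \<Rightarrow> 'b::topological_space \<Rightarrow> 'c::real_normed_algebra_1"
  shows "(\<And>a. a \<in> set as \<Longrightarrow> continuous_on S (f a)) \<Longrightarrow> continuous_on S (\<lambda>z. \<Prod>a\<leftarrow>as. f a z)"
  by (induction as) (auto intro!: continuous_intros)

lemma wedge_cscale_left: "wedge (cscale c z) a = c * wedge z a"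
  by (simp add: wedge_def cscale_def algebra_simps)

lemma wedge_cscale_right: "wedge z (cscale c a) = c * wedge z a"
  by (simp add: wedge_def cscale_def algebra_simps)

lemma form_linear_factors: "form (length as) (linear_factors as) z = (\<Prod>a\<leftarrow>as. wedge z a)"
proof (rule form_eqI[OF degree_linear_factors])
  show "continuous_on UNIV (\<lambda>z. \<Prod>a\<leftarrow>as. wedge z a)"
    unfolding wedge_def by (intro continuous_intros)
  show "(\<Prod>a\<leftarrow>as. wedge (cscale c z) a) = c ^ length as * (\<Prod>a\<leftarrow>as. wedge z a)" for c z
    by (induction as) (simp_all add: wedge_cscale_left)
qed (simp add: poly_linear_factors)

lemma form_eq_imp_poly_eq:
  assumes "degree p \<le> d" "degree q \<le> d" "\<And>z. form d p z = form d q z"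
  shows "p = q"
proof -
  have "poly p t = poly q t" for t
    using assms(3)[of "(t, 1)"] assms(1,2) by (simp add: form_1_eq_poly)
  then show ?thesis by (auto simp flip: poly_eq_poly_eq_iff)
qed

text \<open>On the unit circle \<open>\<bar>s t - r\<bar> = \<bar>cnj s - cnj r * t\<bar>\<close>, so every linear factor may be replaced by
  one whose constant coefficient is dominant; then Cauchy's estimate at the origin applies.\<close>

lemma exists_unit_prod_wedge_ge:
  "\<exists>z. max_norm z = 1 \<and> (\<Prod>a\<leftarrow>as. max_norm a) \<le> (\<Prod>a\<leftarrow>as. cmod (wedge z a))"
proof -
  define lin where "lin = (\<lambda>a t. if cmod (fst a) \<ge> cmod (snd a) then snd a * t - fst a
      else cnj (snd a) - cnj (fst a) * t)"
  have lin_circle: "cmod (lin a t) = cmod (wedge (t, 1) a)" if t: "cmod t = 1" for a t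
  proof (cases "cmod (fst a) \<ge> cmod (snd a)")
    case False
    have "t * cnj t = 1" using t by (simp flip: complex_norm_square)
    then have "cnj (snd a) - cnj (fst a) * t = t * cnj (wedge (t, 1) a)"
      by (simp add: wedge_def algebra_simps)
    then show ?thesis using False t by (simp add: lin_def norm_mult)
  qed (simp add: lin_def wedge_def mult.commute)
  have lin_0: "cmod (lin a 0) = max_norm a" for a
    by (auto simp: lin_def max_norm_def max_def)
  have norm_prod: "cmod (\<Prod>a\<leftarrow>as. f a) = (\<Prod>a\<leftarrow>as. cmod (f a))" for f :: "complex \<times> complex \<Rightarrow> complex"
    by (induction as) (simp_all add: norm_mult)
  define G where "G t = (\<Prod>a\<leftarrow>as. lin a t)" for t
  have hol: "G holomorphic_on UNIV"
    unfolding G_def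
  proof (induction as)
    case (Cons a as)
    have "lin a holomorphic_on UNIV"
      unfolding lin_def by (cases "cmod (fst a) \<ge> cmod (snd a)") (auto intro!: holomorphic_intros)
    then show ?case using Cons by (auto intro!: holomorphic_intros)
  qed simp
  then have cont: "continuous_on S G" for S
    using holomorphic_on_imp_continuous_on continuous_on_subset by blast
  obtain t where t: "t \<in> sphere 0 1" "\<And>s. s \<in> sphere 0 1 \<Longrightarrow> cmod (G s) \<le> cmod (G t)"
    using continuous_attains_sup[OF compact_sphere _ continuous_on_norm[OF cont], of 0 1]
    by auto
  have "cmod ((deriv ^^ 0) G 0) \<le> fact 0 * cmod (G t) / 1 ^ 0"
    using t by (intro Cauchy_inequality cont holomorphic_on_subset[OF hol]) (auto simp: norm_minus_commute)
  then have "(\<Prod>a\<leftarrow>as. max_norm a) \<le> cmod (G t)"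
    by (simp add: G_def norm_prod lin_0)
  moreover have "cmod (G t) = (\<Prod>a\<leftarrow>as. cmod (wedge (t, 1) a))"
    using t(1) by (simp add: G_def norm_prod lin_circle)
  moreover have "max_norm (t, 1) = 1" using t(1) by (simp add: max_norm_def)
  ultimately show ?thesis by metis
qed

section \<open>Norm estimates for points, products and forms\<close>

lemma max_norm_nonneg [simp]: "0 \<le> max_norm z"
  by (simp add: max_norm_def le_max_iff_disj)

lemma max_norm_0 [simp]: "max_norm 0 = 0"
  by (simp add: max_norm_def)

lemma max_norm_pos_iff: "0 < max_norm z \<longleftrightarrow> z \<noteq> 0"
  using max_norm_pos[of z] by auto

lemma cmod_wedge_le: "cmod (wedge u v) \<le> 2 * max_norm u * max_norm v"
proof -
  have "cmod (wedge u v) \<le> cmod (fst u) * cmod (snd v) + cmod (snd u) * cmod (fst v)"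
    unfolding wedge_def by (rule order_trans[OF norm_triangle_ineq4]) (simp add: norm_mult)
  also have "\<dots> \<le> max_norm u * max_norm v + max_norm u * max_norm v"
    by (intro add_mono mult_mono) (auto simp: max_norm_def le_max_iff_disj)
  finally show ?thesis by simp
qed

lemma max_norm_add_le: "max_norm (u + v) \<le> max_norm u + max_norm v"
proof -
  have "cmod (fst u + fst v) \<le> cmod (fst u) + cmod (fst v)" "cmod (snd u + snd v) \<le> cmod (snd u) + cmod (snd v)"
    by (rule norm_triangle_ineq)+
  then show ?thesis by (auto simp: max_norm_def)
qed

text \<open>The triangle inequality for the projective distance
  \<open>cmod (wedge x y) / (max_norm x * max_norm y)\<close>, multiplied out.\<close>

lemma wedge_triangle:
  "max_norm a * cmod (wedge x b) \<le> max_norm x * cmod (wedge a b) + max_norm b * cmod (wedge x a)"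
proof -
  have "cscale (wedge x b) a = cscale (wedge a b) x + cscale (wedge x a) b"
    by (simp add: cscale_def wedge_def prod_eq_iff algebra_simps)
  then have "max_norm (cscale (wedge x b) a) \<le> max_norm (cscale (wedge a b) x) + max_norm (cscale (wedge x a) b)"
    using max_norm_add_le by metis
  then show ?thesis by (simp add: max_norm_cscale mult.commute)
qed

lemma cmod_wedge_commute: "cmod (wedge x y) = cmod (wedge y x)"
  by (metis wedge_def norm_minus_commute mult.commute)

lemma wedge_eq_0_imp_proportional:
  assumes "wedge u v = 0" "v \<noteq> 0"
  shows "\<exists>c. u = cscale c v"
proof (cases "fst v = 0")
  case True
  then show ?thesis using assms
    by (intro exI[of _ "snd u / snd v"]) (auto simp: cscale_def prod_eq_iff wedge_def)
next
  case False
  then show ?thesis using assms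
    by (intro exI[of _ "fst u / fst v"]) (auto simp: cscale_def prod_eq_iff wedge_def field_simps)
qed

lemma prod_list_mono_nonneg:
  fixes f g :: "'a \<Rightarrow> real"
  assumes "\<And>x. x \<in> set xs \<Longrightarrow> 0 \<le> f x \<and> f x \<le> g x"
  shows "(\<Prod>x\<leftarrow>xs. f x) \<le> (\<Prod>x\<leftarrow>xs. g x)" "0 \<le> (\<Prod>x\<leftarrow>xs. f x)"
proof -
  have "0 \<le> (\<Prod>x\<leftarrow>xs. f x) \<and> (\<Prod>x\<leftarrow>xs. f x) \<le> (\<Prod>x\<leftarrow>xs. g x)"
    using assms
  proof (induction xs)
    case (Cons x xs)
    then have "0 \<le> (\<Prod>x\<leftarrow>xs. f x)" "(\<Prod>x\<leftarrow>xs. f x) \<le> (\<Prod>x\<leftarrow>xs. g x)" "0 \<le> f x" "f x \<le> g x"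
      by auto
    then show ?case by (auto intro!: mult_mono)
  qed simp
  then show "(\<Prod>x\<leftarrow>xs. f x) \<le> (\<Prod>x\<leftarrow>xs. g x)" "0 \<le> (\<Prod>x\<leftarrow>xs. f x)" by auto
qed

lemma prod_list_mult_const:
  fixes f :: "'a \<Rightarrow> 'b::comm_monoid_mult"
  shows "(\<Prod>x\<leftarrow>xs. c * f x) = c ^ length xs * (\<Prod>x\<leftarrow>xs. f x)"
  by (induction xs) (simp_all add: mult_ac)

lemma prod_list_power:
  fixes f :: "'a \<Rightarrow> 'b::comm_monoid_mult"
  shows "(\<Prod>x\<leftarrow>xs. f x ^ n) = (\<Prod>x\<leftarrow>xs. f x) ^ n"
  by (induction xs) (simp_all add: power_mult_distrib)

lemma norm_prod_list:
  fixes f :: "'a \<Rightarrow> 'b::{real_normed_div_algebra}"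
  shows "norm (\<Prod>x\<leftarrow>xs. f x) = (\<Prod>x\<leftarrow>xs. norm (f x))"
  by (induction xs) (simp_all add: norm_mult)

lemma cmod_coeff_le_coeff_norm:
  assumes "i \<le> d"
  shows "cmod (coeff (fst F) i) \<le> coeff_norm d F" "cmod (coeff (snd F) i) \<le> coeff_norm d F"
proof -
  have "max (cmod (coeff (fst F) i)) (cmod (coeff (snd F) i)) \<le> coeff_norm d F"
    unfolding coeff_norm_def using assms by (intro Max_ge) auto
  then show "cmod (coeff (fst F) i) \<le> coeff_norm d F" "cmod (coeff (snd F) i) \<le> coeff_norm d F" by auto
qed

lemma coeff_norm_nonneg: "0 \<le> coeff_norm d F"
  using cmod_coeff_le_coeff_norm(1)[of 0 d F] norm_ge_zero order_trans by blast

lemma max_norm_forms_map_le: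
  "max_norm (forms_map d F z) \<le> (real d + 1) * coeff_norm d F * max_norm z ^ d"
proof -
  have "cmod (form d p z) \<le> (real d + 1) * coeff_norm d F * max_norm z ^ d"
    if p: "\<And>i. i \<le> d \<Longrightarrow> cmod (coeff p i) \<le> coeff_norm d F" for p
  proof -
    have "cmod (form d p z) \<le> (\<Sum>i\<le>d. coeff_norm d F * max_norm z ^ d)"
      unfolding form_def
    proof (rule sum_norm_le)
      fix i assume i: "i \<in> {..d}"
      have "cmod (fst z) ^ i * cmod (snd z) ^ (d - i) \<le> max_norm z ^ i * max_norm z ^ (d - i)"
        by (intro mult_mono power_mono zero_le_power) (auto simp: max_norm_def le_max_iff_disj)
      also have "\<dots> = max_norm z ^ d" using i by (simp flip: power_add)
      finally show "cmod (coeff p i * fst z ^ i * snd z ^ (d - i)) \<le> coeff_norm d F * max_norm z ^ d"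
        using p[of i] i coeff_norm_nonneg[of d F]
        by (simp add: norm_mult norm_power mult.assoc) (intro mult_mono, auto)
    qed
    then show ?thesis by (simp add: algebra_simps)
  qed
  from this[of "fst F"] this[of "snd F"] show ?thesis
    using cmod_coeff_le_coeff_norm[of _ d F] by (simp add: forms_map_def max_norm_def)
qed

section \<open>Preimages of a point and the product formula\<close>

text \<open>The lifts may be scaled individually, but jointly the scalings have to make the product
  identity exact. Multiple preimages are repeated.\<close>

definition preimage_list :: "nat \<Rightarrow> forms \<Rightarrow> complex \<times> complex \<Rightarrow> (complex \<times> complex) list \<Rightarrow> bool" where
  "preimage_list d F y as \<longleftrightarrow> length as = d \<and> (\<forall>a\<in>set as. a \<noteq> 0) \<and>
     (\<forall>x. wedge (forms_map d F x) y = (\<Prod>a\<leftarrow>as. wedge x a))"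

lemma preimage_listD:
  assumes "preimage_list d F y as"
  shows "length as = d" "a \<in> set as \<Longrightarrow> a \<noteq> 0" "wedge (forms_map d F x) y = (\<Prod>a\<leftarrow>as. wedge x a)"
  using assms unfolding preimage_list_def by blast+

lemma form_add: "form d (p + q) z = form d p z + form d q z"
  by (simp add: form_def algebra_simps sum.distrib)

lemma exists_pairing_one:
  assumes "y \<noteq> (0 :: complex \<times> complex)"
  shows "\<exists>s t. s * fst y + t * snd y = 1"
proof (cases "fst y = 0")
  case True
  then show ?thesis using assms by (intro exI[of _ 0] exI[of _ "1 / snd y"]) (auto simp: prod_eq_iff)
next
  case False
  then show ?thesis by (intro exI[of _ "1 / fst y"] exI[of _ 0]) auto
qed

lemma form_wedge:
  "form d (Polynomial.smult (snd y) (fst F) + Polynomial.smult (- fst y) (snd F)) x =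
   wedge (forms_map d F x) y"
  by (simp add: form_add form_smult wedge_def forms_map_def mult.commute del: smult_minus_left)

lemma exists_preimage_list:
  assumes deg: "degree (fst F) \<le> d" "degree (snd F) \<le> d" and R: "Res_forms d F \<noteq> 0"
    and d: "d > 0" and y: "y \<noteq> 0"
  shows "\<exists>as. preimage_list d F y as"
proof -
  define q where "q = Polynomial.smult (snd y) (fst F) + Polynomial.smult (- fst y) (snd F)"
  have dq: "degree q \<le> d"
    unfolding q_def using deg by (intro degree_add_le order_trans[OF degree_smult_le])
  obtain s t where st: "s * fst y + t * snd y = 1" using exists_pairing_one[OF y] by blast
  have "q \<noteq> 0"
  proof
    assume q0: "q = 0"
    let ?p = "Polynomial.smult s (fst F) + Polynomial.smult t (snd F)"
    \<comment> \<open>The change of basis with \<open>wedge _ y\<close> as second form has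
      determinant of absolute value one, so it preserves nonvanishing of the resultant.\<close>
    have "Res_forms d (?p, q) = (s * (- fst y) - t * snd y) ^ d * Res_forms d (fst F, snd F)"
      unfolding q_def by (rule Res_forms_linear_combination)
    also have "s * (- fst y) - t * snd y = - 1" using st by (simp add: algebra_simps)
    finally have "Res_forms d (?p, q) \<noteq> 0" using R by simp
    moreover have "Res_forms d (?p, q) = 0"
      using resultant_sub_smult_right[of d d ?p 0 q] d by (auto simp: Res_forms_def q0 power_0_left)
    ultimately show False by simp
  qed
  then obtain as where "length as = d" "\<forall>a\<in>set as. a \<noteq> 0" "q = linear_factors as"
    using exists_linear_factors[of q "d - 1"] dq d by auto
  then show ?thesis
    using form_linear_factors[of as] form_wedge[of d y F]
    unfolding preimage_list_def q_def by (intro exI[of _ as]) simp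
qed

lemma preimage_list_maps_to:
  assumes "preimage_list d F y as" "a \<in> set as" "y \<noteq> 0"
  shows "\<exists>c. forms_map d F a = cscale c y"
proof (rule wedge_eq_0_imp_proportional)
  have "wedge a a = 0" by (simp add: wedge_def)
  then show "wedge (forms_map d F a) y = 0"
    using assms(2) by (force simp: preimage_listD(3)[OF assms(1)] prod_list_zero_iff)
qed fact

text \<open>The form \<open>wedge _ y\<close> is completed to a unimodular pair by a linear form
  with value 1 at \<open>y\<close>, whose pull-back is \<open>p\<close>. At a preimage
  \<open>a\<close> the value of \<open>p\<close> is the scalar \<open>c\<close> with
  \<open>F a = c y\<close>, and by Poisson's formula these scalars multiply to the
  resultant.\<close>

lemma prod_max_norm_preimages:
  assumes deg: "degree (fst F) \<le> d" "degree (snd F) \<le> d"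
    and y: "y \<noteq> 0" and as: "preimage_list d F y as"
  shows "(\<Prod>a\<leftarrow>as. max_norm (forms_map d F a)) = cmod (Res_forms d F) * max_norm y ^ d"
proof -
  define q where "q = Polynomial.smult (snd y) (fst F) + Polynomial.smult (- fst y) (snd F)"
  have dq: "degree q \<le> d"
    unfolding q_def using deg by (intro degree_add_le order_trans[OF degree_smult_le])
  have len: "length as = d" using as by (simp add: preimage_list_def)
  have q: "q = linear_factors as"
  proof (rule form_eq_imp_poly_eq[OF dq])
    show "degree (linear_factors as) \<le> d" using degree_linear_factors[of as] len by simp
    show "form d q z = form d (linear_factors as) z" for z
      using form_linear_factors[of as z] form_wedge[of d y F z] len
      by (simp only: q_def preimage_listD(3)[OF as])
  qed
  obtain s t where st: "s * fst y + t * snd y = 1" using exists_pairing_one[OF y] by blast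
  define p where "p = Polynomial.smult s (fst F) + Polynomial.smult t (snd F)"
  have dp: "degree p \<le> d"
    unfolding p_def using deg by (intro degree_add_le order_trans[OF degree_smult_le])
  have "Res_forms d (p, q) = (s * (- fst y) - t * snd y) ^ d * Res_forms d (fst F, snd F)"
    unfolding q_def p_def by (rule Res_forms_linear_combination)
  also have "s * (- fst y) - t * snd y = - 1" using st by (simp add: algebra_simps)
  finally have "cmod (Res_forms d F) = cmod (resultant_sub d d p q)"
    by (simp add: Res_forms_def norm_mult norm_power)
  also have "\<dots> = (\<Prod>a\<leftarrow>as. cmod (form d p a))"
    using cmod_resultant_linear_factors[OF dp, of as] as len by (simp add: q preimage_list_def)
  finally have Res: "cmod (Res_forms d F) = (\<Prod>a\<leftarrow>as. cmod (form d p a))" .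
  have "max_norm (forms_map d F a) = max_norm y * cmod (form d p a)" if a: "a \<in> set as" for a
  proof -
    obtain c where c: "forms_map d F a = cscale c y" using preimage_list_maps_to[OF as a y] by blast
    then have "form d (fst F) a = c * fst y" "form d (snd F) a = c * snd y"
      by (auto simp: forms_map_def cscale_def)
    then have "form d p a = c * (s * fst y + t * snd y)"
      by (simp add: p_def form_add form_smult algebra_simps)
    then show ?thesis by (simp add: c st max_norm_cscale mult.commute)
  qed
  then have "(\<Prod>a\<leftarrow>as. max_norm (forms_map d F a)) = (\<Prod>a\<leftarrow>as. max_norm y * cmod (form d p a))"
    by (intro arg_cong[of _ _ prod_list] map_cong) auto
  also have "\<dots> = cmod (Res_forms d F) * max_norm y ^ d"
    unfolding prod_list_mult_const Res using len by simp
  finally show ?thesis .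
qed

section \<open>Lifts with resultant of absolute value one\<close>

text \<open>\<open>(real d + 1) * coeff_norm d F\<close> bounds the map on the unit sphere. The
  extra 2 makes the logarithm nonnegative for resultants of absolute value one and absorbs the 2 in
  \<open>cmod_wedge_le\<close>.\<close>

definition log_size :: "nat \<Rightarrow> forms \<Rightarrow> real" where
  "log_size d F = ln (2 * (real d + 1) * coeff_norm d F)"

locale unimodular_forms =
  fixes d :: nat and F :: forms
  assumes d: "2 \<le> d" and deg: "degree (fst F) \<le> d" "degree (snd F) \<le> d"
    and Res: "cmod (Res_forms d F) = 1"
begin

abbreviation "h \<equiv> hom_height d F"
abbreviation "f \<equiv> forms_map d F"
abbreviation "D \<equiv> (real d + 1) * coeff_norm d F"
abbreviation "b \<equiv> log_size d F"

lemma d_pos: "d > 0" using d by simp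

lemma Res_nz: "Res_forms d F \<noteq> 0" using Res by auto

lemma f_nz: "z \<noteq> 0 \<Longrightarrow> f z \<noteq> 0"
  by (rule forms_map_nonzero[OF d_pos Res_nz])

lemma funpow_nz: "z \<noteq> 0 \<Longrightarrow> (f ^^ n) z \<noteq> 0"
  by (rule funpow_forms_map_nonzero[OF d_pos Res_nz])

lemma preimages: "y \<noteq> 0 \<Longrightarrow> \<exists>as. preimage_list d F y as"
  by (rule exists_preimage_list[OF deg Res_nz d_pos])

lemma prod_norm: "y \<noteq> 0 \<Longrightarrow> preimage_list d F y as \<Longrightarrow> (\<Prod>a\<leftarrow>as. max_norm (f a)) = max_norm y ^ d"
  using prod_max_norm_preimages[OF deg] Res by simp

lemma norm_f_le: "max_norm (f z) \<le> D * max_norm z ^ d"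
  by (rule max_norm_forms_map_le)

lemma D_nonneg: "0 \<le> D"
  by (simp add: coeff_norm_nonneg)

text \<open>Bound each factor of the product formula by \<open>norm_f_le\<close> and take
  \<open>d\<close>-th roots.\<close>

lemma norm_le_prod_preimages:
  assumes y: "y \<noteq> 0" and as: "preimage_list d F y as"
  shows "max_norm y \<le> D * (\<Prod>a\<leftarrow>as. max_norm a)"
proof -
  have len: "length as = d" using as by (simp add: preimage_list_def)
  have "max_norm y ^ d = (\<Prod>a\<leftarrow>as. max_norm (f a))" using prod_norm[OF y as] by simp
  also have "\<dots> \<le> (\<Prod>a\<leftarrow>as. D * max_norm a ^ d)"
    by (intro prod_list_mono_nonneg) (use norm_f_le in auto)
  also have "\<dots> = (D * (\<Prod>a\<leftarrow>as. max_norm a)) ^ d"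
    by (simp only: prod_list_mult_const prod_list_power power_mult_distrib len)
  finally show ?thesis
    using d_pos by (rule_tac power_le_imp_le_base[of _ "d - 1"])
      (auto intro!: mult_nonneg_nonneg coeff_norm_nonneg prod_list_mono_nonneg(2)[where g = max_norm])
qed

text \<open>Evaluate the product identity at a point of norm one where the product of the linear
  forms is at least the product of their norms.\<close>

lemma prod_preimages_le:
  assumes as: "preimage_list d F y as"
  shows "(\<Prod>a\<leftarrow>as. max_norm a) \<le> 2 * D * max_norm y"
proof -
  obtain z where z: "max_norm z = 1" "(\<Prod>a\<leftarrow>as. max_norm a) \<le> (\<Prod>a\<leftarrow>as. cmod (wedge z a))"
    using exists_unit_prod_wedge_ge by blast
  have "(\<Prod>a\<leftarrow>as. cmod (wedge z a)) = cmod (wedge (f z) y)"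
    by (simp only: preimage_listD(3)[OF as] norm_prod_list)
  also have "\<dots> \<le> 2 * max_norm (f z) * max_norm y" by (rule cmod_wedge_le)
  also have "\<dots> \<le> 2 * D * max_norm y"
    using norm_f_le[of z] z(1) by (intro mult_right_mono) auto
  finally show ?thesis using z(2) by simp
qed

text \<open>The lower and the upper bound for the product of the preimages of a single point combine
  to \<open>1 \<le> D * (2 * D)\<close>.\<close>

lemma one_le_2D: "1 \<le> 2 * D"
proof -
  have nz: "((1, 0) :: complex \<times> complex) \<noteq> 0" by (simp add: zero_prod_def)
  obtain as where as: "preimage_list d F (1, 0) as" using preimages[OF nz] by blast
  have n1: "max_norm (1, 0) = 1" by (simp add: max_norm_def)
  have "1 \<le> D * (\<Prod>a\<leftarrow>as. max_norm a)" using norm_le_prod_preimages[OF nz as] n1 by simp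
  also have "\<dots> \<le> D * (2 * D)"
    using prod_preimages_le[OF as] n1 D_nonneg by (intro mult_left_mono) auto
  also have "\<dots> \<le> (2 * D) * (2 * D)"
    using D_nonneg by (intro mult_right_mono; linarith)
  finally have "1 ^ 2 \<le> (2 * D) ^ 2" by (simp only: power2_eq_square mult_1)
  then show ?thesis using D_nonneg by (rule_tac power2_le_imp_le) auto
qed

lemma b_eq: "b = ln (2 * D)"
  by (simp only: log_size_def mult.assoc)

lemma b_nonneg: "0 \<le> b"
  using one_le_2D by (simp add: b_eq)

lemma exp_b: "exp b = 2 * D"
  using one_le_2D by (simp add: b_eq)

text \<open>A Nullstellensatz with explicit constant. Up to a scalar, \<open>x\<close> is one of the
  preimages of \<open>f x\<close>; bounding the other factors of the product formula from above
  bounds the factor of \<open>x\<close>, and hence \<open>f x\<close>, from below.\<close>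

lemma norm_f_ge_unit:
  assumes x: "max_norm x = 1"
  shows "1 \<le> (2 * D) ^ (2 * d) * max_norm (f x)"
proof -
  have x0: "x \<noteq> 0" using x by auto
  define y where "y = f x"
  have y0: "y \<noteq> 0" using f_nz[OF x0] by (simp add: y_def)
  have Ny: "max_norm y > 0" using y0 by (simp add: max_norm_pos_iff)
  obtain as where as: "preimage_list d F y as" using preimages[OF y0] by blast
  have len: "length as = d" using as by (simp add: preimage_list_def)
  have "(\<Prod>a\<leftarrow>as. wedge x a) = 0"
    unfolding preimage_listD(3)[OF as, symmetric] by (simp add: y_def wedge_def)
  then obtain a where a: "a \<in> set as" "wedge x a = 0" by (auto simp: prod_list_zero_iff)
  have "wedge a x = 0" using a(2) cmod_wedge_commute[of x a] by simp
  then obtain t where t: "a = cscale t x" using wedge_eq_0_imp_proportional x0 by blast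
  have Na: "max_norm (f a) = max_norm a ^ d * max_norm y"
    by (simp add: t forms_map_cscale max_norm_cscale x norm_power y_def)
  let ?r = "remove1 a as"
  have lr: "length ?r = d - 1" using a(1) len by (simp add: length_remove1)
  have "max_norm y ^ d = max_norm (f a) * (\<Prod>a\<leftarrow>?r. max_norm (f a))"
    using prod_norm[OF y0 as] prod_list_map_remove1[OF a(1), of "\<lambda>a. max_norm (f a)"] by simp
  also have "\<dots> \<le> max_norm (f a) * (\<Prod>a\<leftarrow>?r. D * max_norm a ^ d)"
    by (intro mult_left_mono prod_list_mono_nonneg) (use norm_f_le in auto)
  also have "\<dots> = max_norm y * D ^ (d - 1) * (max_norm a * (\<Prod>a\<leftarrow>?r. max_norm a)) ^ d"
    by (simp only: prod_list_mult_const prod_list_power power_mult_distrib lr Na mult_ac)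
  also have "max_norm a * (\<Prod>a\<leftarrow>?r. max_norm a) = (\<Prod>a\<leftarrow>as. max_norm a)"
    using prod_list_map_remove1[OF a(1), of max_norm] by simp
  also have "max_norm y * D ^ (d - 1) * (\<Prod>a\<leftarrow>as. max_norm a) ^ d \<le>
      max_norm y * D ^ (d - 1) * (2 * D * max_norm y) ^ d"
    using prod_preimages_le[OF as] D_nonneg
    by (intro mult_left_mono power_mono mult_nonneg_nonneg zero_le_power
        prod_list_mono_nonneg(2)[where g = max_norm] coeff_norm_nonneg) auto
  finally have "max_norm y ^ d * 1 \<le> max_norm y ^ d * (max_norm y * D ^ (d - 1) * (2 * D) ^ d)"
    by (simp add: power_mult_distrib mult_ac)
  then have "1 \<le> max_norm y * (D ^ (d - 1) * (2 * D) ^ d)"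
    using Ny by (subst (asm) mult_le_cancel_left_pos) (auto simp: mult_ac)
  also have "\<dots> \<le> max_norm y * ((2 * D) ^ d * (2 * D) ^ d)"
  proof (intro mult_left_mono mult_right_mono)
    have "D ^ (d - 1) \<le> (2 * D) ^ (d - 1)"
      using coeff_norm_nonneg[of d F] by (intro power_mono) auto
    also have "\<dots> \<le> (2 * D) ^ d" using one_le_2D by (intro power_increasing) auto
    finally show "D ^ (d - 1) \<le> (2 * D) ^ d" .
  qed (use coeff_norm_nonneg in auto)
  also have "\<dots> = (2 * D) ^ (2 * d) * max_norm (f x)"
    unfolding y_def mult_2[of d] power_add by (rule mult.commute)
  finally show ?thesis .
qed

lemma ln_norm_f_bound:
  assumes x: "x \<noteq> 0"
  shows "\<bar>ln (max_norm (f x)) - real d * ln (max_norm x)\<bar> \<le> 2 * real d * b"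
proof -
  define m where "m = max_norm x"
  have m: "m > 0" using x by (simp add: m_def max_norm_pos_iff)
  define w where "w = cscale (of_real (1 / m)) x"
  have w: "max_norm w = 1" using m by (simp add: w_def max_norm_cscale norm_divide flip: m_def)
  have "x = cscale (of_real m) w" using m by (simp add: w_def)
  then have "max_norm (f x) = m ^ d * max_norm (f w)"
    using m by (simp add: forms_map_cscale max_norm_cscale norm_power)
  moreover have w0: "w \<noteq> 0" using w by force
  then have fw: "max_norm (f w) > 0" using f_nz[of w] by (simp add: max_norm_pos_iff)
  ultimately have eq: "ln (max_norm (f x)) - real d * ln (max_norm x) = ln (max_norm (f w))"
    using m by (simp add: ln_mult ln_realpow m_def)
  have "max_norm (f w) \<le> exp b"
    using norm_f_le[of w] w D_nonneg by (simp add: exp_b)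
  then have "ln (max_norm (f w)) \<le> b" using fw by (metis ln_exp ln_le_cancel_iff exp_gt_zero)
  moreover have "b \<le> 2 * real d * b" using d b_nonneg mult_right_mono[of 1 "2 * real d" b] by simp
  moreover have "0 \<le> 2 * real d * b + ln (max_norm (f w))"
  proof -
    have "1 \<le> exp b ^ (2 * d) * max_norm (f w)" using norm_f_ge_unit[OF w] by (simp only: exp_b)
    then have "ln 1 \<le> ln (exp b ^ (2 * d) * max_norm (f w))" using fw by (subst ln_le_cancel_iff) auto
    then show ?thesis using fw by (simp add: ln_mult ln_realpow)
  qed
  ultimately show ?thesis unfolding eq by linarith
qed

text \<open>The errors \<open>2 * d * b\<close> of the single steps add up like a geometric series,
  and \<open>2 * d / (d - 1) \<le> 4\<close> since \<open>d \<ge> 2\<close>.\<close>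

lemma ln_norm_funpow_bound:
  assumes x: "x \<noteq> 0"
  shows "\<bar>ln (max_norm ((f ^^ n) x)) - real d ^ n * ln (max_norm x)\<bar> \<le> 4 * b * (real d ^ n - 1)"
proof (induction n)
  case (Suc n)
  let ?w = "(f ^^ n) x"
  have "\<bar>ln (max_norm (f ?w)) - real d * ln (max_norm ?w)\<bar> \<le> 2 * real d * b"
    by (rule ln_norm_f_bound[OF funpow_nz[OF x]])
  moreover have "\<bar>real d * ln (max_norm ?w) - real d * (real d ^ n * ln (max_norm x))\<bar>
      \<le> real d * (4 * b * (real d ^ n - 1))"
    using Suc by (simp add: abs_mult mult_left_mono flip: right_diff_distrib)
  moreover have "4 * b * 1 \<le> 2 * b * real d"
    using d b_nonneg mult_left_mono[of 2 "real d" "2 * b"] by simp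
  ultimately show ?case by (simp add: algebra_simps)
qed simp

lemma height_LIMSEQ: "x \<noteq> 0 \<Longrightarrow> (\<lambda>n. ln (max_norm ((f ^^ n) x)) / real d ^ n) \<longlonglongrightarrow> h x"
  by (rule hom_height_LIMSEQ[OF d Res_nz])

lemma height_bound:
  assumes x: "x \<noteq> 0"
  shows "\<bar>h x - ln (max_norm x)\<bar> \<le> 4 * b"
proof (rule LIMSEQ_le_const2)
  show "(\<lambda>n. \<bar>ln (max_norm ((f ^^ n) x)) / real d ^ n - ln (max_norm x)\<bar>) \<longlonglongrightarrow> \<bar>h x - ln (max_norm x)\<bar>"
    by (intro tendsto_intros height_LIMSEQ x)
  have "\<bar>ln (max_norm ((f ^^ n) x)) / real d ^ n - ln (max_norm x)\<bar> \<le> 4 * b" for n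
  proof -
    have "ln (max_norm ((f ^^ n) x)) / real d ^ n - ln (max_norm x) =
        (ln (max_norm ((f ^^ n) x)) - real d ^ n * ln (max_norm x)) / real d ^ n"
      using d_pos by (simp add: diff_divide_distrib)
    then have "\<bar>ln (max_norm ((f ^^ n) x)) / real d ^ n - ln (max_norm x)\<bar> =
        \<bar>ln (max_norm ((f ^^ n) x)) - real d ^ n * ln (max_norm x)\<bar> / real d ^ n"
      by (simp only: abs_divide) simp
    also have "\<dots> \<le> 4 * b * (real d ^ n - 1) / real d ^ n"
      using ln_norm_funpow_bound[OF x] d_pos by (intro divide_right_mono) auto
    also have "\<dots> \<le> 4 * b" using d_pos b_nonneg by (simp add: field_simps)
    finally show ?thesis .
  qed
  then show "\<exists>N. \<forall>n\<ge>N. \<bar>ln (max_norm ((f ^^ n) x)) / real d ^ n - ln (max_norm x)\<bar> \<le> 4 * b" by blast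
qed

lemma height_f:
  assumes x: "x \<noteq> 0"
  shows "h (f x) = real d * h x"
proof (rule LIMSEQ_unique[OF height_LIMSEQ[OF f_nz[OF x]]])
  have "(\<lambda>n. real d * (ln (max_norm ((f ^^ Suc n) x)) / real d ^ Suc n)) \<longlonglongrightarrow> real d * h x"
    by (intro tendsto_intros LIMSEQ_Suc[OF height_LIMSEQ] x)
  then show "(\<lambda>n. ln (max_norm ((f ^^ n) (f x))) / real d ^ n) \<longlonglongrightarrow> real d * h x"
    using d_pos by (simp add: funpow_swap1)
qed

lemma height_funpow: "x \<noteq> 0 \<Longrightarrow> h ((f ^^ n) x) = real d ^ n * h x"
  by (induction n) (simp_all add: height_f funpow_nz)

lemma height_funpow_bound:
  "x \<noteq> 0 \<Longrightarrow> \<bar>real d ^ n * h x - ln (max_norm ((f ^^ n) x))\<bar> \<le> 4 * b"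
  using height_bound[OF funpow_nz, of x n] by (simp add: height_funpow)

lemma height_cscale: "z \<noteq> 0 \<Longrightarrow> c \<noteq> 0 \<Longrightarrow> h (cscale c z) = h z + ln (cmod c)"
  by (rule hom_height_cscale[OF d Res_nz])

end

section \<open>Logarithmic potentials of iterated preimages\<close>

lemma ln_prod_list:
  assumes "\<And>x. x \<in> set xs \<Longrightarrow> (0::real) < f x"
  shows "ln (\<Prod>x\<leftarrow>xs. f x) = (\<Sum>x\<leftarrow>xs. ln (f x))" "0 < (\<Prod>x\<leftarrow>xs. f x)"
proof -
  have "0 < (\<Prod>x\<leftarrow>xs. f x) \<and> ln (\<Prod>x\<leftarrow>xs. f x) = (\<Sum>x\<leftarrow>xs. ln (f x))"
    using assms
  proof (induction xs)
    case (Cons a xs)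
    then have "0 < f a" "0 < (\<Prod>x\<leftarrow>xs. f x)" "ln (\<Prod>x\<leftarrow>xs. f x) = (\<Sum>x\<leftarrow>xs. ln (f x))" by auto
    then show ?case using ln_mult_pos[of "f a" "\<Prod>x\<leftarrow>xs. f x"] by simp
  qed simp
  then show "ln (\<Prod>x\<leftarrow>xs. f x) = (\<Sum>x\<leftarrow>xs. ln (f x))" "0 < (\<Prod>x\<leftarrow>xs. f x)" by auto
qed

lemma sum_list_map_concat:
  "(\<Sum>x\<leftarrow>concat xss. g x) = (\<Sum>xs\<leftarrow>xss. \<Sum>x\<leftarrow>xs. (g x :: real))"
  by (induction xss) simp_all

lemma prod_list_map_concat:
  "(\<Prod>x\<leftarrow>concat xss. g x) = (\<Prod>xs\<leftarrow>xss. \<Prod>x\<leftarrow>xs. (g x :: real))"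
  by (induction xss) simp_all

lemma exists_unit_sum_ln_wedge_ge:
  assumes "\<And>a. a \<in> set as \<Longrightarrow> a \<noteq> 0"
  shows "\<exists>z. max_norm z = 1 \<and> (\<forall>a\<in>set as. wedge z a \<noteq> 0) \<and>
    (\<Sum>a\<leftarrow>as. ln (max_norm a)) \<le> (\<Sum>a\<leftarrow>as. ln (cmod (wedge z a)))"
proof -
  obtain z where z: "max_norm z = 1" "(\<Prod>a\<leftarrow>as. max_norm a) \<le> (\<Prod>a\<leftarrow>as. cmod (wedge z a))"
    using exists_unit_prod_wedge_ge by blast
  have pos: "0 < max_norm a" if "a \<in> set as" for a using assms[OF that] by (simp add: max_norm_pos_iff)
  have p: "0 < (\<Prod>a\<leftarrow>as. max_norm a)" by (rule ln_prod_list(2)) (rule pos)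
  have nz: "wedge z a \<noteq> 0" if "a \<in> set as" for a
  proof
    assume "wedge z a = 0"
    then have "0 \<in> set (map (\<lambda>a. cmod (wedge z a)) as)" using that by force
    then have "(\<Prod>a\<leftarrow>as. cmod (wedge z a)) = 0" by (simp only: prod_list_zero_iff)
    with z(2) p show False by linarith
  qed
  have "ln (\<Prod>a\<leftarrow>as. max_norm a) \<le> ln (\<Prod>a\<leftarrow>as. cmod (wedge z a))"
    using z(2) p by (subst ln_le_cancel_iff) auto
  moreover have "ln (\<Prod>a\<leftarrow>as. max_norm a) = (\<Sum>a\<leftarrow>as. ln (max_norm a))"
    by (rule ln_prod_list(1)) (rule pos)
  moreover have "ln (\<Prod>a\<leftarrow>as. cmod (wedge z a)) = (\<Sum>a\<leftarrow>as. ln (cmod (wedge z a)))"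
    by (rule ln_prod_list(1)) (simp add: nz)
  ultimately show ?thesis using z(1) nz by (intro exI[of _ z]) simp
qed

lemma cmod_coeff_linear_factors_le:
  "cmod (coeff (linear_factors as) i) \<le> 2 ^ length as * (\<Prod>a\<leftarrow>as. max_norm a)"
proof (induction as arbitrary: i)
  case Nil
  then show ?case by (simp add: coeff_1)
next
  case (Cons a as)
  let ?B = "2 ^ length as * (\<Prod>a\<leftarrow>as. max_norm a)"
  have a: "cmod (fst a) \<le> max_norm a" "cmod (snd a) \<le> max_norm a" by (auto simp: max_norm_def)
  have "cmod (fst a * coeff (linear_factors as) i) \<le> max_norm a * ?B"
    unfolding norm_mult by (intro mult_mono a Cons) auto
  moreover have "cmod (case i of 0 \<Rightarrow> 0 | Suc j \<Rightarrow> snd a * coeff (linear_factors as) j) \<le> max_norm a * ?B"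
  proof (cases i)
    case 0
    have "0 \<le> ?B" using Cons[of 0] norm_ge_zero order_trans by blast
    then show ?thesis using 0 by simp
  next
    case (Suc j)
    then show ?thesis by (simp only: nat.case norm_mult) (intro mult_mono a Cons, auto)
  qed
  moreover have "coeff (linear_factors (a # as)) i = - (fst a * coeff (linear_factors as) i) +
      (case i of 0 \<Rightarrow> 0 | Suc j \<Rightarrow> snd a * coeff (linear_factors as) j)"
    by (simp add: coeff_pCons split: nat.split)
  ultimately have "cmod (coeff (linear_factors (a # as)) i) \<le> max_norm a * ?B + max_norm a * ?B"
    using norm_triangle_ineq[of "- (fst a * coeff (linear_factors as) i)"] by (smt (verit) norm_minus_cancel)
  then show ?case by (simp add: mult_ac)
qed

context unimodular_forms
begin

text \<open>For a target of height zero, \<open>d * h a\<close> is the logarithm of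
  \<open>max_norm (f a) / max_norm y\<close>, so the product formula says that the heights of the
  preimages sum to zero. Scaling each lift to height zero therefore leaves the product
  unchanged.\<close>

lemma normalized_preimages:
  assumes y: "y \<noteq> 0" "h y = 0"
  shows "\<exists>as. length as = d \<and> (\<forall>a\<in>set as. a \<noteq> 0 \<and> h a = 0) \<and>
    (\<forall>x. cmod (wedge (f x) y) = (\<Prod>a\<leftarrow>as. cmod (wedge x a)))"
proof -
  obtain as where as: "preimage_list d F y as" using preimages[OF y(1)] by blast
  note asD = preimage_listD[OF as]
  have dh: "real d * h a = ln (max_norm (f a)) - ln (max_norm y)" if a: "a \<in> set as" for a
  proof -
    obtain c where c: "f a = cscale c y" using preimage_list_maps_to[OF as a y(1)] by blast
    have c0: "c \<noteq> 0" using f_nz[OF asD(2)[OF a]] c by auto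
    have "real d * h a = h (f a)" using height_f asD(2)[OF a] by simp
    also have "\<dots> = ln (cmod c)" using height_cscale[OF y(1) c0] y(2) by (simp add: c)
    also have "\<dots> = ln (max_norm (f a)) - ln (max_norm y)"
      using c0 max_norm_pos[OF y(1)] by (simp add: c max_norm_cscale ln_mult)
    finally show ?thesis .
  qed
  have "real d * (\<Sum>a\<leftarrow>as. h a) = (\<Sum>a\<leftarrow>as. ln (max_norm (f a)) - ln (max_norm y))"
    unfolding sum_list_const_mult[symmetric] using dh by (intro arg_cong[of _ _ sum_list] map_cong) auto
  also have "\<dots> = ln (\<Prod>a\<leftarrow>as. max_norm (f a)) - real d * ln (max_norm y)"
    using f_nz asD(1,2)
    by (subst ln_prod_list(1)) (auto simp: sum_list_subtractf sum_list_triv max_norm_pos_iff)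
  also have "\<dots> = 0"
    using y(1) by (simp add: prod_norm[OF y(1) as] ln_realpow max_norm_pos_iff)
  finally have sum0: "(\<Sum>a\<leftarrow>as. h a) = 0" using d_pos by simp
  define bs where "bs = map (\<lambda>a. cscale (of_real (exp (- h a))) a) as"
  have "h (cscale (of_real (exp (- h a))) a) = 0" if "a \<in> set as" for a
    using height_cscale[OF asD(2)[OF that], of "of_real (exp (- h a))"] by simp
  then have "\<forall>a\<in>set bs. a \<noteq> 0 \<and> h a = 0" using asD(2) by (auto simp: bs_def)
  moreover have "cmod (wedge (f x) y) = (\<Prod>a\<leftarrow>bs. cmod (wedge x a))" for x
  proof -
    have "(\<Prod>a\<leftarrow>bs. cmod (wedge x a)) = (\<Prod>a\<leftarrow>as. exp (- h a) * cmod (wedge x a))"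
      by (simp add: bs_def o_def wedge_cscale_right norm_mult)
    also have "\<dots> = exp (- (\<Sum>a\<leftarrow>as. h a)) * (\<Prod>a\<leftarrow>as. cmod (wedge x a))"
      by (induction as) (simp_all add: exp_add exp_diff exp_minus field_simps)
    finally show ?thesis by (simp add: sum0 asD(3) norm_prod_list)
  qed
  ultimately show ?thesis using asD(1) by (intro exI[of _ bs]) (simp add: bs_def)
qed

text \<open>The preimages have height zero again and serve as new targets, so no constant
  accumulates.\<close>

lemma iterated_preimages:
  assumes y: "y \<noteq> 0" "h y = 0"
  shows "\<exists>as. length as = d ^ n \<and> (\<forall>a\<in>set as. a \<noteq> 0 \<and> h a = 0) \<and>
    (\<forall>x. cmod (wedge ((f ^^ n) x) y) = (\<Prod>a\<leftarrow>as. cmod (wedge x a)))"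
proof (induction n)
  case 0
  then show ?case using y by (intro exI[of _ "[y]"]) simp
next
  case (Suc n)
  then obtain as where as: "length as = d ^ n" "\<forall>a\<in>set as. a \<noteq> 0 \<and> h a = 0"
    "\<forall>x. cmod (wedge ((f ^^ n) x) y) = (\<Prod>a\<leftarrow>as. cmod (wedge x a))" by blast
  obtain g where g: "\<And>a. a \<in> set as \<Longrightarrow> length (g a) = d \<and> (\<forall>b\<in>set (g a). b \<noteq> 0 \<and> h b = 0) \<and>
    (\<forall>x. cmod (wedge (f x) a) = (\<Prod>b\<leftarrow>g a. cmod (wedge x b)))"
    using normalized_preimages as(2) by metis
  have "length (concat (map g as)) = d ^ Suc n"
  proof -
    have "map (length \<circ> g) as = map (\<lambda>_. d) as" using g by (intro map_cong) auto
    then show ?thesis by (simp only: length_concat map_map as(1) sum_list_triv of_nat_id power_Suc mult.commute)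
  qed
  moreover have "\<forall>b\<in>set (concat (map g as)). b \<noteq> 0 \<and> h b = 0" using g by auto
  moreover have "cmod (wedge ((f ^^ Suc n) x) y) = (\<Prod>b\<leftarrow>concat (map g as). cmod (wedge x b))" for x
  proof -
    have "cmod (wedge ((f ^^ Suc n) x) y) = (\<Prod>a\<leftarrow>as. cmod (wedge (f x) a))"
      using as(3) by (simp only: funpow_Suc_right o_apply)
    also have "\<dots> = (\<Prod>a\<leftarrow>as. \<Prod>b\<leftarrow>g a. cmod (wedge x b))"
      using g by (intro arg_cong[of _ _ prod_list] map_cong refl) blast
    finally show ?thesis by (simp only: prod_list_map_concat map_map o_def)
  qed
  ultimately show ?case by blast
qed

text \<open>The two families are the \<open>n\<close>-fold preimages of \<open>0\<close> and \<open>\<infinity>\<close>, lifted to height zero.\<close>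

lemma iterate_potentials:
  obtains A :: "bool \<Rightarrow> (complex \<times> complex) list"
  where "\<forall>i. length (A i) = d ^ n" "\<forall>i. \<forall>a\<in>set (A i). a \<noteq> 0 \<and> h a = 0"
    and "\<forall>i x. x \<noteq> 0 \<longrightarrow> (\<forall>a\<in>set (A i). wedge x a \<noteq> 0) \<longrightarrow>
      (\<Sum>a\<leftarrow>A i. ln (cmod (wedge x a))) \<le> real d ^ n * h x + 8 * b"
    and "\<forall>x. x \<noteq> 0 \<longrightarrow> (\<exists>i. (\<forall>a\<in>set (A i). wedge x a \<noteq> 0) \<and>
      real d ^ n * h x \<le> (\<Sum>a\<leftarrow>A i. ln (cmod (wedge x a))) + 8 * b)"
proof -
  define e where "e i = (if i then (1, 0) else (0, 1) :: complex \<times> complex)" for i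
  have e0: "e i \<noteq> 0" "max_norm (e i) = 1" for i by (auto simp: e_def zero_prod_def max_norm_def)
  define s where "s i = (of_real (exp (- h (e i))) :: complex)" for i
  have s: "s i \<noteq> 0" "cmod (s i) = exp (- h (e i))" for i by (simp_all add: s_def)
  have y: "cscale (s i) (e i) \<noteq> 0" "h (cscale (s i) (e i)) = 0" for i
    using e0 s height_cscale[OF e0(1) s(1), of i i] by auto
  have "\<exists>A. \<forall>i. length (A i) = d ^ n \<and> (\<forall>a\<in>set (A i). a \<noteq> 0 \<and> h a = 0) \<and>
    (\<forall>x. cmod (wedge ((f ^^ n) x) (cscale (s i) (e i))) = (\<Prod>a\<leftarrow>A i. cmod (wedge x a)))"
    by (rule choice) (use iterated_preimages[OF y] in blast)
  then obtain A where A: "\<And>i. length (A i) = d ^ n" "\<And>i a. a \<in> set (A i) \<Longrightarrow> a \<noteq> 0 \<and> h a = 0"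
    "\<And>i x. cmod (wedge ((f ^^ n) x) (cscale (s i) (e i))) = (\<Prod>a\<leftarrow>A i. cmod (wedge x a))"
    by blast
  have he: "\<bar>h (e i)\<bar> \<le> 4 * b" for i using height_bound[OF e0(1), of i] e0(2) by simp
  have logs: "ln (cmod (wedge ((f ^^ n) x) (e i))) - h (e i) = (\<Sum>a\<leftarrow>A i. ln (cmod (wedge x a)))"
    if "\<forall>a\<in>set (A i). wedge x a \<noteq> 0" for i x
  proof -
    have pos: "0 < (\<Prod>a\<leftarrow>A i. cmod (wedge x a))" by (rule ln_prod_list(2)) (use that in auto)
    then have nz: "wedge ((f ^^ n) x) (e i) \<noteq> 0"
      unfolding A(3)[symmetric] by (auto simp: wedge_cscale_right)
    have "(\<Sum>a\<leftarrow>A i. ln (cmod (wedge x a))) = ln (\<Prod>a\<leftarrow>A i. cmod (wedge x a))"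
      by (rule ln_prod_list(1)[symmetric]) (use that in auto)
    also have "\<dots> = ln (cmod (wedge ((f ^^ n) x) (e i))) - h (e i)"
      unfolding A(3)[symmetric] using nz by (simp add: wedge_cscale_right norm_mult s ln_mult)
    finally show ?thesis by simp
  qed
  \<comment> \<open>Against a coordinate vector the wedge is one coordinate up to sign. Each is at
    most the norm and one attains it, so the lower bound is available for one of the two families,
    depending on the point.\<close>
  have wle: "cmod (wedge z (e i)) \<le> max_norm z" for z i
    by (auto simp: wedge_def e_def max_norm_def)
  have weq: "\<exists>i. cmod (wedge z (e i)) = max_norm z" for z
    unfolding wedge_def e_def max_norm_def max_def
    by (cases "cmod (fst z) \<le> cmod (snd z)") (auto intro: exI[of _ True] exI[of _ False])
  have upper: "(\<Sum>a\<leftarrow>A i. ln (cmod (wedge x a))) \<le> real d ^ n * h x + 8 * b"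
    if x: "x \<noteq> 0" and nz: "\<forall>a\<in>set (A i). wedge x a \<noteq> 0" for i x
  proof -
    have "0 < (\<Prod>a\<leftarrow>A i. cmod (wedge x a))" by (rule ln_prod_list(2)) (use nz in auto)
    then have "0 < cmod (wedge ((f ^^ n) x) (e i))"
      unfolding A(3)[symmetric] by (auto simp: wedge_cscale_right)
    then have "ln (cmod (wedge ((f ^^ n) x) (e i))) \<le> ln (max_norm ((f ^^ n) x))"
      using wle[of "(f ^^ n) x" i] by (subst ln_le_cancel_iff) linarith+
    \<comment> \<open>\<open>4 * b\<close> for the height of \<open>e i\<close> and
      \<open>4 * b\<close> for the iterate, whatever \<open>n\<close> is.\<close>
    then show ?thesis using logs[OF nz] he[of i] height_funpow_bound[OF x, of n] by linarith
  qed
  have lower: "\<exists>i. (\<forall>a\<in>set (A i). wedge x a \<noteq> 0) \<and>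
      real d ^ n * h x \<le> (\<Sum>a\<leftarrow>A i. ln (cmod (wedge x a))) + 8 * b" if x: "x \<noteq> 0" for x
  proof -
    obtain i where i: "cmod (wedge ((f ^^ n) x) (e i)) = max_norm ((f ^^ n) x)" using weq by blast
    have "0 < cmod (wedge ((f ^^ n) x) (e i))" unfolding i using funpow_nz[OF x] by (simp add: max_norm_pos_iff)
    then have "(\<Prod>a\<leftarrow>A i. cmod (wedge x a)) \<noteq> 0"
      unfolding A(3)[symmetric] using s(1) by (auto simp: wedge_cscale_right)
    then have nz: "\<forall>a\<in>set (A i). wedge x a \<noteq> 0" by (force simp: prod_list_zero_iff)
    then show ?thesis using logs[OF nz] he[of i] height_funpow_bound[OF x, of n] i
      by (intro exI[of _ i]) auto
  qed
  show ?thesis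
    by (rule that[of A]; (intro allI ballI impI)?) (fact A(1), fact A(2), erule upper, assumption, erule lower)
qed

text \<open>Lets the linear factors of the largest component take part in the choice of a point
  \<open>z\<close>: where they are jointly large, \<open>f z\<close> is nearly as large as the
  coefficients.\<close>

lemma exists_large_component:
  "\<exists>ps. length ps = d \<and> (\<forall>p\<in>set ps. p \<noteq> 0) \<and> coeff_norm d F \<le> 2 ^ d * (\<Prod>p\<leftarrow>ps. max_norm p) \<and>
    (\<forall>z. (\<Prod>p\<leftarrow>ps. cmod (wedge z p)) \<le> max_norm (f z))"
proof -
  let ?c = "\<lambda>i. max (cmod (coeff (fst F) i)) (cmod (coeff (snd F) i))"
  have "coeff_norm d F \<in> ?c ` {..d}" unfolding coeff_norm_def by (rule Max_in) auto
  then obtain i where i: "coeff_norm d F = ?c i" by auto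
  obtain p where p: "p = fst F \<or> p = snd F" "cmod (coeff p i) = coeff_norm d F"
    using i by (metis max_def)
  have "coeff_norm d F \<noteq> 0" using one_le_2D by auto
  then have "p \<noteq> 0" using p(2) by auto
  moreover have "degree p \<le> d" using p(1) deg by auto
  ultimately obtain ps where ps: "length ps = d" "\<forall>a\<in>set ps. a \<noteq> 0" "p = linear_factors ps"
    using exists_linear_factors[of p "d - 1"] d_pos by auto
  have "(\<Prod>p\<leftarrow>ps. cmod (wedge z p)) \<le> max_norm (f z)" for z
  proof -
    have "(\<Prod>p\<leftarrow>ps. cmod (wedge z p)) = cmod (form d p z)"
      using form_linear_factors[of ps z] ps by (simp add: norm_prod_list)
    also have "\<dots> \<le> max_norm (f z)" using p(1) by (auto simp: forms_map_def max_norm_def)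
    finally show ?thesis .
  qed
  then show ?thesis
    using ps cmod_coeff_linear_factors_le[of ps i] p(2) by (intro exI[of _ ps]) auto
qed

end

section \<open>Small heights force small coefficients\<close>

lemma sum_list_if_const:
  "(\<Sum>x\<leftarrow>xs. if P x then c else 0) = c * (\<Sum>x\<leftarrow>xs. if P x then 1 else (0::real))"
  by (induction xs) (auto simp: algebra_simps)

context unimodular_forms
begin

text \<open>A point \<open>x = f z\<close> with \<open>z\<close> of norm one and \<open>f z\<close> almost as large as the
  coefficients has a very negative normalized height. By the product formula the preimages of very
  negative normalized height (the bad ones) form a small proportion, so the potential at \<open>x\<close> is not
  much smaller than the potential at the nearest good preimage \<open>x'\<close>, where the height vanishes.\<close>

lemma log_size_le_height_excess:
  assumes M: "0 \<le> M" and hM: "\<And>x. x \<noteq> 0 \<Longrightarrow> h x \<le> M + ln (max_norm x)"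
  shows "b \<le> (6 * real d + 32) * (M + 1)"
proof (cases "b = 0")
  case True
  then show ?thesis using M by simp
next
  case False
  then have b: "0 < b" using b_nonneg by simp
  \<comment> \<open>Here \<open>n\<close> may depend on \<open>F\<close>: the error
    \<open>8 * b\<close> of the potentials becomes at most \<open>k\<close>, a bounded error per
    preimage.\<close>
  obtain n where n: "8 * b < real d ^ n" using real_arch_pow[of "real d" "8 * b"] d by auto
  define k where "k = real d ^ n"
  have k: "0 < k" "8 * b \<le> k" using n d_pos by (auto simp: k_def)
  obtain A :: "bool \<Rightarrow> (complex \<times> complex) list"
    where len: "\<forall>i. length (A i) = d ^ n" and A': "\<forall>i. \<forall>a\<in>set (A i). a \<noteq> 0 \<and> h a = 0"
    and Lower: "\<forall>i x. x \<noteq> 0 \<longrightarrow> (\<forall>a\<in>set (A i). wedge x a \<noteq> 0) \<longrightarrow>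
      (\<Sum>a\<leftarrow>A i. ln (cmod (wedge x a))) \<le> k * h x + 8 * b"
    and Upper: "\<forall>x. x \<noteq> 0 \<longrightarrow> (\<exists>i. (\<forall>a\<in>set (A i). wedge x a \<noteq> 0) \<and>
      k * h x \<le> (\<Sum>a\<leftarrow>A i. ln (cmod (wedge x a))) + 8 * b)"
    by (rule iterate_potentials[of n, folded k_def])
  note len = len[rule_format] and Upper = Upper[rule_format]
  have Lower: "(\<Sum>a\<leftarrow>A i. ln (cmod (wedge x a))) \<le> k * h x + 8 * b"
    if "x \<noteq> 0" "\<forall>a\<in>set (A i). wedge x a \<noteq> 0" for i x
    using that by (rule Lower[THEN spec, THEN spec, THEN mp, THEN mp])
  have A: "a \<noteq> 0" "h a = 0" if "a \<in> set (A i)" for i a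
    using A'[THEN spec, THEN bspec, OF that] by simp_all
  have const: "(\<Sum>a\<leftarrow>A i. c) = k * c" for i c by (simp add: sum_list_triv len k_def)
  have Npos: "0 < max_norm a" if "a \<in> set (A i)" for a i using A(1)[OF that] by (simp add: max_norm_pos_iff)
  \<comment> \<open>A lift \<open>a\<close> of height zero with \<open>ln (max_norm a) > T\<close>
    lies over a point of normalized height below \<open>- T\<close>. In the final estimate the
    threshold \<open>b / 2\<close> appears once on the right, and half of \<open>b\<close> remains
    on the left.\<close>
  define T where "T = b / 2"
  define bad where "bad a \<longleftrightarrow> T < ln (max_norm a)" for a
  define \<beta> where "\<beta> i = (\<Sum>a\<leftarrow>A i. if bad a then 1 else (0::real))" for i
  \<comment> \<open>The logarithmic norms add up to at most \<open>k * M + k\<close> and none is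
    below \<open>- M\<close>, so only few can exceed \<open>T\<close>.\<close>
  have \<beta>: "T * \<beta> i \<le> k * (1 + 2 * M)" for i
  proof -
    obtain x where x: "max_norm x = 1" "\<forall>a\<in>set (A i). wedge x a \<noteq> 0"
      "(\<Sum>a\<leftarrow>A i. ln (max_norm a)) \<le> (\<Sum>a\<leftarrow>A i. ln (cmod (wedge x a)))"
      using exists_unit_sum_ln_wedge_ge[of "A i", OF A(1)[where i = i]] by blast
    have x0: "x \<noteq> 0" using x(1) by force
    have "(\<Sum>a\<leftarrow>A i. ln (cmod (wedge x a))) \<le> k * h x + k" using Lower[OF x0 x(2)] k by simp
    also have "k * h x \<le> k * M" using hM[OF x0] x(1) k by (intro mult_left_mono) auto
    finally have 1: "(\<Sum>a\<leftarrow>A i. ln (max_norm a)) \<le> k * M + k" using x(3) by linarith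
    have "T * \<beta> i = (\<Sum>a\<leftarrow>A i. if bad a then T else 0)" unfolding \<beta>_def by (rule sum_list_if_const[symmetric])
    also have "\<dots> \<le> (\<Sum>a\<leftarrow>A i. ln (max_norm a) + M)"
    proof (rule sum_list_mono)
      fix a assume a: "a \<in> set (A i)"
      have "0 \<le> M + ln (max_norm a)" using hM[OF A(1)[OF a]] A(2)[OF a] by simp
      then show "(if bad a then T else 0) \<le> ln (max_norm a) + M" using M by (auto simp: bad_def)
    qed
    also have "\<dots> \<le> k * M + k + k * M" using 1 unfolding sum_list_addf const by linarith
    finally show ?thesis by (simp add: algebra_simps)
  qed
  have \<beta>': "b * (\<beta> True + \<beta> False) \<le> 4 * k * (1 + 2 * M)"
    using \<beta>[of True] \<beta>[of False] by (simp add: T_def algebra_simps)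
  obtain ps where ps: "length ps = d" "\<forall>p\<in>set ps. p \<noteq> 0"
      "coeff_norm d F \<le> 2 ^ d * (\<Prod>p\<leftarrow>ps. max_norm p)"
      "\<And>z. (\<Prod>p\<leftarrow>ps. cmod (wedge z p)) \<le> max_norm (f z)"
    using exists_large_component by blast
  obtain g where g: "\<And>y. y \<noteq> 0 \<Longrightarrow> preimage_list d F y (g y)" using preimages by metis
  let ?bads = "filter bad (A True @ A False)"
  \<comment> \<open>A joint choice of \<open>z\<close>: the copies of \<open>ps\<close> make
    \<open>x = f z\<close> large, and the preimages of the bad points keep \<open>x\<close> away
    from them on average. With \<open>d ^ n\<close> copies the size of the coefficients enters with
    the factor \<open>k\<close>, as in the potentials.\<close>
  define W where "W = concat (map g ?bads) @ concat (replicate (d ^ n) ps)"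
  have bads0: "y \<noteq> 0" if "y \<in> set ?bads" for y
  proof -
    have "y \<in> set (A True) \<or> y \<in> set (A False)" using that by auto
    then show ?thesis by (elim disjE) (erule A(1))+
  qed
  have g0: "a \<noteq> 0" if "y \<in> set ?bads" "a \<in> set (g y)" for y a
    using preimage_listD(2)[OF g[OF bads0[OF that(1)]] that(2)] .
  have W0: "a \<noteq> 0" if "a \<in> set W" for a
  proof -
    from that consider y where "y \<in> set ?bads" "a \<in> set (g y)" | "a \<in> set ps"
      unfolding W_def by auto
    then show ?thesis by cases (rule g0, assumption+, use ps(2) in blast)
  qed
  obtain z where z: "max_norm z = 1" "\<forall>a\<in>set W. wedge z a \<noteq> 0"
      "(\<Sum>a\<leftarrow>W. ln (max_norm a)) \<le> (\<Sum>a\<leftarrow>W. ln (cmod (wedge z a)))"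
    using exists_unit_sum_ln_wedge_ge[OF W0] by blast
  have z0: "z \<noteq> 0" using z(1) by force
  define x where "x = f z"
  have x0: "x \<noteq> 0" using f_nz[OF z0] by (simp add: x_def)
  define X where "X = ln (max_norm x)"
  have Nx: "0 < max_norm x" using x0 by (simp add: max_norm_pos_iff)
  have K0: "0 < coeff_norm d F" using one_le_2D coeff_norm_nonneg[of d F] by (cases "coeff_norm d F = 0") auto
  have D0: "0 < D" using K0 by simp
  have lnD: "ln D + ln 2 = b" unfolding b_eq using ln_mult_pos[of 2 D] D0 by linarith
  have "max_norm x \<le> D" using norm_f_le[of z] z(1) by (simp add: x_def)
  then have "X \<le> ln D" unfolding X_def using Nx D0 by (subst ln_le_cancel_iff)
  then have XD: "X + ln 2 \<le> b" using lnD by linarith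
  have ln2: "0 \<le> ln (2::real)" "ln (2::real) \<le> 1" using ln_2_less_1 by auto
  have sumW: "(\<Sum>a\<leftarrow>W. \<phi> a) = (\<Sum>y\<leftarrow>?bads. \<Sum>a\<leftarrow>g y. \<phi> a) + k * (\<Sum>p\<leftarrow>ps. \<phi> p)" for \<phi> :: "_ \<Rightarrow> real"
    by (simp add: W_def sum_list_map_concat o_def sum_list_replicate k_def)
  have wx: "wedge x y \<noteq> 0" "(\<Sum>a\<leftarrow>g y. ln (cmod (wedge z a))) = ln (cmod (wedge x y))"
      "ln (max_norm y) - ln D \<le> (\<Sum>a\<leftarrow>g y. ln (max_norm a))" if y: "y \<in> set ?bads" for y
  proof -
    note gy = g[OF bads0[OF y]]
    have nz: "0 < cmod (wedge z a)" if "a \<in> set (g y)" for a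
    proof -
      have "a \<in> set W" unfolding W_def set_append set_concat set_map using that y by blast
      then show ?thesis using z(2) by simp
    qed
    have eq: "cmod (wedge x y) = (\<Prod>a\<leftarrow>g y. cmod (wedge z a))"
      unfolding x_def preimage_listD(3)[OF gy] norm_prod_list ..
    have "0 < cmod (wedge x y)" unfolding eq by (rule ln_prod_list(2)[OF nz])
    then show "wedge x y \<noteq> 0" by auto
    show "(\<Sum>a\<leftarrow>g y. ln (cmod (wedge z a))) = ln (cmod (wedge x y))"
      unfolding eq by (rule ln_prod_list(1)[OF nz, symmetric])
    have pos: "0 < max_norm a" if "a \<in> set (g y)" for a using g0[OF y that] by (simp add: max_norm_pos_iff)
    have Ny: "0 < max_norm y" using bads0[OF y] by (simp add: max_norm_pos_iff)
    have P: "0 < (\<Prod>a\<leftarrow>g y. max_norm a)" by (rule ln_prod_list(2)[OF pos])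
    have "ln (max_norm y) \<le> ln (D * (\<Prod>a\<leftarrow>g y. max_norm a))"
      using norm_le_prod_preimages[OF bads0[OF y] gy] Ny P D0 by (subst ln_le_cancel_iff) auto
    also have "\<dots> = ln D + (\<Sum>a\<leftarrow>g y. ln (max_norm a))"
      using ln_mult_pos[OF D0 P] ln_prod_list(1)[OF pos] by simp
    finally show "ln (max_norm y) - ln D \<le> (\<Sum>a\<leftarrow>g y. ln (max_norm a))" by simp
  qed
  have psW: "p \<in> set W" if "p \<in> set ps" for p
    unfolding W_def set_append set_concat set_replicate_conv_if using that d_pos by simp
  have ps1: "(\<Sum>p\<leftarrow>ps. ln (cmod (wedge z p))) \<le> X"
  proof -
    have nz: "0 < cmod (wedge z p)" if "p \<in> set ps" for p using psW[OF that] z(2) by simp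
    have "(\<Sum>p\<leftarrow>ps. ln (cmod (wedge z p))) = ln (\<Prod>p\<leftarrow>ps. cmod (wedge z p))"
      by (rule ln_prod_list(1)[OF nz, symmetric])
    also have "\<dots> \<le> X"
      unfolding X_def x_def using ps(4)[of z] ln_prod_list(2)[OF nz] Nx
      by (subst ln_le_cancel_iff) (auto simp: x_def)
    finally show ?thesis .
  qed
  have ps2: "ln (coeff_norm d F) - real d * ln 2 \<le> (\<Sum>p\<leftarrow>ps. ln (max_norm p))"
  proof -
    have pos: "0 < max_norm p" if "p \<in> set ps" for p using ps(2) that by (simp add: max_norm_pos_iff)
    have P: "0 < (\<Prod>p\<leftarrow>ps. max_norm p)" by (rule ln_prod_list(2)) (rule pos)
    have S: "ln (\<Prod>p\<leftarrow>ps. max_norm p) = (\<Sum>p\<leftarrow>ps. ln (max_norm p))"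
      by (rule ln_prod_list(1)) (rule pos)
    have "ln (coeff_norm d F) \<le> ln (2 ^ d * (\<Prod>p\<leftarrow>ps. max_norm p))"
      using ps(3) K0 P by (subst ln_le_cancel_iff) auto
    also have "\<dots> = real d * ln 2 + (\<Sum>p\<leftarrow>ps. ln (max_norm p))"
      using ln_mult_pos[OF _ P, of "2 ^ d"] S by (simp add: ln_realpow)
    finally show ?thesis by simp
  qed
  \<comment> \<open>Up to the term \<open>b - X\<close>, minus the logarithm of the projective
    distance from \<open>x\<close> to \<open>a\<close>. The shift makes it nonnegative, so that the
    sum over one family is at most the sum over both.\<close>
  define \<Delta> where "\<Delta> a = b + ln (max_norm a) - ln (cmod (wedge x a))" for a
  have \<Delta>0: "0 \<le> \<Delta> a" if a: "a \<in> set ?bads" for a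
  proof -
    have Na: "0 < max_norm a" using bads0[OF a] by (simp add: max_norm_pos_iff)
    have "ln (cmod (wedge x a)) \<le> ln (2 * max_norm x * max_norm a)"
      using cmod_wedge_le[of x a] wx(1)[OF a] Nx Na by (subst ln_le_cancel_iff) auto
    also have "\<dots> = ln 2 + X + ln (max_norm a)" using Nx Na by (simp add: ln_mult X_def)
    finally show ?thesis using XD by (simp add: \<Delta>_def)
  qed
  have sum\<Delta>: "(\<Sum>a\<leftarrow>?bads. \<Delta> a) \<le> k * (X - ln (coeff_norm d F) + real d * ln 2) + 2 * b * (\<beta> True + \<beta> False)"
  proof -
    have "(\<Sum>y\<leftarrow>?bads. ln (max_norm y) - ln D) + k * (ln (coeff_norm d F) - real d * ln 2)
        \<le> (\<Sum>y\<leftarrow>?bads. \<Sum>a\<leftarrow>g y. ln (max_norm a)) + k * (\<Sum>p\<leftarrow>ps. ln (max_norm p))"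
      using wx(3) ps2 k by (intro add_mono sum_list_mono mult_left_mono) auto
    also have "\<dots> \<le> (\<Sum>y\<leftarrow>?bads. \<Sum>a\<leftarrow>g y. ln (cmod (wedge z a))) + k * (\<Sum>p\<leftarrow>ps. ln (cmod (wedge z p)))"
      using z(3) unfolding sumW .
    also have "\<dots> \<le> (\<Sum>y\<leftarrow>?bads. ln (cmod (wedge x y))) + k * X"
      using wx(2) ps1 k by (intro add_mono sum_list_mono mult_left_mono) auto
    finally have 1: "(\<Sum>y\<leftarrow>?bads. ln (max_norm y) - ln D) - (\<Sum>y\<leftarrow>?bads. ln (cmod (wedge x y)))
        \<le> k * (X - ln (coeff_norm d F) + real d * ln 2)"
      by (simp add: algebra_simps)
    have "(\<Sum>a\<leftarrow>?bads. \<Delta> a) = (\<Sum>y\<leftarrow>?bads. ln (max_norm y) - ln D) - (\<Sum>y\<leftarrow>?bads. ln (cmod (wedge x y)))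
        + (\<Sum>y\<leftarrow>?bads. b + ln D)"
      unfolding \<Delta>_def by (simp only: sum_list_addf[symmetric] sum_list_subtractf[symmetric]) (simp add: algebra_simps)
    also have "(\<Sum>y\<leftarrow>?bads. b + ln D) \<le> (\<Sum>y\<leftarrow>?bads. 2 * b)"
      using lnD ln2 by (intro sum_list_mono) linarith
    also have "(\<Sum>y\<leftarrow>?bads. 2 * b) = 2 * b * (\<beta> True + \<beta> False)"
      by (simp only: sum_list_map_filter' sum_list_if_const[where c = "2 * b"] \<beta>_def map_append sum_list_append distrib_left)
    finally show ?thesis using 1 by linarith
  qed
  let ?G = "{a. (\<exists>i. a \<in> set (A i)) \<and> \<not> bad a}"
  have finG: "finite ?G"
  proof (rule finite_subset)
    show "?G \<subseteq> (\<Union>i. set (A i))" by blast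
  qed simp
  show ?thesis
  proof (cases "?G = {}")
    case True
    \<comment> \<open>Without good points the whole family is bad, and the bound on the proportion
      of bad points already bounds \<open>b\<close>.\<close>
    then have all_bad: "bad a" if "a \<in> set (A True)" for a using that by blast
    have "map (\<lambda>a. if bad a then 1 else (0::real)) (A True) = map (\<lambda>_. 1) (A True)"
      by (rule map_cong) (simp_all add: all_bad)
    then have "\<beta> True = k" using const[where i = True and c = 1] by (simp only: \<beta>_def mult_1_right)
    then have "k * T \<le> k * (1 + 2 * M)" using \<beta>[of True] by (simp only: mult.commute)
    then have "b \<le> 2 + 4 * M" using k by (simp add: T_def)
    also have "\<dots> \<le> 32 * (M + 1)" using M by simp
      also have "\<dots> \<le> (6 * real d + 32) * (M + 1)" using M by (intro mult_right_mono) auto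
    finally show ?thesis .
  next
    case False
    \<comment> \<open>The projective distance to \<open>x\<close> without the constant factor
      \<open>1 / max_norm x\<close>.\<close>
    define dist_x where "dist_x a = cmod (wedge x a) / max_norm a" for a
    define x' where "x' = arg_min_on dist_x ?G"
    have x'G: "x' \<in> ?G" unfolding x'_def by (rule arg_min_if_finite(1)[OF finG False])
    have x'min: "dist_x x' \<le> dist_x a" if "a \<in> ?G" for a
    proof (rule ccontr)
      assume "\<not> dist_x x' \<le> dist_x a"
      then have "dist_x a < dist_x x'" by simp
      then show False using arg_min_if_finite(2)[OF finG False, of dist_x] that
        unfolding x'_def by blast
    qed
    obtain j where j: "x' \<in> set (A j)" "\<not> bad x'" using x'G by blast
    have x'0: "x' \<noteq> 0" "h x' = 0" "ln (max_norm x') \<le> T"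
      using A[OF j(1)] j(2) by (simp_all add: bad_def)
    have Nx': "0 < max_norm x'" by (rule Npos[OF j(1)])
    \<comment> \<open>As \<open>h x' = 0\<close>, one family has potential at least
      \<open>- 8 * b\<close> at \<open>x'\<close>; its potentials at \<open>x\<close> and
      \<open>x'\<close> are compared.\<close>
    from Upper[OF x'0(1)] obtain i where i: "\<forall>a\<in>set (A i). wedge x' a \<noteq> 0"
      "0 \<le> (\<Sum>a\<leftarrow>A i. ln (cmod (wedge x' a))) + 8 * b"
      unfolding x'0(2) mult_zero_right by blast
    \<comment> \<open>For a bad \<open>a\<close> the trivial bound costs \<open>\<Delta> a\<close>.
      A good \<open>a\<close> is no closer to \<open>x\<close> than \<open>x'\<close> is, so by the
      triangle inequality it is at most twice as far from \<open>x'\<close> as from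
      \<open>x\<close>.\<close>
    have pt: "wedge x a \<noteq> 0 \<and> ln (cmod (wedge x' a)) \<le>
        ln 2 + T - X + ln (cmod (wedge x a)) + (if bad a then \<Delta> a else 0)" if a: "a \<in> set (A i)" for a
    proof (cases "bad a")
      case True
      then have ab: "a \<in> set ?bads" using a by (cases i) auto
      have "ln (cmod (wedge x' a)) \<le> ln (2 * max_norm x' * max_norm a)"
        using cmod_wedge_le[of x' a] i(1) a Nx' Npos[OF a] by (subst ln_le_cancel_iff) auto
      also have "\<dots> = ln 2 + ln (max_norm x') + ln (max_norm a)" using Nx' Npos[OF a] by (simp add: ln_mult)
      finally have "ln (cmod (wedge x' a)) \<le> ln 2 + T - X + ln (cmod (wedge x a)) + \<Delta> a"
        using x'0(3) XD ln2 unfolding \<Delta>_def by linarith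
      then show ?thesis using wx(1)[OF ab] True by simp
    next
      case False
      then have aG: "a \<in> ?G" using a by auto
      have "max_norm a * cmod (wedge x' x) \<le> max_norm x' * cmod (wedge x a)"
        using x'min[OF aG] Nx' Npos[OF a]
        by (simp add: dist_x_def field_simps cmod_wedge_commute[of x' x])
      then have le: "max_norm x * cmod (wedge x' a) \<le> 2 * max_norm x' * cmod (wedge x a)"
        using wedge_triangle[of x x' a] by linarith
      moreover have pos: "0 < max_norm x * cmod (wedge x' a)" using Nx i(1) a by simp
      ultimately have nz: "wedge x a \<noteq> 0" by auto
      have "ln (max_norm x * cmod (wedge x' a)) \<le> ln (2 * max_norm x' * cmod (wedge x a))"
        using le pos nz Nx' by (subst ln_le_cancel_iff) auto
      then have "X + ln (cmod (wedge x' a)) \<le> ln 2 + ln (max_norm x') + ln (cmod (wedge x a))"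
        using Nx i(1) a nz Nx' by (simp add: ln_mult X_def)
      then show ?thesis using nz False x'0(3) by simp
    qed
    have "(\<Sum>a\<leftarrow>A i. ln (cmod (wedge x' a))) \<le>
        (\<Sum>a\<leftarrow>A i. (ln 2 + T - X) + ln (cmod (wedge x a)) + (if bad a then \<Delta> a else 0))"
      using pt by (intro sum_list_mono) auto
    also have "\<dots> = k * (ln 2 + T - X) + (\<Sum>a\<leftarrow>A i. ln (cmod (wedge x a))) + (\<Sum>a\<leftarrow>A i. if bad a then \<Delta> a else 0)"
      by (simp only: sum_list_addf const)
    also have "(\<Sum>a\<leftarrow>A i. ln (cmod (wedge x a))) \<le> k * (real d * M) + k"
    proof -
      have "h x = real d * h z" by (simp add: x_def height_f z0)
      also have "\<dots> \<le> real d * M" using hM[OF z0] z(1) by (intro mult_left_mono) auto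
      finally have "k * h x \<le> k * (real d * M)" using k by (intro mult_left_mono) auto
      moreover have "\<forall>a\<in>set (A i). wedge x a \<noteq> 0" using pt by blast
      ultimately show ?thesis using Lower[OF x0, of i] k by linarith
    qed
    also have "(\<Sum>a\<leftarrow>A i. if bad a then \<Delta> a else 0) \<le> (\<Sum>a\<leftarrow>?bads. \<Delta> a)"
    proof -
      have "0 \<le> (\<Sum>a\<leftarrow>A j. if bad a then \<Delta> a else 0)" for j
      proof (rule sum_list_nonneg)
        fix t assume "t \<in> set (map (\<lambda>a. if bad a then \<Delta> a else 0) (A j))"
        then obtain a where a: "a \<in> set (A j)" "t = (if bad a then \<Delta> a else 0)" by (auto simp del: split_paired_Ex)
        have "a \<in> set ?bads" if "bad a" using a(1) that by (cases j) auto
        then show "0 \<le> t" using a(2) \<Delta>0 by simp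
      qed
      then show ?thesis
        by (cases i) (simp_all add: sum_list_map_filter')
    qed
    finally have "(\<Sum>a\<leftarrow>A i. ln (cmod (wedge x' a))) \<le> k * (ln 2 + T - X) + (k * (real d * M) + k)
        + (k * (X - ln (coeff_norm d F) + real d * ln 2) + 2 * b * (\<beta> True + \<beta> False))"
      using sum\<Delta> by linarith
    then have "0 \<le> k * (ln 2 + T - X) + (k * (real d * M) + k)
        + (k * (X - ln (coeff_norm d F) + real d * ln 2) + 8 * k * (1 + 2 * M)) + k"
      using i(2) \<beta>' k by linarith
    \<comment> \<open>\<open>X\<close> cancels between the \<open>k\<close> comparisons and the
      bound for the losses, leaving \<open>ln (coeff_norm d F)\<close>.\<close>
    then have "0 \<le> k * (ln 2 + T + real d * M + 2 - ln (coeff_norm d F) + real d * ln 2 + 8 * (1 + 2 * M))"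
      by (simp add: algebra_simps)
    then have 1: "ln (coeff_norm d F) \<le> ln 2 + T + real d * M + 2 + real d * ln 2 + 8 * (1 + 2 * M)"
      using k by (simp add: zero_le_mult_iff)
    have "b = ln (2 * (real d + 1)) + ln (coeff_norm d F)"
      using K0 by (simp add: log_size_def ln_mult)
    moreover have "ln (2 * (real d + 1)) \<le> 2 * (real d + 1) - 1"
      by (rule ln_le_minus_one) simp
    moreover have "real d * ln 2 \<le> real d * 1" using ln2 by (intro mult_left_mono) auto
    ultimately have "b \<le> 2 * (real d + 1) - 1 + (1 + b / 2 + real d * M + 2 + real d + 8 * (1 + 2 * M))"
      using 1 ln2 unfolding T_def by linarith
    then have "b \<le> 2 * (3 * real d + 12 + (real d + 16) * M)" by (simp add: algebra_simps)
    also have "\<dots> \<le> (6 * real d + 32) * (M + 1)"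
      using M by (simp add: algebra_simps)
    finally show ?thesis .
  qed
qed

end

section \<open>Conjugation\<close>

lemma mat2_apply_eq: "mat2_apply (a, b, c, e) z = (a * fst z + b * snd z, c * fst z + e * snd z)"
  by (cases z) (simp add: mat2_apply_def)

definition mat2_inv :: "mat2 \<Rightarrow> mat2" where
  "mat2_inv = (\<lambda>(a, b, c, e). (e, - b, - c, a))"

definition mat2_mult :: "mat2 \<Rightarrow> mat2 \<Rightarrow> mat2" where
  "mat2_mult = (\<lambda>(a, b, c, e) (a', b', c', e').
     (a * a' + b * c', a * b' + b * e', c * a' + e * c', c * b' + e * e'))"

lemma mat2_inv_SL2: "\<psi> \<in> SL2 \<Longrightarrow> mat2_inv \<psi> \<in> SL2"
  by (auto simp: SL2_def mat2_inv_def mult.commute)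

lemma mat2_mult_SL2: "\<phi> \<in> SL2 \<Longrightarrow> \<psi> \<in> SL2 \<Longrightarrow> mat2_mult \<phi> \<psi> \<in> SL2"
proof -
  assume "\<phi> \<in> SL2" "\<psi> \<in> SL2"
  then obtain a b c e a' b' c' e' where *: "\<phi> = (a, b, c, e)" "\<psi> = (a', b', c', e')"
    "a * e - b * c = 1" "a' * e' - b' * c' = 1" by (auto simp: SL2_def)
  have "(a * a' + b * c') * (c * b' + e * e') - (a * b' + b * e') * (c * a' + e * c') =
      (a * e - b * c) * (a' * e' - b' * c')" by (simp add: algebra_simps)
  then show ?thesis by (simp add: * SL2_def mat2_mult_def)
qed

lemma mat2_apply_mult: "mat2_apply (mat2_mult \<phi> \<psi>) z = mat2_apply \<phi> (mat2_apply \<psi> z)"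
  by (cases \<phi>, cases \<psi>) (simp add: mat2_apply_eq mat2_mult_def algebra_simps)

lemma mat2_apply_inv:
  assumes "\<psi> \<in> SL2"
  shows "mat2_apply (mat2_inv \<psi>) (mat2_apply \<psi> z) = z" "mat2_apply \<psi> (mat2_apply (mat2_inv \<psi>) z) = z"
proof -
  obtain a b c e where \<psi>: "\<psi> = (a, b, c, e)" by (cases \<psi>)
  obtain x y where z: "z = (x, y)" by (cases z)
  have det: "a * e - b * c = 1" using assms by (simp add: SL2_def \<psi>)
  have "e * (a * x + b * y) + - b * (c * x + e * y) = (a * e - b * c) * x"
    "- c * (a * x + b * y) + a * (c * x + e * y) = (a * e - b * c) * y"
    "a * (e * x + - b * y) + b * (- c * x + a * y) = (a * e - b * c) * x"
    "c * (e * x + - b * y) + e * (- c * x + a * y) = (a * e - b * c) * y" by (simp_all add: algebra_simps)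
  then show "mat2_apply (mat2_inv \<psi>) (mat2_apply \<psi> z) = z" "mat2_apply \<psi> (mat2_apply (mat2_inv \<psi>) z) = z"
    by (simp_all add: \<psi> z mat2_inv_def mat2_apply_eq det)
qed

lemma wedge_mat2_apply:
  assumes "\<psi> \<in> SL2"
  shows "wedge (mat2_apply \<psi> u) (mat2_apply \<psi> v) = wedge u v"
proof -
  obtain a b c e where \<psi>: "\<psi> = (a, b, c, e)" by (cases \<psi>)
  have det: "a * e - b * c = 1" using assms by (simp add: SL2_def \<psi>)
  have "wedge (mat2_apply \<psi> u) (mat2_apply \<psi> v) = (a * e - b * c) * wedge u v"
    by (simp add: wedge_def \<psi> mat2_apply_eq algebra_simps)
  then show ?thesis by (simp add: det)
qed

lemma mat2_apply_cscale: "mat2_apply \<psi> (cscale c z) = cscale c (mat2_apply \<psi> z)"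
  by (cases \<psi>) (simp add: mat2_apply_eq cscale_def algebra_simps)

lemma continuous_on_mat2_apply: "continuous_on S (mat2_apply \<psi>)"
proof -
  obtain a b c e where \<psi>: "\<psi> = (a, b, c, e)" by (cases \<psi>)
  have "mat2_apply \<psi> = (\<lambda>z. (a * fst z + b * snd z, c * fst z + e * snd z))"
    by (simp add: \<psi> mat2_apply_eq fun_eq_iff)
  then show ?thesis by (auto intro!: continuous_intros)
qed

lemma exists_form_mat2_apply:
  "\<exists>q. degree q \<le> d \<and> (\<forall>z. form d q z = form d p (mat2_apply \<psi> z))"
proof -
  obtain a b c e where \<psi>: "\<psi> = (a, b, c, e)" by (cases \<psi>)
  define q where "q = (\<Sum>i\<le>d. Polynomial.smult (coeff p i) ([:b, a:] ^ i * [:e, c:] ^ (d - i)))"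
  have deg1: "degree ([:u, v:] ^ n) \<le> n" for u v :: complex and n
    using degree_power_le[of "[:u, v:]" n] by (auto intro: order_trans)
  have "degree q \<le> d"
    unfolding q_def
  proof (intro degree_sum_le order_trans[OF degree_smult_le])
    fix i assume "i \<in> {..d}"
    then show "degree ([:b, a:] ^ i * [:e, c:] ^ (d - i)) \<le> d"
      using degree_mult_le[of "[:b, a:] ^ i" "[:e, c:] ^ (d - i)"] deg1[of b a i] deg1[of e c "d - i"]
      by simp
  qed simp
  moreover have "form d q z = form d p (mat2_apply \<psi> z)" for z
  proof (rule form_eqI[OF \<open>degree q \<le> d\<close>])
    have "continuous_on UNIV (form d p)" unfolding form_def by (intro continuous_intros)
    then show "continuous_on UNIV (\<lambda>z. form d p (mat2_apply \<psi> z))"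
      by (rule continuous_on_compose2[OF _ continuous_on_mat2_apply]) auto
    show "form d p (mat2_apply \<psi> (cscale c z)) = c ^ d * form d p (mat2_apply \<psi> z)" for c z
      by (simp add: mat2_apply_cscale form_cscale)
    show "form d p (mat2_apply \<psi> (t, 1)) = poly q t" for t
      by (simp add: form_def q_def \<psi> mat2_apply_eq poly_sum algebra_simps)
  qed
  ultimately show ?thesis by blast
qed

text \<open>An intertwining relation in place of a formula with the inverse matrix: it composes and
  iterates directly.\<close>

definition conjugate_forms :: "nat \<Rightarrow> mat2 \<Rightarrow> forms \<Rightarrow> forms \<Rightarrow> bool" where
  "conjugate_forms d \<psi> F G \<longleftrightarrow> \<psi> \<in> SL2 \<and> degree (fst G) \<le> d \<and> degree (snd G) \<le> d \<and>
     (\<forall>z. forms_map d G (mat2_apply \<psi> z) = mat2_apply \<psi> (forms_map d F z))"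

lemma exists_conjugate_forms:
  assumes \<psi>: "\<psi> \<in> SL2"
  shows "\<exists>G. conjugate_forms d \<psi> F G"
proof -
  obtain a b c e where abce: "\<psi> = (a, b, c, e)" by (cases \<psi>)
  obtain p where p: "degree p \<le> d" "\<And>z. form d p z = form d (fst F) (mat2_apply (mat2_inv \<psi>) z)"
    using exists_form_mat2_apply by blast
  obtain q where q: "degree q \<le> d" "\<And>z. form d q z = form d (snd F) (mat2_apply (mat2_inv \<psi>) z)"
    using exists_form_mat2_apply by blast
  define G where "G = (Polynomial.smult a p + Polynomial.smult b q, Polynomial.smult c p + Polynomial.smult e q)"
  have "forms_map d G (mat2_apply \<psi> z) = mat2_apply \<psi> (forms_map d F z)" for z
    by (simp add: G_def forms_map_def form_add form_smult p q mat2_apply_inv[OF \<psi>] abce[symmetric])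
       (simp add: abce mat2_apply_eq)
  moreover have "degree (fst G) \<le> d" "degree (snd G) \<le> d"
    unfolding G_def using p(1) q(1)
    by (auto intro!: degree_add_le intro: order_trans[OF degree_smult_le])
  ultimately show ?thesis using \<psi> unfolding conjugate_forms_def by blast
qed

lemma conjugate_forms_trans:
  assumes "conjugate_forms d \<phi> F G" "conjugate_forms d \<psi> G H"
  shows "conjugate_forms d (mat2_mult \<psi> \<phi>) F H"
  using assms unfolding conjugate_forms_def
  by (simp add: mat2_mult_SL2 mat2_apply_mult del: split_paired_All)

definition mat2_size :: "mat2 \<Rightarrow> real" where
  "mat2_size = (\<lambda>(a, b, c, e). cmod a + cmod b + cmod c + cmod e)"

lemma max_norm_mat2_apply_le: "max_norm (mat2_apply \<psi> z) \<le> mat2_size \<psi> * max_norm z"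
proof -
  obtain a b c e where \<psi>: "\<psi> = (a, b, c, e)" by (cases \<psi>)
  have le: "cmod (u * fst z + v * snd z) \<le> (cmod u + cmod v) * max_norm z" for u v
  proof -
    have "cmod (u * fst z + v * snd z) \<le> cmod u * cmod (fst z) + cmod v * cmod (snd z)"
      by (rule order_trans[OF norm_triangle_ineq]) (simp add: norm_mult)
    also have "\<dots> \<le> cmod u * max_norm z + cmod v * max_norm z"
      by (intro add_mono mult_left_mono) (auto simp: max_norm_def)
    finally show ?thesis by (simp add: algebra_simps)
  qed
  have "(cmod a + cmod b) * max_norm z \<le> mat2_size \<psi> * max_norm z"
    "(cmod c + cmod e) * max_norm z \<le> mat2_size \<psi> * max_norm z"
    by (intro mult_right_mono; simp add: mat2_size_def \<psi>)+
  then show ?thesis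
    using le[of a b] le[of c e] unfolding \<psi> mat2_apply_eq
    by (simp add: max_norm_def[of "(_, _)"])
qed

lemma ln_max_norm_mat2_apply_bound:
  assumes \<psi>: "\<psi> \<in> SL2" and z: "z \<noteq> 0"
  shows "\<bar>ln (max_norm (mat2_apply \<psi> z)) - ln (max_norm z)\<bar> \<le> ln (mat2_size \<psi>)"
proof -
  have pos: "0 < max_norm z" "0 < max_norm (mat2_apply \<psi> z)"
    using z mat2_apply_nonzero[OF \<psi> z] by (simp_all add: max_norm_pos_iff)
  have S: "0 < mat2_size \<psi>"
    using max_norm_mat2_apply_le[of \<psi> z] pos by (smt (verit) zero_less_mult_iff)
  have inv: "mat2_size (mat2_inv \<psi>) = mat2_size \<psi>" by (cases \<psi>) (simp add: mat2_size_def mat2_inv_def)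
  have "ln (max_norm (mat2_apply \<psi> z)) \<le> ln (mat2_size \<psi> * max_norm z)"
    using max_norm_mat2_apply_le[of \<psi> z] pos S by (subst ln_le_cancel_iff) auto
  moreover have "max_norm z \<le> mat2_size \<psi> * max_norm (mat2_apply \<psi> z)"
    using max_norm_mat2_apply_le[of "mat2_inv \<psi>" "mat2_apply \<psi> z"] by (simp add: mat2_apply_inv[OF \<psi>] inv)
  then have "ln (max_norm z) \<le> ln (mat2_size \<psi> * max_norm (mat2_apply \<psi> z))"
    using pos S by (subst ln_le_cancel_iff) auto
  ultimately show ?thesis using pos S by (simp add: ln_mult)
qed

text \<open>The product formula is applied to \<open>G\<close> at the image of \<open>y\<close>,
  whose preimages are the images of those of \<open>y\<close>. Preimages correspond with the same
  scalars over the two targets, so the resultants agree in absolute value. This avoids transforming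
  Sylvester matrices.\<close>

lemma (in unimodular_forms) conjugate_unimodular:
  assumes G: "conjugate_forms d \<psi> F G"
  shows "unimodular_forms d G"
proof
  have \<psi>: "\<psi> \<in> SL2" and dG: "degree (fst G) \<le> d" "degree (snd G) \<le> d"
    and conj: "\<And>z. forms_map d G (mat2_apply \<psi> z) = mat2_apply \<psi> (f z)"
    using G by (auto simp: conjugate_forms_def)
  show "2 \<le> d" by (rule d)
  show "degree (fst G) \<le> d" "degree (snd G) \<le> d" by (rule dG)+
  have y: "((1, 0) :: complex \<times> complex) \<noteq> 0" by (simp add: zero_prod_def)
  define y where "y = ((1, 0) :: complex \<times> complex)"
  have y0: "y \<noteq> 0" "max_norm y = 1" using y by (simp_all add: y_def max_norm_def)
  define y' where "y' = mat2_apply \<psi> y"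
  have y'0: "y' \<noteq> 0" using mat2_apply_nonzero[OF \<psi> y0(1)] by (simp add: y'_def)
  obtain as where as: "preimage_list d F y as" using preimages[OF y0(1)] by blast
  note asD = preimage_listD[OF as]
  have pre: "preimage_list d G y' (map (mat2_apply \<psi>) as)"
    unfolding preimage_list_def
  proof (intro conjI allI)
    show "length (map (mat2_apply \<psi>) as) = d" using asD(1) by simp
    show "\<forall>a\<in>set (map (mat2_apply \<psi>) as). a \<noteq> 0" using asD(2) mat2_apply_nonzero[OF \<psi>] by auto
    fix x
    define w where "w = mat2_apply (mat2_inv \<psi>) x"
    have x: "x = mat2_apply \<psi> w" by (simp add: w_def mat2_apply_inv[OF \<psi>])
    show "wedge (forms_map d G x) y' = (\<Prod>a\<leftarrow>map (mat2_apply \<psi>) as. wedge x a)"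
      by (simp add: x conj y'_def wedge_mat2_apply[OF \<psi>] asD(3) o_def)
  qed
  have "max_norm (forms_map d G (mat2_apply \<psi> a)) = max_norm y' * max_norm (f a)" if a: "a \<in> set as" for a
  proof -
    obtain c where c: "f a = cscale c y" using preimage_list_maps_to[OF as a y0(1)] by blast
    show ?thesis by (simp add: conj c mat2_apply_cscale max_norm_cscale y0(2) y'_def)
  qed
  then have "(\<Prod>a\<leftarrow>as. max_norm (forms_map d G (mat2_apply \<psi> a))) = (\<Prod>a\<leftarrow>as. max_norm y' * max_norm (f a))"
    by (intro arg_cong[of _ _ prod_list] map_cong) simp_all
  also have "\<dots> = max_norm y' ^ d"
    using prod_norm[OF y0(1) as] y0(2) by (simp add: prod_list_mult_const asD(1))
  finally have "cmod (Res_forms d G) * max_norm y' ^ d = max_norm y' ^ d"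
    using prod_max_norm_preimages[OF dG y'0 pre] by (simp add: o_def)
  then show "cmod (Res_forms d G) = 1" using y'0 max_norm_pos[OF y'0] by simp
qed

text \<open>A matrix changes \<open>ln (max_norm z)\<close> by a bounded amount, which the division
  by \<open>d ^ n\<close> removes in the limit.\<close>

lemma (in unimodular_forms) conjugate_height:
  assumes G: "conjugate_forms d \<psi> F G" and z: "z \<noteq> 0"
  shows "hom_height d G (mat2_apply \<psi> z) = h z"
proof -
  have \<psi>: "\<psi> \<in> SL2" and conj: "\<And>z. forms_map d G (mat2_apply \<psi> z) = mat2_apply \<psi> (f z)"
    using G by (auto simp: conjugate_forms_def)
  interpret G: unimodular_forms d G by (rule conjugate_unimodular[OF G])
  have it: "(forms_map d G ^^ n) (mat2_apply \<psi> z) = mat2_apply \<psi> ((f ^^ n) z)" for n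
    by (induction n) (simp_all add: conj)
  let ?g = "\<lambda>n. (ln (max_norm (mat2_apply \<psi> ((f ^^ n) z))) - ln (max_norm ((f ^^ n) z))) / real d ^ n"
  have "?g \<longlonglongrightarrow> 0"
  proof (rule Lim_null_comparison)
    show "\<forall>\<^sub>F n in sequentially. norm (?g n) \<le> ln (mat2_size \<psi>) * (1 / real d) ^ n"
    proof (intro always_eventually allI)
      fix n
      show "norm (?g n) \<le> ln (mat2_size \<psi>) * (1 / real d) ^ n"
        using ln_max_norm_mat2_apply_bound[OF \<psi> funpow_nz[OF z, of n]] d_pos
        by (simp add: power_divide divide_right_mono)
    qed
    have "(\<lambda>n. (1 / real d) ^ n) \<longlonglongrightarrow> 0" using d by (intro LIMSEQ_power_zero) auto
    then show "(\<lambda>n. ln (mat2_size \<psi>) * (1 / real d) ^ n) \<longlonglongrightarrow> 0" by (rule tendsto_mult_right_zero)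
  qed
  from tendsto_add[OF this height_LIMSEQ[OF z]]
  have "(\<lambda>n. ln (max_norm ((forms_map d G ^^ n) (mat2_apply \<psi> z))) / real d ^ n) \<longlonglongrightarrow> h z"
    by (simp add: it diff_divide_distrib)
  then show ?thesis
    by (rule LIMSEQ_unique[OF G.height_LIMSEQ[OF mat2_apply_nonzero[OF \<psi> z]]])
qed

section \<open>Covering the sphere\<close>

text \<open>A matrix expanding the disc of radius \<open>r\<close> around \<open>a\<close> to unit size; in the hyperbolic picture it
  moves the point at depth \<open>- ln r\<close> in the direction of \<open>a\<close> to the origin.\<close>

definition zooms :: "complex \<times> complex \<Rightarrow> real \<Rightarrow> mat2 \<Rightarrow> bool" where
  "zooms a r \<psi> \<longleftrightarrow> \<psi> \<in> SL2 \<and>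
     (\<forall>x. cmod (wedge x a) \<le> r * (max_norm x * max_norm a) \<longrightarrow> max_norm (mat2_apply \<psi> x) \<le> 2 * sqrt r * max_norm x) \<and>
     (\<forall>x. r * (max_norm x * max_norm a) + cmod (wedge x a) \<le> 4 * sqrt r * max_norm (mat2_apply \<psi> x) * max_norm a)"

text \<open>In the coordinates \<open>wedge x a\<close> and \<open>wedge x w\<close> of a unimodular
  basis the zoom is diagonal with entries \<open>1 / sqrt r\<close> and
  \<open>sqrt r\<close>.\<close>

lemma exists_zoom_unit:
  assumes a: "max_norm a = 1" and r: "0 < r" "r \<le> 2"
  shows "\<exists>\<psi>. zooms a r \<psi>"
proof -
  define q where "q = sqrt r"
  have q: "q > 0" "r = q * q" using r by (simp_all add: q_def)
  \<comment> \<open>A coordinate of \<open>a\<close> of absolute value one is inverted, which keeps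
    \<open>w\<close> of norm one.\<close>
  obtain w where w: "wedge a w = 1" "max_norm w = 1"
  proof (cases "cmod (fst a) = 1")
    case True
    then have "fst a \<noteq> 0" by auto
    then show ?thesis using True
      by (intro that[of "(0, 1 / fst a)"]) (auto simp: wedge_def max_norm_def norm_divide)
  next
    case False
    then have 1: "cmod (snd a) = 1" using a by (auto simp: max_norm_def max_def split: if_splits)
    then have "snd a \<noteq> 0" by auto
    then show ?thesis using 1
      by (intro that[of "(- 1 / snd a, 0)"]) (auto simp: wedge_def max_norm_def norm_divide)
  qed
  let ?q = "complex_of_real q"
  define \<psi> where "\<psi> = (snd a / ?q, - fst a / ?q, ?q * snd w, - ?q * fst w)"
  have app: "mat2_apply \<psi> x = (wedge x a / ?q, ?q * wedge x w)" for x
    using q by (simp add: \<psi>_def mat2_apply_eq wedge_def field_simps)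
  have N: "max_norm (mat2_apply \<psi> x) = max (cmod (wedge x a) / q) (q * cmod (wedge x w))" for x
    using q by (simp add: app max_norm_def norm_divide norm_mult)
  have "snd a / ?q * (- ?q * fst w) - - fst a / ?q * (?q * snd w) = wedge a w"
    using q by (simp add: wedge_def)
  then have "\<psi> \<in> SL2" using w(1) by (simp add: SL2_def \<psi>_def)
  moreover have "max_norm (mat2_apply \<psi> x) \<le> 2 * q * max_norm x" if "cmod (wedge x a) \<le> r * max_norm x" for x
  proof -
    have "cmod (wedge x a) / q \<le> q * max_norm x" using that q by (simp add: field_simps)
    moreover have "0 \<le> q * max_norm x" using q by simp
    moreover have "q * cmod (wedge x w) \<le> q * (2 * max_norm x)"
      using cmod_wedge_le[of x w] w(2) q by (intro mult_left_mono) auto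
    ultimately show ?thesis unfolding N by simp
  qed
  moreover have "r * max_norm x + cmod (wedge x a) \<le> 4 * q * max_norm (mat2_apply \<psi> x)" for x
  proof -
    define m where "m = max_norm (mat2_apply \<psi> x)"
    have m: "0 \<le> m" by (simp add: m_def)
    have "cmod (wedge x a) / q \<le> m" "q * cmod (wedge x w) \<le> m" by (simp_all add: m_def N)
    then have 1: "cmod (wedge x a) \<le> q * m" "q * cmod (wedge x w) \<le> m" using q by (simp_all add: field_simps)
    have "max_norm w * cmod (wedge x a) + max_norm a * cmod (wedge x w) \<ge> max_norm x * cmod (wedge a w)"
      using wedge_triangle[of x a w] by (simp add: cmod_wedge_commute[of a x])
    then have "max_norm x \<le> cmod (wedge x a) + cmod (wedge x w)" using a w by simp
    then have "q * max_norm x \<le> q * cmod (wedge x a) + q * cmod (wedge x w)"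
      using q by (simp flip: distrib_left)
    also have "\<dots> \<le> q * (q * m) + m" using 1 q by (intro add_mono mult_left_mono) auto
    also have "q * (q * m) \<le> 2 * m" using r m q(2) by (simp add: mult_right_mono flip: mult.assoc)
    finally have "q * (q * max_norm x) \<le> q * (3 * m)" using q by (intro mult_left_mono) auto
    then show ?thesis using 1(1) unfolding m_def[symmetric] q(2) by (simp add: mult_ac)
  qed
  ultimately show ?thesis unfolding zooms_def a using q_def by (intro exI[of _ \<psi>]) simp
qed

lemma exists_zoom:
  assumes a: "a \<noteq> 0" and r: "0 < r" "r \<le> 2"
  shows "\<exists>\<psi>. zooms a r \<psi>"
proof -
  define c where "c = complex_of_real (1 / max_norm a)"
  have m: "0 < max_norm a" using a by (simp add: max_norm_pos_iff)
  have c: "cmod c = 1 / max_norm a" using m by (simp add: c_def norm_divide)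
  have "max_norm (cscale c a) = 1" using m by (simp add: max_norm_cscale c)
  then obtain \<psi> where "zooms (cscale c a) r \<psi>" using exists_zoom_unit r by blast
  then show ?thesis
    using m by (intro exI[of _ \<psi>])
      (simp add: zooms_def wedge_cscale_right norm_mult max_norm_cscale c field_simps del: split_paired_All)
qed

text \<open>After the zoom the distance between \<open>x\<close> and \<open>c\<close> is still at
  least of order \<open>exp (- s)\<close>, and wedges are preserved. Hence replacing
  \<open>x\<close> by \<open>y\<close> enlarges the factor at \<open>c\<close> by at most
  \<open>exp s\<close> times the ratio of the zoomed norms, up to a constant. Over all preimages
  \<open>c\<close> this compares the potentials at \<open>x\<close> and \<open>y\<close>.\<close>

lemma zoom_ratio:
  assumes \<psi>: "zooms a r \<psi>" and r: "0 < r" and a: "a \<noteq> 0" and x: "x \<noteq> 0" and s: "0 \<le> s"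
    and near: "cmod (wedge x a) \<le> r * (max_norm x * max_norm a)"
    and far: "r * exp (- s) * (max_norm x * max_norm c) < cmod (wedge x c)"
  shows "cmod (wedge y c) * max_norm (mat2_apply \<psi> x) \<le> 16 * exp s * max_norm (mat2_apply \<psi> y) * cmod (wedge x c)"
proof -
  define q where "q = sqrt r"
  have q: "q > 0" "r = q * q" using r by (simp_all add: q_def)
  define A where "A = max_norm a"
  define X where "X = max_norm x"
  define C where "C = max_norm c"
  define Y where "Y = max_norm y"
  define m where "m = max_norm (mat2_apply \<psi> y)"
  define v where "v = cmod (wedge x c)"
  define E where "E = exp s"
  have pos: "0 < A" "0 < X" "0 \<le> C" "0 \<le> Y" "0 \<le> m" "0 \<le> v" "1 \<le> E"
    using a x s by (auto simp: A_def X_def C_def Y_def m_def v_def E_def max_norm_pos_iff)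
  have 1: "max_norm (mat2_apply \<psi> x) \<le> 2 * q * X"
    using \<psi> near unfolding zooms_def q_def X_def by blast
  have 2: "r * (Y * A) + cmod (wedge y a) \<le> 4 * q * m * A"
    using \<psi> unfolding zooms_def q_def Y_def A_def m_def by blast
  have 3: "A * cmod (wedge y c) \<le> Y * cmod (wedge a c) + C * cmod (wedge y a)"
    using wedge_triangle[of a y c] by (simp add: A_def Y_def C_def)
  have 4: "X * cmod (wedge a c) \<le> A * v + C * cmod (wedge x a)"
    using wedge_triangle[of x a c] by (simp add: X_def A_def v_def C_def cmod_wedge_commute[of a x])
  have "r * (X * C) \<le> E * v"
    using mult_left_mono[OF less_imp_le[OF far], of E] pos
    by (simp add: E_def X_def C_def v_def mult_ac exp_minus)
  then have 5: "q * (q * (X * C)) \<le> E * v" by (simp add: q(2) mult_ac)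
  have "X * (A * cmod (wedge y c)) \<le> X * (Y * cmod (wedge a c) + C * cmod (wedge y a))"
    using 3 pos by (intro mult_left_mono) auto
  also have "\<dots> = Y * (X * cmod (wedge a c)) + X * C * cmod (wedge y a)" by (simp add: algebra_simps)
  also have "\<dots> \<le> Y * (A * v + C * cmod (wedge x a)) + X * C * cmod (wedge y a)"
    using 4 pos by (intro add_mono mult_left_mono) auto
  also have "\<dots> \<le> Y * (A * v + C * (r * (X * A))) + X * C * cmod (wedge y a)"
    using near pos by (intro add_mono mult_left_mono order_refl) (auto simp: X_def A_def)
  also have "\<dots> = Y * A * v + X * C * (r * (Y * A) + cmod (wedge y a))" by (simp add: algebra_simps)
  also have "\<dots> \<le> Y * A * v + X * C * (4 * q * m * A)"
    using 2 pos by (intro add_mono mult_left_mono order_refl) auto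
  finally have "A * (X * cmod (wedge y c)) \<le> A * (Y * v + 4 * (X * C) * q * m)" by (simp add: algebra_simps)
  then have 6: "X * cmod (wedge y c) \<le> Y * v + 4 * (X * C) * q * m" using pos by simp
  have "A * (q * (q * Y)) = r * (Y * A)" "A * (q * (4 * m)) = 4 * q * m * A" by (simp_all add: q(2) mult_ac)
  then have "A * (q * (q * Y)) \<le> A * (q * (4 * m))"
    using 2 norm_ge_zero[of "wedge y a"] by linarith
  then have 7: "q * Y \<le> 4 * m" using pos q by simp
  have "q * (X * cmod (wedge y c)) \<le> q * (Y * v + 4 * (X * C) * q * m)"
    using 6 q by (intro mult_left_mono) auto
  also have "\<dots> = (q * Y) * v + 4 * (q * (q * (X * C))) * m" by (simp add: algebra_simps)
  also have "\<dots> \<le> (4 * m) * v + 4 * (E * v) * m"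
    using 7 5 pos by (intro add_mono mult_right_mono mult_left_mono) auto
  also have "\<dots> \<le> 8 * E * m * v"
    using pos mult_right_mono[of 1 E "m * v"] by (simp add: algebra_simps)
  finally have 8: "q * (X * cmod (wedge y c)) \<le> 8 * E * m * v" .
  have "cmod (wedge y c) * max_norm (mat2_apply \<psi> x) \<le> cmod (wedge y c) * (2 * q * X)"
    using 1 by (intro mult_left_mono) auto
  also have "\<dots> = 2 * (q * (X * cmod (wedge y c)))" by (simp add: mult_ac)
  also have "\<dots> \<le> 2 * (8 * E * m * v)" using 8 by (rule mult_left_mono) simp
  finally show ?thesis by (simp add: E_def m_def v_def mult_ac)
qed

lemma finite_net_sphere:
  assumes "0 < r"
  shows "\<exists>E. finite E \<and> (\<forall>a\<in>E. max_norm a = 1) \<and>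
    (\<forall>x. x \<noteq> 0 \<longrightarrow> (\<exists>a\<in>E. cmod (wedge x a) \<le> r * (max_norm x * max_norm a)))"
proof -
  let ?S = "{z. max_norm z = 1}"
  have "0 < r / 2" using assms by simp
  moreover have "seq_compact ?S"
    using compact_max_norm_sphere by (simp only: compact_eq_seq_compact_metric)
  ultimately obtain E where E: "finite E" "E \<subseteq> ?S" "?S \<subseteq> (\<Union>x\<in>E. ball x (r / 2))"
    using seq_compact_imp_totally_bounded[of ?S] by blast
  have "\<exists>a\<in>E. cmod (wedge x a) \<le> r * (max_norm x * max_norm a)" if x: "x \<noteq> 0" for x
  proof -
    have m: "0 < max_norm x" using x by (simp add: max_norm_pos_iff)
    define w where "w = cscale (of_real (1 / max_norm x)) x"
    have w: "max_norm w = 1" using m by (simp add: w_def max_norm_cscale norm_divide)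
    then obtain a where a: "a \<in> E" "dist a w < r / 2" using E(3) by auto
    have a1: "max_norm a = 1" using a(1) E(2) by auto
    have "wedge w a = wedge (w - a) a" by (simp add: wedge_def algebra_simps)
    then have "cmod (wedge w a) \<le> 2 * max_norm (w - a)" using cmod_wedge_le[of "w - a" a] a1 by simp
    also have "max_norm (w - a) \<le> norm (w - a)"
      unfolding max_norm_def
      using norm_fst_le[of "fst (w - a)" "snd (w - a)"] norm_snd_le[of "snd (w - a)" "fst (w - a)"]
      by (simp only: prod.collapse max.bounded_iff)
    also have "norm (w - a) < r / 2" using a(2) by (simp add: dist_norm norm_minus_commute)
    finally have "cmod (wedge w a) \<le> r" by simp
    moreover have "cmod (wedge w a) = cmod (wedge x a) / max_norm x"
      using m by (simp add: w_def wedge_cscale_left norm_mult norm_divide)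
    ultimately show ?thesis using a(1) a1 m by (intro bexI[of _ a]) (simp_all add: field_simps)
  qed
  then show ?thesis using E(1,2) by (intro exI[of _ E]) auto
qed

lemma ln_max_norm_zoom_le:
  assumes \<psi>: "zooms a r \<psi>" and r: "0 < r" and w: "w \<noteq> 0"
    and near: "cmod (wedge w a) \<le> r * (max_norm w * max_norm a)"
  shows "ln (max_norm (mat2_apply \<psi> w)) \<le> ln 2 + ln r / 2 + ln (max_norm w)"
proof -
  have le: "max_norm (mat2_apply \<psi> w) \<le> 2 * sqrt r * max_norm w" and SL: "\<psi> \<in> SL2"
    using \<psi> near unfolding zooms_def by blast+
  have pos: "0 < max_norm w" "0 < max_norm (mat2_apply \<psi> w)"
    using w mat2_apply_nonzero[OF SL w] by (simp_all add: max_norm_pos_iff)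
  have "ln (max_norm (mat2_apply \<psi> w)) \<le> ln (2 * sqrt r * max_norm w)"
    using le pos r by (subst ln_le_cancel_iff) auto
  also have "\<dots> = ln 2 + ln r / 2 + ln (max_norm w)" using pos r by (simp add: ln_mult ln_sqrt)
  finally show ?thesis .
qed

context unimodular_forms
begin

text \<open>A fixed net of zooms works for bounded size: \<open>ln r / 2\<close> contributes
  \<open>- 5 * B - 4\<close>, of which \<open>4 * B\<close> pays for the height bound,
  \<open>B\<close> for \<open>\<delta> * max b 1\<close>, and the rest for
  \<open>1 + ln 2\<close>.\<close>

lemma cover_small:
  assumes B: "b \<le> B" "1 \<le> B" and \<delta>: "0 < \<delta>" "\<delta> \<le> 1"
    and E: "finite E" "\<forall>a\<in>E. max_norm a = 1"
      "\<forall>x. x \<noteq> 0 \<longrightarrow> (\<exists>a\<in>E. cmod (wedge x a) \<le> exp (- (10 * B + 8)) * (max_norm x * max_norm a))"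
  shows "\<exists>\<Psi>. length \<Psi> \<le> card E \<and> set \<Psi> \<subseteq> SL2 \<and>
    (\<forall>w. w \<noteq> 0 \<longrightarrow> (\<exists>\<psi>\<in>set \<Psi>. ln (max_norm (mat2_apply \<psi> w)) + \<delta> * max b 1 + 1 < h w))"
proof -
  define r where "r = exp (- (10 * B + 8))"
  have r: "0 < r" "r \<le> 2" using B by (auto simp: r_def intro: order_trans[of _ 1])
  define Z where "Z a = (SOME \<psi>. zooms a r \<psi>)" for a
  have Z: "zooms a r (Z a)" if "a \<in> E" for a
  proof -
    have "max_norm a = 1" using E(2) that by blast
    then show ?thesis unfolding Z_def by (rule someI_ex[OF exists_zoom_unit[OF _ r]])
  qed
  obtain es where es: "set es = E" "length es = card E" using E(1) by (metis finite_distinct_list distinct_card)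
  have "set (map Z es) \<subseteq> SL2" using Z es(1) unfolding zooms_def by auto
  moreover have "\<exists>\<psi>\<in>set (map Z es). ln (max_norm (mat2_apply \<psi> w)) + \<delta> * max b 1 + 1 < h w" if w: "w \<noteq> 0" for w
  proof -
    obtain a where a: "a \<in> E" "cmod (wedge w a) \<le> r * (max_norm w * max_norm a)"
      using E(3) w unfolding r_def by blast
    have "ln (max_norm (mat2_apply (Z a) w)) \<le> ln 2 + ln r / 2 + ln (max_norm w)"
      by (rule ln_max_norm_zoom_le[OF Z[OF a(1)] r(1) w a(2)])
    moreover have "ln r / 2 = - 5 * B - 4" by (simp add: r_def)
    moreover have "ln (max_norm w) - 4 * B \<le> h w" using height_bound[OF w] B(1) by linarith
    moreover have "\<delta> * max b 1 \<le> 1 * B" using \<delta> B by (intro mult_mono) auto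
    moreover have "ln (2::real) < 1" by (rule ln_2_less_1)
    ultimately show ?thesis using a(1) es(1) by (intro bexI[of _ "Z a"]) auto
  qed
  ultimately show ?thesis using es(2) by (intro exI[of _ "map Z es"]) simp
qed

text \<open>Contrapositive of \<open>log_size_le_height_excess\<close> for the conjugate, with
  \<open>M\<close> chosen such that \<open>C * (M + 1) = b - 2\<close>, which is below the assumed
  bound \<open>b - 1\<close>. The lower bound on \<open>b\<close> makes \<open>M\<close>
  nonnegative.\<close>

lemma conjugate_has_high_point:
  assumes G: "conjugate_forms d \<psi> F G" and min: "b - 1 \<le> log_size d G"
    and C: "C = 6 * real d + 32" and bC: "15 * C \<le> b"
  shows "\<exists>y. y \<noteq> 0 \<and> (b - 2) / C - 1 + ln (max_norm (mat2_apply \<psi> y)) < h y"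
proof (rule ccontr)
  assume neg: "\<not> ?thesis"
  interpret G: unimodular_forms d G by (rule conjugate_unimodular[OF G])
  have \<psi>: "\<psi> \<in> SL2" using G by (simp add: conjugate_forms_def)
  have C1: "1 \<le> C" by (simp add: C)
  have "log_size d G \<le> C * (((b - 2) / C - 1) + 1)"
    unfolding C
  proof (rule G.log_size_le_height_excess)
    show "0 \<le> (b - 2) / (6 * real d + 32) - 1"
      using bC C1 unfolding C[symmetric] by (simp add: field_simps)
    fix x :: "complex \<times> complex" assume x: "x \<noteq> 0"
    define y where "y = mat2_apply (mat2_inv \<psi>) x"
    have xy: "x = mat2_apply \<psi> y" by (simp add: y_def mat2_apply_inv[OF \<psi>])
    have y: "y \<noteq> 0" unfolding y_def by (rule mat2_apply_nonzero[OF mat2_inv_SL2[OF \<psi>] x])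
    have "h y \<le> (b - 2) / C - 1 + ln (max_norm (mat2_apply \<psi> y))" using neg y by (meson not_less)
    then show "hom_height d G x \<le> (b - 2) / (6 * real d + 32) - 1 + ln (max_norm x)"
      unfolding xy conjugate_height[OF G y] C .
  qed
  then show False using min C1 by simp
qed

lemma cover_large:
  assumes min: "\<And>\<psi> G. conjugate_forms d \<psi> F G \<Longrightarrow> b - 1 \<le> log_size d G"
    and C: "C = 6 * real d + 32" and bC: "15 * C \<le> b"
    and n: "128 * C \<le> real d ^ n" and J: "96 * C \<le> real J"
  shows "\<exists>\<Psi>. length \<Psi> \<le> 2 * d ^ n * Suc J \<and> set \<Psi> \<subseteq> SL2 \<and>
    (\<forall>w. w \<noteq> 0 \<longrightarrow> (\<exists>\<psi>\<in>set \<Psi>. ln (max_norm (mat2_apply \<psi> w)) + 1 / (4 * C) * max b 1 + 1 < h w))"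
proof -
  have C1: "1 \<le> C" by (simp add: C)
  then have b1: "15 \<le> b" using bC by linarith
  define k where "k = real d ^ n"
  have k: "0 < k" using d_pos by (simp add: k_def)
  \<comment> \<open>\<open>b / C\<close> is the main term in the excess of the high point; losses
    are counted in units of one eighth of it.\<close>
  define s where "s = b / (8 * C)"
  have s: "0 < s" using C1 b1 by (simp add: s_def)
  \<comment> \<open>By \<open>cmod_wedge_le\<close> a disc of radius 2 contains every point, so the
    first scale covers the sphere.\<close>
  define R where "R j = 2 * exp (- (real j * s))" for j
  have R: "0 < R j" "R j \<le> 2" for j using s by (auto simp: R_def)
  have R_Suc: "R (Suc j) = R j * exp (- s)" for j by (simp add: R_def algebra_simps flip: exp_add)
  obtain A :: "bool \<Rightarrow> (complex \<times> complex) list"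
    where len: "\<forall>i. length (A i) = d ^ n" and A': "\<forall>i. \<forall>a\<in>set (A i). a \<noteq> 0 \<and> h a = 0"
    and Lower: "\<forall>i x. x \<noteq> 0 \<longrightarrow> (\<forall>a\<in>set (A i). wedge x a \<noteq> 0) \<longrightarrow>
      (\<Sum>a\<leftarrow>A i. ln (cmod (wedge x a))) \<le> k * h x + 8 * b"
    and Upper: "\<forall>x. x \<noteq> 0 \<longrightarrow> (\<exists>i. (\<forall>a\<in>set (A i). wedge x a \<noteq> 0) \<and>
      k * h x \<le> (\<Sum>a\<leftarrow>A i. ln (cmod (wedge x a))) + 8 * b)"
    by (rule iterate_potentials[of n, folded k_def])
  have const: "(\<Sum>a\<leftarrow>A i. c) = k * c" for i c by (simp add: sum_list_triv len k_def)
  define L where "L = A True @ A False"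
  have AL: "a \<in> set L" if "a \<in> set (A i)" for a i using that by (cases i) (auto simp: L_def)
  have L0: "a \<noteq> 0" if "a \<in> set L" for a
  proof -
    have "a \<in> set (A True) \<or> a \<in> set (A False)" using that by (simp add: L_def)
    then show ?thesis using A' by blast
  qed
  define Z where "Z a j = (SOME \<psi>. zooms a (R j) \<psi>)" for a j
  have Z: "zooms a (R j) (Z a j)" if "a \<in> set L" for a j
    unfolding Z_def by (rule someI_ex[OF exists_zoom[OF L0[OF that] R]])
  define \<Psi> where "\<Psi> = map (\<lambda>(a, j). Z a j) (List.product L [0..<Suc J])"
  have "length \<Psi> = 2 * d ^ n * Suc J" by (simp add: \<Psi>_def L_def len)
  moreover have Z\<Psi>: "Z a j \<in> set \<Psi>" if "a \<in> set L" "j \<le> J" for a j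
    using that by (auto simp: \<Psi>_def)
  have "set \<Psi> \<subseteq> SL2"
  proof
    fix \<psi> assume "\<psi> \<in> set \<Psi>"
    then obtain a j where "a \<in> set L" "\<psi> = Z a j" by (auto simp: \<Psi>_def)
    then show "\<psi> \<in> SL2" using Z[of a j] by (simp add: zooms_def)
  qed
  moreover have "\<exists>\<psi>\<in>set \<Psi>. ln (max_norm (mat2_apply \<psi> w)) + 1 / (4 * C) * max b 1 + 1 < h w" if w: "w \<noteq> 0" for w
  proof -
    define near where "near j \<longleftrightarrow> (\<exists>a\<in>set L. cmod (wedge w a) \<le> R j * (max_norm w * max_norm a))" for j
    have ln2: "0 < ln (2::real)" "ln (2::real) < 1" using ln_2_less_1 by auto
    show ?thesis
    proof (cases "near J")
      case True
      then obtain a where a: "a \<in> set L" "cmod (wedge w a) \<le> R J * (max_norm w * max_norm a)"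
        by (auto simp: near_def)
      have "ln (max_norm (mat2_apply (Z a J) w)) \<le> ln 2 + ln (R J) / 2 + ln (max_norm w)"
        by (rule ln_max_norm_zoom_le[OF Z[OF a(1)] R(1) w a(2)])
      moreover have "ln (R J) = ln 2 - real J * s" by (simp add: R_def ln_mult)
      \<comment> \<open>Half of this is the gain from the smallest disc; it beats the height bound
        \<open>4 * b\<close> and the required excess.\<close>
      moreover have "12 * b \<le> real J * s"
        using mult_right_mono[OF J, of s] s C1 by (simp add: s_def field_simps)
      moreover have "ln (max_norm w) - 4 * b \<le> h w" using height_bound[OF w] by linarith
      moreover have "1 / (4 * C) * max b 1 \<le> 1 * b"
        using C1 b1 by (intro mult_mono) (auto simp: field_simps)
      ultimately have "ln (max_norm (mat2_apply (Z a J) w)) + 1 / (4 * C) * max b 1 + 1 < h w"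
        using ln2 b1 by linarith
      then show ?thesis using Z\<Psi>[OF a(1) order_refl] by blast
    next
      case False
      have "near 0"
      proof -
        define a where "a = hd (A True)"
        have "length (A True) \<noteq> 0" using len d_pos by simp
        then have "a \<in> set L" unfolding a_def by (intro AL[of _ True] hd_in_set) simp
        moreover have "cmod (wedge w a) \<le> R 0 * (max_norm w * max_norm a)"
          using cmod_wedge_le[of w a] by (simp add: R_def)
        ultimately show ?thesis unfolding near_def by blast
      qed
      \<comment> \<open>Between the largest discs, which contain \<open>w\<close>, and the smallest,
        which do not, there is a scale after which \<open>w\<close> has left all discs, those of
        both families.\<close>
      then obtain j where j: "j < J" "near j" "\<not> near (Suc j)"
        using ex_least_nat_less[of "\<lambda>j. \<not> near j" J] False by auto
      obtain a where a: "a \<in> set L" "cmod (wedge w a) \<le> R j * (max_norm w * max_norm a)"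
        using j(2) by (auto simp: near_def)
      have far: "R j * exp (- s) * (max_norm w * max_norm c) < cmod (wedge w c)" if "c \<in> set L" for c
        using j(3) that unfolding near_def R_Suc by (meson not_less)
      define \<psi> where "\<psi> = Z a j"
      have \<psi>: "zooms a (R j) \<psi>" using Z[OF a(1)] by (simp add: \<psi>_def)
      then have SL: "\<psi> \<in> SL2" by (simp add: zooms_def)
      obtain G where G: "conjugate_forms d \<psi> F G" using exists_conjugate_forms[OF SL] by blast
      obtain y where y: "y \<noteq> 0" "(b - 2) / C - 1 + ln (max_norm (mat2_apply \<psi> y)) < h y"
        using conjugate_has_high_point[OF G min[OF G] C bC] by blast
      have pos: "0 < max_norm (mat2_apply \<psi> y)" "0 < max_norm (mat2_apply \<psi> w)"
        using mat2_apply_nonzero[OF SL] y(1) w by (simp_all add: max_norm_pos_iff)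
      define \<rho> where "\<rho> = 4 * ln 2 + s + ln (max_norm (mat2_apply \<psi> y)) - ln (max_norm (mat2_apply \<psi> w))"
      obtain i where i: "\<forall>a\<in>set (A i). wedge y a \<noteq> 0"
        "k * h y \<le> (\<Sum>a\<leftarrow>A i. ln (cmod (wedge y a))) + 8 * b" using Upper y(1) by blast
      have wnz: "0 < cmod (wedge w c)" if "c \<in> set (A i)" for c
      proof -
        have "0 \<le> R j * exp (- s) * (max_norm w * max_norm c)" using R(1)[of j] by simp
        then show ?thesis using far[OF AL[OF that]] by linarith
      qed
      have "ln (cmod (wedge y c)) \<le> \<rho> + ln (cmod (wedge w c))" if c: "c \<in> set (A i)" for c
      proof -
        have yc: "0 < cmod (wedge y c)" using i(1) c by simp
        have "ln (cmod (wedge y c) * max_norm (mat2_apply \<psi> w)) \<le>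
            ln (16 * exp s * max_norm (mat2_apply \<psi> y) * cmod (wedge w c))"
          using zoom_ratio[OF \<psi> R(1) L0[OF a(1)] w _ a(2) far[OF AL[OF c]], of y] s yc pos wnz[OF c]
          by (subst ln_le_cancel_iff) auto
        moreover have "ln (16::real) = 4 * ln 2" using ln_realpow[of 2 4] by simp
        ultimately show ?thesis using yc pos wnz[OF c] by (simp add: ln_mult \<rho>_def)
      qed
      then have "(\<Sum>c\<leftarrow>A i. ln (cmod (wedge y c))) \<le> (\<Sum>c\<leftarrow>A i. \<rho> + ln (cmod (wedge w c)))"
        by (rule sum_list_mono)
      also have "\<dots> = k * \<rho> + (\<Sum>c\<leftarrow>A i. ln (cmod (wedge w c)))" by (simp only: sum_list_addf const)
      also have "(\<Sum>c\<leftarrow>A i. ln (cmod (wedge w c))) \<le> k * h w + 8 * b"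
      proof -
        have "\<forall>c\<in>set (A i). wedge w c \<noteq> 0" using wnz by fastforce
        then show ?thesis using Lower w by blast
      qed
      finally have "k * h y \<le> k * (\<rho> + h w) + 16 * b" using i(2) by (simp add: algebra_simps)
      \<comment> \<open>The choice of \<open>n\<close>: the potential errors at the two points,
        \<open>8 * b\<close> each, cost one \<open>s\<close> after division by
        \<open>k\<close>.\<close>
      also have "16 * b \<le> k * s"
      proof -
        have "128 * C * s \<le> k * s" using n s by (intro mult_right_mono) (auto simp: k_def)
        then show ?thesis using C1 by (simp add: s_def)
      qed
      finally have "k * h y \<le> k * (\<rho> + h w + s)" by (simp add: algebra_simps)
      then have hy: "h y \<le> \<rho> + h w + s" using k by simp
      \<comment> \<open>Of the \<open>8 * s\<close>, two are lost and two are the required excess.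
        The other four amount to at least \<open>15 / 2\<close>, which covers
        \<open>4 * ln 2\<close> and the constants; hence the 15 in the bound on
        \<open>b\<close>.\<close>
      have "(b - 2) / C = b / C - 2 / C" by (simp add: diff_divide_distrib)
      moreover have "b / C = 8 * s" using C1 by (simp add: s_def)
      moreover have "2 / C \<le> 1" using C1 by (simp add: C field_simps)
      moreover have "1 / (4 * C) * max b 1 = 2 * s" using C1 b1 by (simp add: s_def max_def)
      moreover have "15 / 8 \<le> s" using bC C1 by (simp add: s_def field_simps)
      ultimately have "ln (max_norm (mat2_apply \<psi> w)) + 1 / (4 * C) * max b 1 + 1 < h w"
        using hy y(2) ln2 unfolding \<rho>_def by linarith
      then show ?thesis using Z\<Psi>[OF a(1), of j] j(1) unfolding \<psi>_def by force
    qed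
  qed
  ultimately show ?thesis by (intro exI[of _ \<Psi>]) (simp del: split_paired_All)
qed

end

text \<open>Sizes below \<open>15 * C\<close> are treated with a fixed net, the others with
  preimages; \<open>C\<close>, \<open>n\<close>, \<open>J\<close> and the net depend on
  \<open>d\<close> alone.\<close>

lemma zoom_cover:
  assumes d: "2 \<le> d"
  shows "\<exists>\<delta>>0. \<exists>N. \<forall>F. unimodular_forms d F \<longrightarrow>
    (\<forall>\<psi> G. conjugate_forms d \<psi> F G \<longrightarrow> log_size d F - 1 \<le> log_size d G) \<longrightarrow>
    (\<exists>\<Psi>. length \<Psi> \<le> N \<and> set \<Psi> \<subseteq> SL2 \<and> (\<forall>w. w \<noteq> 0 \<longrightarrow>
      (\<exists>\<psi>\<in>set \<Psi>. ln (max_norm (mat2_apply \<psi> w)) + \<delta> * max (log_size d F) 1 + 1 < hom_height d F w)))"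
proof -
  define C where "C = 6 * real d + 32"
  have C1: "1 \<le> C" by (simp add: C_def)
  obtain n where n: "128 * C < real d ^ n" using real_arch_pow[of "real d" "128 * C"] d by auto
  define J where "J = nat \<lceil>96 * C\<rceil>"
  have J: "96 * C \<le> real J" by (simp add: J_def real_nat_ceiling_ge)
  obtain E where E: "finite E" "\<forall>a\<in>E. max_norm a = 1"
    "\<forall>x. x \<noteq> 0 \<longrightarrow> (\<exists>a\<in>E. cmod (wedge x a) \<le> exp (- (10 * (15 * C) + 8)) * (max_norm x * max_norm a))"
    using finite_net_sphere[of "exp (- (10 * (15 * C) + 8))"] by auto
  define N where "N = max (card E) (2 * d ^ n * Suc J)"
  define \<delta> where "\<delta> = 1 / (4 * C)"
  have \<delta>: "0 < \<delta>" "\<delta> \<le> 1" using C1 by (auto simp: \<delta>_def field_simps)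
  show ?thesis
  proof (intro exI[of _ \<delta>] exI[of _ N] conjI allI impI)
    fix F
    assume F: "unimodular_forms d F"
      and min: "\<forall>\<psi> G. conjugate_forms d \<psi> F G \<longrightarrow> log_size d F - 1 \<le> log_size d G"
    interpret unimodular_forms d F by (rule F)
    show "\<exists>\<Psi>. length \<Psi> \<le> N \<and> set \<Psi> \<subseteq> SL2 \<and> (\<forall>w. w \<noteq> 0 \<longrightarrow>
      (\<exists>\<psi>\<in>set \<Psi>. ln (max_norm (mat2_apply \<psi> w)) + \<delta> * max b 1 + 1 < h w))"
    proof (cases "15 * C \<le> b")
      case True
      from cover_large[OF _ C_def True less_imp_le[OF n] J] min obtain \<Psi> where
        "length \<Psi> \<le> 2 * d ^ n * Suc J" "set \<Psi> \<subseteq> SL2"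
        "\<forall>w. w \<noteq> 0 \<longrightarrow> (\<exists>\<psi>\<in>set \<Psi>. ln (max_norm (mat2_apply \<psi> w)) + \<delta> * max b 1 + 1 < h w)"
        unfolding \<delta>_def by blast
      then show ?thesis by (intro exI[of _ \<Psi>]) (simp add: N_def del: split_paired_All)
    next
      case False
      have "b \<le> 15 * C" "1 \<le> 15 * C" using False C1 by linarith+
      from cover_small[OF this \<delta> E] obtain \<Psi> where
        "length \<Psi> \<le> card E" "set \<Psi> \<subseteq> SL2"
        "\<forall>w. w \<noteq> 0 \<longrightarrow> (\<exists>\<psi>\<in>set \<Psi>. ln (max_norm (mat2_apply \<psi> w)) + \<delta> * max b 1 + 1 < h w)"
        by blast
      then show ?thesis by (intro exI[of _ \<Psi>]) (simp add: N_def del: split_paired_All)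
    qed
  qed (rule \<delta>(1))
qed

section \<open>From homogeneous lifts to rational maps on the sphere\<close>

text \<open>The error \<open>4 * b / d ^ n\<close> is uniform in \<open>z\<close>. Continuity makes
  the sets of large excess open.\<close>

lemma (in unimodular_forms) continuous_on_height: "continuous_on {z. z \<noteq> 0} h"
proof (rule uniform_limit_theorem)
  have fn: "continuous_on UNIV (f ^^ n)" for n
  proof (induction n)
    case (Suc n)
    have "continuous_on UNIV f" unfolding forms_map_def form_def by (intro continuous_intros)
    then show ?case using continuous_on_compose2[OF _ Suc, of UNIV f] by (simp add: o_def)
  qed (simp add: continuous_on_id)
  have "continuous_on UNIV max_norm" unfolding max_norm_def by (intro continuous_intros)
  then have "continuous_on {z. z \<noteq> 0} (\<lambda>z. max_norm ((f ^^ n) z))" for n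
    by (rule continuous_on_compose2[OF _ continuous_on_subset[OF fn]]) auto
  moreover have "max_norm ((f ^^ n) z) \<noteq> 0" if "z \<in> {z. z \<noteq> 0}" for n z
    using max_norm_pos[OF funpow_nz, of z n] that by simp
  ultimately have "continuous_on {z. z \<noteq> 0} (\<lambda>z. ln (max_norm ((f ^^ n) z)) / real d ^ n)" for n
    using d_pos by (intro continuous_on_divide continuous_on_ln continuous_on_const ballI) auto
  then show "\<forall>\<^sub>F n in sequentially. continuous_on {z. z \<noteq> 0} (\<lambda>z. ln (max_norm ((f ^^ n) z)) / real d ^ n)"
    by simp
  show "uniform_limit {z. z \<noteq> 0} (\<lambda>n z. ln (max_norm ((f ^^ n) z)) / real d ^ n) h sequentially"
  proof (rule uniform_limitI)
    fix e :: real assume e: "0 < e"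
    have "(\<lambda>n. 4 * b * (1 / real d) ^ n) \<longlonglongrightarrow> 0"
      using d by (intro tendsto_mult_right_zero LIMSEQ_power_zero) auto
    then have "\<forall>\<^sub>F n in sequentially. 4 * b * (1 / real d) ^ n < e"
      using e by (rule order_tendstoD)
    then show "\<forall>\<^sub>F n in sequentially. \<forall>z\<in>{z. z \<noteq> 0}. dist (ln (max_norm ((f ^^ n) z)) / real d ^ n) (h z) < e"
    proof eventually_elim
      case (elim n)
      show ?case
      proof
        fix z :: "complex \<times> complex" assume "z \<in> {z. z \<noteq> 0}"
        then have z: "z \<noteq> 0" by simp
        have "ln (max_norm ((f ^^ n) z)) / real d ^ n - h z =
            - ((real d ^ n * h z - ln (max_norm ((f ^^ n) z))) / real d ^ n)"
          using d_pos by (simp add: diff_divide_distrib)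
        then have "dist (ln (max_norm ((f ^^ n) z)) / real d ^ n) (h z) =
            \<bar>real d ^ n * h z - ln (max_norm ((f ^^ n) z))\<bar> / real d ^ n"
          by (simp add: dist_real_def abs_divide)
        also have "\<dots> \<le> 4 * b / real d ^ n"
          using height_funpow_bound[OF z, of n] by (intro divide_right_mono) auto
        finally show "dist (ln (max_norm ((f ^^ n) z)) / real d ^ n) (h z) < e"
          using elim by (simp add: power_divide)
      qed
    qed
  qed
qed simp

lemma proj_cscale: "z \<noteq> 0 \<Longrightarrow> c \<noteq> 0 \<Longrightarrow> proj (cscale c z) = proj z"
  using proj_eq_iff[of z "cscale c z"] by auto

text \<open>The resultant is homogeneous of degree \<open>2 * d\<close> in the coefficients, hence
  the root of this order.\<close>

lemma exists_unimodular_lift: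
  assumes d: "2 \<le> d" and f: "rational_map d f"
  shows "\<exists>F. unimodular_forms d F \<and> is_lift d F f"
proof -
  obtain p q where F: "is_lift d (p, q) f" using f by (auto simp: rational_map_def)
  have deg: "degree p \<le> d" "degree q \<le> d" and R: "Res_forms d (p, q) \<noteq> 0"
    and map: "\<And>z. z \<noteq> 0 \<Longrightarrow> f (proj z) = proj (forms_map d (p, q) z)"
    using F by (auto simp: is_lift_def)
  define t where "t = root (2 * d) (1 / cmod (Res_forms d (p, q)))"
  have t: "0 < t" "t ^ (2 * d) = 1 / cmod (Res_forms d (p, q))"
    using R d by (auto simp: t_def)
  define G where "G = (Polynomial.smult (of_real t) p, Polynomial.smult (of_real t) q)"
  have "cmod (Res_forms d G) = 1"
    using t R by (simp add: G_def Res_forms_smult norm_mult norm_power)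
  moreover have "degree (fst G) \<le> d" "degree (snd G) \<le> d"
    using deg by (auto simp: G_def intro: order_trans[OF degree_smult_le])
  moreover have "f (proj z) = proj (forms_map d G z)" if z: "z \<noteq> 0" for z
    using map[OF z] proj_cscale[OF forms_map_nonzero[OF _ R z], of "of_real t"] t(1) d
    by (simp add: G_def forms_map_smult)
  ultimately show ?thesis
    using d by (intro exI[of _ G]) (auto simp: unimodular_forms_def is_lift_def)
qed

lemma is_lift_conjugate:
  assumes d: "2 \<le> d" and F: "is_lift d F f" "unimodular_forms d F" and G: "conjugate_forms d \<phi> F G"
  shows "is_lift d G (moebius \<phi> \<circ> f \<circ> inv_into UNIV (moebius \<phi>))"
proof -
  interpret F: unimodular_forms d F by (rule F(2))
  interpret G: unimodular_forms d G by (rule F.conjugate_unimodular[OF G])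
  have \<phi>: "\<phi> \<in> SL2" and conj: "\<And>z. forms_map d G (mat2_apply \<phi> z) = mat2_apply \<phi> (forms_map d F z)"
    using G by (auto simp: conjugate_forms_def)
  have "(moebius \<phi> \<circ> f \<circ> inv_into UNIV (moebius \<phi>)) (proj z) = proj (forms_map d G z)" if z: "z \<noteq> 0" for z
  proof -
    define w where "w = mat2_apply (mat2_inv \<phi>) z"
    have w: "w \<noteq> 0" unfolding w_def by (rule mat2_apply_nonzero[OF mat2_inv_SL2[OF \<phi>] z])
    have zw: "z = mat2_apply \<phi> w" by (simp add: w_def mat2_apply_inv[OF \<phi>])
    have "proj z = moebius \<phi> (proj w)" by (simp add: zw moebius_proj[OF \<phi> w])
    then have "inv_into UNIV (moebius \<phi>) (proj z) = proj w"
      using bij_moebius[OF \<phi>] by (simp add: bij_is_inj)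
    moreover have "f (proj w) = proj (forms_map d F w)" using F(1) w unfolding is_lift_def by blast
    moreover have "moebius \<phi> (proj (forms_map d F w)) = proj (forms_map d G z)"
      using moebius_proj[OF \<phi> F.f_nz[OF w]] by (simp add: zw conj)
    ultimately show ?thesis by simp
  qed
  then show ?thesis using G.deg G.Res_nz unfolding is_lift_def by blast
qed

lemma wedge_rep_nonzero:
  assumes "x \<noteq> y"
  shows "wedge (rep_cp1 x) (rep_cp1 y) \<noteq> 0"
proof
  assume "wedge (rep_cp1 x) (rep_cp1 y) = 0"
  then obtain c where c: "rep_cp1 x = cscale c (rep_cp1 y)"
    using wedge_eq_0_imp_proportional[OF _ rep_cp1_nonzero] by blast
  have "c \<noteq> 0"
  proof
    assume "c = 0"
    then have "rep_cp1 x = 0" using c by simp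
    then show False by simp
  qed
  then have "proj (rep_cp1 x) = proj (rep_cp1 y)" using c proj_cscale[OF rep_cp1_nonzero] by metis
  then show False using assms by simp
qed

theorem theorem6p2:
  fixes d :: nat
  assumes "d \<ge> 2"
  shows "\<exists>\<delta>::real. \<exists>N::nat. \<delta> > 0 \<and> N > 0 \<and>
    (\<forall>f :: cp1 \<Rightarrow> cp1. rational_map d f \<longrightarrow>
      (\<exists>U :: nat \<Rightarrow> cp1 set.
        (\<forall>i\<in>{1..N}. open (U i)) \<and>
        (\<Union>i\<in>{1..N}. U i) = UNIV \<and>
        (\<forall>i\<in>{1..N}. \<forall>x\<in>U i. \<forall>y\<in>U i.
           green d f x y > ereal (\<delta> * max (- ln (abs_res d f)) 1))))"
proof -
  have d0: "0 < d" using assms by simp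
  obtain \<delta> N where \<delta>: "0 < \<delta>" and cover: "\<forall>F. unimodular_forms d F \<longrightarrow>
    (\<forall>\<psi> G. conjugate_forms d \<psi> F G \<longrightarrow> log_size d F - 1 \<le> log_size d G) \<longrightarrow>
    (\<exists>\<Psi>. length \<Psi> \<le> N \<and> set \<Psi> \<subseteq> SL2 \<and> (\<forall>w. w \<noteq> 0 \<longrightarrow>
      (\<exists>\<psi>\<in>set \<Psi>. ln (max_norm (mat2_apply \<psi> w)) + \<delta> * max (log_size d F) 1 + 1 < hom_height d F w)))"
    using zoom_cover[OF assms] by blast
  \<comment> \<open>\<open>Suc N\<close> makes the number of sets positive even for
    \<open>N = 0\<close>.\<close>
  have main: "\<exists>U :: nat \<Rightarrow> cp1 set. (\<forall>i\<in>{1..Suc N}. open (U i)) \<and> (\<Union>i\<in>{1..Suc N}. U i) = UNIV \<and>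
      (\<forall>i\<in>{1..Suc N}. \<forall>x\<in>U i. \<forall>y\<in>U i. green d f x y > ereal (\<delta> / real d * max (- ln (abs_res d f)) 1))"
    if f: "rational_map d f" for f
  proof -
    obtain F where F: "unimodular_forms d F" "is_lift d F f" using exists_unimodular_lift[OF assms f] by blast
    interpret F: unimodular_forms d F by (rule F(1))
    define V where "V \<phi> = abs_Res d (moebius \<phi> \<circ> f \<circ> inv_into UNIV (moebius \<phi>))" for \<phi>
    define c where "c = 2 * real d * ln (2 * (real d + 1))"
    have V: "0 < V \<phi>" "ln (V \<phi>) = c - 2 * real d * log_size d G" "0 \<le> log_size d G"
      if G: "conjugate_forms d \<phi> F G" for \<phi> G
    proof -
      interpret G: unimodular_forms d G by (rule F.conjugate_unimodular[OF G])
      have "coeff_norm d G \<noteq> 0" using G.one_le_2D by auto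
      then have K: "0 < coeff_norm d G" using coeff_norm_nonneg[of d G] by simp
      have eq: "V \<phi> = 1 / coeff_norm d G ^ (2 * d)"
        unfolding V_def abs_Res_eq[OF d0 is_lift_conjugate[OF assms F(2,1) G]] abs_Res_lift_def
        by (simp add: G.Res)
      then show "0 < V \<phi>" using K by simp
      have "log_size d G = ln (2 * (real d + 1)) + ln (coeff_norm d G)"
        unfolding log_size_def using K by (intro ln_mult_pos) auto
      moreover have "ln (V \<phi>) = - (2 * real d * ln (coeff_norm d G))"
        using K by (simp add: eq ln_div ln_realpow)
      ultimately show "ln (V \<phi>) = c - 2 * real d * log_size d G"
        by (simp add: c_def algebra_simps)
      show "0 \<le> log_size d G" by (rule G.b_nonneg)
    qed
    have V_le: "V \<phi> \<le> exp c" if \<phi>: "\<phi> \<in> SL2" for \<phi>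
    proof -
      obtain G where G: "conjugate_forms d \<phi> F G" using exists_conjugate_forms[OF \<phi>] by blast
      have "0 \<le> 2 * real d * log_size d G" using V(3)[OF G] by simp
      then have "ln (V \<phi>) \<le> c" using V(2)[OF G] by linarith
      then have "exp (ln (V \<phi>)) \<le> exp c" by simp
      then show ?thesis using V(1)[OF G] by simp
    qed
    \<comment> \<open>Sizes are nonnegative, so the supremum is over a bounded set; for an unbounded
      one \<open>SUP\<close> would be an unspecified value.\<close>
    have bdd: "bdd_above (V ` SL2)" using V_le by (intro bdd_aboveI2)
    have ne: "(1, 0, 0, 1) \<in> SL2" by (simp add: SL2_def)
    have abs_res: "abs_res d f = (SUP \<phi>\<in>SL2. V \<phi>)" by (simp add: abs_res_def V_def)
    have V_res: "V \<phi> \<le> abs_res d f" if "\<phi> \<in> SL2" for \<phi>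
      unfolding abs_res by (rule cSUP_upper[OF that bdd])
    obtain G1 where "conjugate_forms d (1, 0, 0, 1) F G1" using exists_conjugate_forms[OF ne] by blast
    then have res_pos: "0 < abs_res d f" using V(1) V_res[OF ne] by fastforce
    \<comment> \<open>A near-maximizer suffices: the factor \<open>exp (- 1)\<close> costs at most
      \<open>1 / (2 * d)\<close> in the size, less than the slack 1 that \<open>cover\<close>
      allows.\<close>
    have "abs_res d f * exp (- 1) < abs_res d f * 1"
      using res_pos by (intro mult_strict_left_mono) auto
    then have "abs_res d f * exp (- 1) < (SUP \<phi>\<in>SL2. V \<phi>)" by (simp only: abs_res mult_1_right)
    moreover have "SL2 \<noteq> {}" using ne by blast
    ultimately obtain \<phi> where \<phi>: "\<phi> \<in> SL2" "abs_res d f * exp (- 1) < V \<phi>"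
      using less_cSUP_iff[OF _ bdd, of "abs_res d f * exp (- 1)"] by blast
    obtain G where G: "conjugate_forms d \<phi> F G" using exists_conjugate_forms[OF \<phi>(1)] by blast
    interpret G: unimodular_forms d G by (rule F.conjugate_unimodular[OF G])
    define b where "b = log_size d G"
    have "ln (abs_res d f * exp (- 1)) < ln (V \<phi>)"
      using \<phi>(2) res_pos V(1)[OF G] by (subst ln_less_cancel_iff) auto
    then have near: "ln (abs_res d f) - 1 < c - 2 * real d * b"
      using res_pos by (simp add: ln_mult V(2)[OF G] b_def)
    have min: "b - 1 \<le> log_size d G'" if G': "conjugate_forms d \<psi> G G'" for \<psi> G'
    proof -
      have conj: "conjugate_forms d (mat2_mult \<psi> \<phi>) F G'" by (rule conjugate_forms_trans[OF G G'])
      then have "V (mat2_mult \<psi> \<phi>) \<le> abs_res d f" by (intro V_res) (simp add: conjugate_forms_def)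
      then have "c - 2 * real d * log_size d G' \<le> ln (abs_res d f)"
        using V(1,2)[OF conj] res_pos by (metis ln_le_cancel_iff)
      then have "2 * real d * (b - log_size d G') < 1" using near by (simp add: algebra_simps)
      then have "\<not> 1 < b - log_size d G'"
        using assms mult_mono[of 1 "2 * real d" 1 "b - log_size d G'"] by fastforce
      then show ?thesis by simp
    qed
    have R_le: "max (- ln (abs_res d f)) 1 \<le> 2 * real d * max b 1"
    proof -
      have "ln (V \<phi>) \<le> ln (abs_res d f)" using V_res[OF \<phi>(1)] V(1)[OF G] res_pos by simp
      moreover have "0 \<le> c" using d0 by (simp add: c_def)
      ultimately have "- ln (abs_res d f) \<le> 2 * real d * b" using V(2)[OF G] by (simp add: b_def)
      also have "\<dots> \<le> 2 * real d * max b 1" by (intro mult_left_mono) auto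
      finally have "- ln (abs_res d f) \<le> 2 * real d * max b 1" .
      moreover have "1 * 1 \<le> 2 * real d * max b 1" using d0 by (intro mult_mono) auto
      ultimately show ?thesis by simp
    qed
    obtain \<Psi> where \<Psi>: "length \<Psi> \<le> N" "set \<Psi> \<subseteq> SL2"
      "\<forall>w. w \<noteq> 0 \<longrightarrow> (\<exists>\<psi>\<in>set \<Psi>. ln (max_norm (mat2_apply \<psi> w)) + \<delta> * max b 1 + 1 < hom_height d G w)"
      using cover G.unimodular_forms_axioms min unfolding b_def by blast
    \<comment> \<open>The zooms are found for the conjugate \<open>G\<close>; invariance of the
      height expresses them through \<open>F\<close>, with \<open>\<phi>\<close> moved into the
      norm.\<close>
    define excess where "excess \<psi> z = hom_height d F z - ln (max_norm (mat2_apply \<psi> (mat2_apply \<phi> z)))" for \<psi> z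
    define T where "T = \<delta> * max b 1 + 1"
    define W where "W \<psi> = {x. T < excess \<psi> (rep_cp1 x)}" for \<psi>
    have nz: "mat2_apply \<psi> (mat2_apply \<phi> z) \<noteq> 0" if "\<psi> \<in> SL2" "z \<noteq> 0" for \<psi> z
      using mat2_apply_nonzero \<phi>(1) that by blast
    have openW: "open (W \<psi>)" if \<psi>: "\<psi> \<in> SL2" for \<psi>
    proof -
      \<comment> \<open>Scaling \<open>z\<close> adds the same logarithm to the height and to the
        logarithmic norm, so the excess descends to the sphere.\<close>
      have "excess \<psi> (rep_cp1 (proj z)) = excess \<psi> z" if z: "z \<noteq> 0" for z
      proof -
        obtain a where a: "a \<noteq> 0" "rep_cp1 (proj z) = cscale a z"
          using proj_eq_iff[OF z rep_cp1_nonzero, of "proj z"] by auto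
        show ?thesis
          using F.height_cscale[OF z a(1)] a max_norm_pos[OF nz[OF \<psi> z]]
          by (simp add: excess_def mat2_apply_cscale max_norm_cscale ln_mult)
      qed
      then have "{z. z \<noteq> 0 \<and> proj z \<in> W \<psi>} = {z. z \<noteq> 0} \<inter> excess \<psi> -` {T<..}"
        by (auto simp: W_def simp del: split_paired_All)
      moreover have "open ({z. z \<noteq> 0} \<inter> excess \<psi> -` {T<..})"
      proof (rule continuous_open_preimage)
        have "continuous_on UNIV max_norm" unfolding max_norm_def by (intro continuous_intros)
        then have "continuous_on {z. z \<noteq> 0} (\<lambda>z. max_norm (mat2_apply \<psi> (mat2_apply \<phi> z)))"
          by (rule continuous_on_compose2[OF _ continuous_on_compose2[OF
              continuous_on_mat2_apply[of UNIV] continuous_on_mat2_apply]]) auto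
        moreover have "max_norm (mat2_apply \<psi> (mat2_apply \<phi> z)) \<noteq> 0" if "z \<in> {z. z \<noteq> 0}" for z
          using max_norm_pos[OF nz[OF \<psi>], of z] that by simp
        ultimately show "continuous_on {z. z \<noteq> 0} (excess \<psi>)"
          unfolding excess_def by (intro continuous_on_diff F.continuous_on_height continuous_on_ln ballI)
        show "open {z :: complex \<times> complex. z \<noteq> 0}" by (rule open_Collect_neq) (intro continuous_intros)+
      qed simp
      ultimately show ?thesis unfolding open_cp1_def by simp
    qed
    define U where "U i = (if i - 1 < length \<Psi> then W (\<Psi> ! (i - 1)) else {})" for i
    have "open (U i)" for i
    proof (cases "i - 1 < length \<Psi>")
      case True
      then have "\<Psi> ! (i - 1) \<in> SL2" using \<Psi>(2) nth_mem by blast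
      then show ?thesis using True openW by (simp only: U_def if_True)
    qed (simp add: U_def)
    moreover have "(\<Union>i\<in>{1..Suc N}. U i) = UNIV"
    proof (intro equalityI subsetI UNIV_I)
      fix x
      obtain \<psi> where \<psi>: "\<psi> \<in> set \<Psi>"
        "ln (max_norm (mat2_apply \<psi> (mat2_apply \<phi> (rep_cp1 x)))) + \<delta> * max b 1 + 1
          < hom_height d G (mat2_apply \<phi> (rep_cp1 x))"
        using \<Psi>(3) mat2_apply_nonzero[OF \<phi>(1) rep_cp1_nonzero] by blast
      then have "x \<in> W \<psi>"
        using F.conjugate_height[OF G rep_cp1_nonzero, of x] by (simp add: W_def excess_def T_def)
      moreover obtain j where "j < length \<Psi>" "\<psi> = \<Psi> ! j" using \<psi>(1) by (metis in_set_conv_nth)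
      ultimately have "x \<in> U (Suc j)" "Suc j \<in> {1..Suc N}" using \<Psi>(1) by (auto simp: U_def)
      then show "x \<in> (\<Union>i\<in>{1..Suc N}. U i)" by blast
    qed
    moreover have "green d f x y > ereal (\<delta> / real d * max (- ln (abs_res d f)) 1)"
      if xy: "x \<in> U i" "y \<in> U i" for i x y
    proof (cases "x = y")
      case True
      then show ?thesis by (simp add: green_def)
    next
      case False
      define u where "u = rep_cp1 x"
      define v where "v = rep_cp1 y"
      have uv: "u \<noteq> 0" "v \<noteq> 0" "proj u = x" "proj v = y" by (simp_all add: u_def v_def)
      obtain \<psi> where \<psi>: "\<psi> \<in> SL2" "x \<in> W \<psi>" "y \<in> W \<psi>"
      proof (cases "i - 1 < length \<Psi>")
        case True
        then have "\<Psi> ! (i - 1) \<in> SL2" using \<Psi>(2) nth_mem by blast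
        then show ?thesis using that xy True unfolding U_def by simp
      qed (use xy in \<open>simp add: U_def\<close>)
      define u' where "u' = mat2_apply \<psi> (mat2_apply \<phi> u)"
      define v' where "v' = mat2_apply \<psi> (mat2_apply \<phi> v)"
      have pos: "0 < max_norm u'" "0 < max_norm v'"
        using nz[OF \<psi>(1)] uv by (simp_all add: u'_def v'_def max_norm_pos_iff)
      have w: "wedge u' v' = wedge u v" by (simp add: u'_def v'_def wedge_mat2_apply \<psi>(1) \<phi>(1))
      have w0: "0 < cmod (wedge u v)" using wedge_rep_nonzero[OF False] by (simp add: u_def v_def)
      have "ln (cmod (wedge u v)) \<le> ln (2 * max_norm u' * max_norm v')"
        using cmod_wedge_le[of u' v'] w0 pos unfolding w by (subst ln_le_cancel_iff) auto
      also have "\<dots> = ln 2 + ln (max_norm u') + ln (max_norm v')" using pos by (simp add: ln_mult)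
      finally have 1: "ln (cmod (wedge u v)) \<le> ln 2 + ln (max_norm u') + ln (max_norm v')" .
      have 2: "T < hom_height d F u - ln (max_norm u')" "T < hom_height d F v - ln (max_norm v')"
        using \<psi>(2,3) by (simp_all add: W_def excess_def u_def v_def u'_def v'_def)
      have "green d f x y = ereal (green_lift d F u v)"
        using green_eq[OF assms F(2) uv(1,2)] False uv(3,4) by simp
      also have "green_lift d F u v = - ln (cmod (wedge u v)) + hom_height d F u + hom_height d F v"
        by (simp add: green_lift_def wedge_def F.Res)
      finally have g: "green d f x y = ereal \<dots>" .
      have "\<delta> / real d * max (- ln (abs_res d f)) 1 \<le> \<delta> / real d * (2 * real d * max b 1)"
        using R_le \<delta> by (intro mult_left_mono) auto
      also have "\<dots> = 2 * (\<delta> * max b 1)" using d0 by simp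
      finally have "\<delta> / real d * max (- ln (abs_res d f)) 1 \<le> 2 * (\<delta> * max b 1)" .
      \<comment> \<open>The two summands 1 contributed by \<open>T\<close> exceed the
        \<open>ln 2\<close> that comes from \<open>cmod_wedge_le\<close>.\<close>
      then have "\<delta> / real d * max (- ln (abs_res d f)) 1 <
          - ln (cmod (wedge u v)) + hom_height d F u + hom_height d F v"
        using 1 2 ln_2_less_1 unfolding T_def by linarith
      then show ?thesis unfolding g by simp
    qed
    ultimately show ?thesis by (intro exI[of _ U]) blast
  qed
  have "0 < \<delta> / real d" using \<delta> d0 by simp
  then show ?thesis using main by (intro exI[of _ "\<delta> / real d"] exI[of _ "Suc N"]) blast
qed

end
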